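(* Let $p$ be a prime, let $S$ be a free pro-$p$ group and let $n\geq 1$. Then: (a) $S_{(n)}$ is the intersection of the kernels of all continuous homomorphisms $\rho\colon S\to\mathrm{U}_n(\mathbb{F}_p)$; (b) $S_n$ is the intersection of the kernels of all continuous homomorphisms $\rho\colon S\to\mathrm{U}_n(\mathbb{Z}_p)$; (c) $S^{(n)}$ is the intersection of the kernels of all continuous homomorphisms $\rho\colon S\to\mathrm{U}_{k+1}(\mathbb{Z}/p^{n-k}\mathbb{Z})$, where $k$ ranges over $1,\ldots,n-1$.
   Context: For a commutative unital ring $\Lambda$, $\mathrm{U}_m(\Lambda)$ is the group of upper-triangular unipotent $m\times m$ matrices over $\Lambda$ (with its natural profinite topology for $\Lambda=\mathbb{Z}_p$). For a profinite group $G$: the descending central series is $G_1=G$, $G_{i+1}=[G_i,G]$; the descending $p$-central series is $G^{(1)}=G$, $G^{(i+1)}=(G^{(i)})^p[G^{(i)},G]$; the $p$-Zassenhaus filtration is $G_{(1)}=G$, $G_{(n)}=G_{(\lceil n/p\rceil)}^p\prod_{i+j=n}[G_{(i)},G_{(j)}]$. Here $[H,K]$ is the closed subgroup generated by commutators $x^{-1}y^{-1}xy$ ($x\in H,y\in K$) and $H^p$ the closed subgroup generated by $p$-th powers. *)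

theory Defs
  imports "HOL-Analysis.Analysis" "HOL-Algebra.Algebra" "HOL-Number_Theory.Residues"
begin

definition topological_group :: "('a, 'b) monoid_scheme \<Rightarrow> 'a topology \<Rightarrow> bool" where
  "topological_group G T \<longleftrightarrow> group G \<and> topspace T = carrier G \<and>
     continuous_map (prod_topology T T) T (\<lambda>(x, y). x \<otimes>\<^bsub>G\<^esub> y) \<and>
     continuous_map T T (\<lambda>x. inv\<^bsub>G\<^esub> x)"

definition profinite_group :: "('a, 'b) monoid_scheme \<Rightarrow> 'a topology \<Rightarrow> bool" where
  "profinite_group G T \<longleftrightarrow> topological_group G T \<and> compact_space T \<and> Hausdorff_space T \<and>
     (\<forall>x\<in>topspace T. connected_component_of_set T x = {x})"

definition pro_p_group :: "nat \<Rightarrow> ('a, 'b) monoid_scheme \<Rightarrow> 'a topology \<Rightarrow> bool" where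
  "pro_p_group p G T \<longleftrightarrow> profinite_group G T \<and>
     (\<forall>N. openin T N \<and> normal N G \<longrightarrow> (\<exists>e::nat. card (rcosets\<^bsub>G\<^esub> N) = p ^ e))"

text \<open>Free pro-p group on a subset X converging to 1 (Ribes--Zalesskii): universal
  property tested against all finite p-groups (represented with carrier in nat),
  which for a pro-p group is equivalent to the universal property for all pro-p groups.\<close>
definition free_pro_p_group :: "nat \<Rightarrow> ('a, 'b) monoid_scheme \<Rightarrow> 'a topology \<Rightarrow> bool" where
  "free_pro_p_group p S T \<longleftrightarrow> pro_p_group p S T \<and>
     (\<exists>Y. Y \<subseteq> carrier S \<and>
        (\<forall>U. openin T U \<and> \<one>\<^bsub>S\<^esub> \<in> U \<longrightarrow> finite (Y - U)) \<and>
        (\<forall>H :: nat monoid. \<forall>f. group H \<and> finite (carrier H) \<and> (\<exists>e::nat. card (carrier H) = p ^ e) \<and>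
            (\<forall>x\<in>Y. f x \<in> carrier H) \<and> finite {x\<in>Y. f x \<noteq> \<one>\<^bsub>H\<^esub>} \<longrightarrow>
           (\<exists>\<phi>. \<phi> \<in> hom S H \<and> continuous_map T (discrete_topology (carrier H)) \<phi> \<and>
                 (\<forall>x\<in>Y. \<phi> x = f x) \<and>
                 (\<forall>\<psi>. \<psi> \<in> hom S H \<and> continuous_map T (discrete_topology (carrier H)) \<psi> \<and>
                       (\<forall>x\<in>Y. \<psi> x = f x) \<longrightarrow> (\<forall>s\<in>carrier S. \<psi> s = \<phi> s)))))"

definition closed_gen :: "('a, 'b) monoid_scheme \<Rightarrow> 'a topology \<Rightarrow> 'a set \<Rightarrow> 'a set" where
  "closed_gen G T A = T closure_of (generate G A)"

definition comm :: "('a, 'b) monoid_scheme \<Rightarrow> 'a \<Rightarrow> 'a \<Rightarrow> 'a" where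
  "comm G x y = inv\<^bsub>G\<^esub> x \<otimes>\<^bsub>G\<^esub> inv\<^bsub>G\<^esub> y \<otimes>\<^bsub>G\<^esub> x \<otimes>\<^bsub>G\<^esub> y"

definition commsub :: "('a, 'b) monoid_scheme \<Rightarrow> 'a topology \<Rightarrow> 'a set \<Rightarrow> 'a set \<Rightarrow> 'a set" where
  "commsub G T H K = closed_gen G T {comm G x y | x y. x \<in> H \<and> y \<in> K}"

definition ppow :: "('a, 'b) monoid_scheme \<Rightarrow> 'a topology \<Rightarrow> nat \<Rightarrow> 'a set \<Rightarrow> 'a set" where
  "ppow G T p H = closed_gen G T {x [^]\<^bsub>G\<^esub> p | x. x \<in> H}"

section \<open>Filtrations (indexed from 1; index 0 is a junk value equal to G)\<close>

fun lower_central :: "('a, 'b) monoid_scheme \<Rightarrow> 'a topology \<Rightarrow> nat \<Rightarrow> 'a set" where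
  "lower_central G T 0 = carrier G"
| "lower_central G T (Suc i) =
     (if i = 0 then carrier G else commsub G T (lower_central G T i) (carrier G))"

text \<open>Products of closed (normal) subgroups are taken as the closed subgroup generated
  by their union.\<close>
fun p_central :: "nat \<Rightarrow> ('a, 'b) monoid_scheme \<Rightarrow> 'a topology \<Rightarrow> nat \<Rightarrow> 'a set" where
  "p_central p G T 0 = carrier G"
| "p_central p G T (Suc i) =
     (if i = 0 then carrier G
      else closed_gen G T (ppow G T p (p_central p G T i) \<union> commsub G T (p_central p G T i) (carrier G)))"

text \<open>p-Zassenhaus filtration; (n + p - 1) div p is the ceiling of n/p.
  (The case p <= 1 is junk, irrelevant for primes.)\<close>
lemma ceil_div_less:
  fixes n p :: nat
  assumes "\<not> (n \<le> 1 \<or> p \<le> 1)"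
  shows "(n + p - 1) div p < n"
proof -
  have n2: "n \<ge> 2" and p2: "p \<ge> 2" using assms by auto
  have "n * p = n * (p - 1) + n" using p2 by (cases p) auto
  also have "n * (p - 1) \<ge> 2 * (p - 1)" using n2 by simp
  then have "n * (p - 1) + n \<ge> p + n" using p2 by linarith
  finally have "n + p - 1 < n * p" using n2 by linarith
  then show ?thesis using p2 by (simp add: div_less_iff_less_mult)
qed

function zassenhaus :: "nat \<Rightarrow> ('a, 'b) monoid_scheme \<Rightarrow> 'a topology \<Rightarrow> nat \<Rightarrow> 'a set" where
  "zassenhaus p G T n =
     (if n \<le> 1 \<or> p \<le> 1 then carrier G
      else closed_gen G T (ppow G T p (zassenhaus p G T ((n + p - 1) div p)) \<union>
             (\<Union>i\<in>{1..<n}. commsub G T (zassenhaus p G T i) (zassenhaus p G T (n - i)))))"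
  by pat_completeness auto
termination
  by (relation "Wellfounded.measure (\<lambda>(p, G, T, n). n)") (auto, metis One_nat_def ceil_div_less)

definition unitri :: "('r, 'm) ring_scheme \<Rightarrow> nat \<Rightarrow> (nat \<Rightarrow> nat \<Rightarrow> 'r) monoid" where
  "unitri R m =
    \<lparr>carrier = {A. \<forall>i j. (i < m \<and> j < m \<longrightarrow> A i j \<in> carrier R) \<and>
                         (i < m \<and> j < i \<longrightarrow> A i j = \<zero>\<^bsub>R\<^esub>) \<and>
                         (i < m \<longrightarrow> A i i = \<one>\<^bsub>R\<^esub>) \<and>
                         (\<not> (i < m \<and> j < m) \<longrightarrow> A i j = \<zero>\<^bsub>R\<^esub>)},
     mult = (\<lambda>A B i j. if i < m \<and> j < m then (\<Oplus>\<^bsub>R\<^esub>k\<in>{..<m}. A i k \<otimes>\<^bsub>R\<^esub> B k j) else \<zero>\<^bsub>R\<^esub>),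
     one = (\<lambda>i j. if i < m \<and> j < m \<and> i = j then \<one>\<^bsub>R\<^esub> else \<zero>\<^bsub>R\<^esub>)\<rparr>"

text \<open>The p-adic integers Z_p as the inverse limit of Z/p^k: compatible sequences
  of residues a k in {0..<p^k}.\<close>
definition padic_int :: "nat \<Rightarrow> (nat \<Rightarrow> int) ring" where
  "padic_int p =
    \<lparr>carrier = {a. \<forall>k. 0 \<le> a k \<and> a k < int p ^ k \<and> a (Suc k) mod (int p ^ k) = a k},
     monoid.mult = \<lambda>a b. \<lambda>k. (a k * b k) mod (int p ^ k),
     one = \<lambda>k. 1 mod (int p ^ k),
     ring.zero = \<lambda>k. 0,
     ring.add = \<lambda>a b. \<lambda>k. (a k + b k) mod (int p ^ k)\<rparr>"

text \<open>Natural (p-adic / inverse-limit) topology on U_m(Z_p): basic open sets are the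
  sets of matrices congruent to a given one modulo p^k entrywise.\<close>
definition padic_unitri_topology :: "nat \<Rightarrow> nat \<Rightarrow> (nat \<Rightarrow> nat \<Rightarrow> nat \<Rightarrow> int) topology" where
  "padic_unitri_topology p m =
     topology_generated_by
       {{A \<in> carrier (unitri (padic_int p) m). \<forall>i<m. \<forall>j<m. A i j k = B i j k} | B k.
          B \<in> carrier (unitri (padic_int p) m)}"

end

theory Submission
  imports Defs
begin

text \<open>
  The inclusions from left to right hold because the unipotent matrices \<open>1 + N\<close>, with \<open>N\<close> in the
  \<open>i\<close>-th step of a multiplicative filtration of the ring of triangular matrices (by distance from the
  diagonal and by powers of \<open>p\<close>), form a central filtration that reaches the trivial group at \<open>n\<close>.

  For the converse let \<open>C\<close> be an open normal subgroup containing the term of the filtration in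
  question. Only finitely many free generators lie outside \<open>C\<close>; sending them to \<open>1 + X\<^sub>i\<close> is the Magnus
  representation, and its coefficients at short words are entries of unitriangular representations.
  Repeatedly eliminating one generator \<open>x\<close>, that is replacing every other generator \<open>y\<close> by the
  commutators \<open>[y, x, ..., x]\<close>, writes an element as a product of powers \<open>x\<^sub>1\<^sup>a x\<^sub>2\<^sup>b ...\<close> modulo deep
  elements. If \<open>x\<close> is always chosen with the smallest leading word, the leading word of
  \<open>[y, x, ..., x]\<close> is \<open>y x ... x\<close>, the leading words stay uniquely factorising, and so the
  corresponding monomials are triangular. Hence vanishing of the Magnus coefficients forces
  the binomial coefficients of each exponent to be divisible by the right power of \<open>p\<close>, and then every
  factor lies in \<open>C\<close>.
\<close>

section \<open>Noncommutative power series with integer coefficients\<close>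

text \<open>One elimination over the integers (\<open>detection\<close>) serves all three parts.
  They differ in the filtration \<open>F\<close>, in the representations used and in the exponent
  \<open>v\<close> required at word length \<open>d\<close>: 1 for \<open>d < n\<close>
  (Zassenhaus), the exponent of the index of \<open>C\<close> for \<open>d < n\<close> (lower
  central), \<open>n - d\<close> (p-central). The obstacle is that an element of \<open>S\<close>
  need not be a product of generators and then has no series with integer coefficients attached to
  it. Elements are therefore paired with series: the work takes place in the subgroup of
  \<open>S \<times>\<times> magnus\<close> generated by the pairs \<open>(y, 1 + X)\<close>, and an
  arbitrary element is moved into its projection modulo an open normal subgroup on which all
  relevant representations are trivial. A fixed power of every element is deep, so all exponents can
  be taken to be natural numbers and ordinary binomial coefficients appear. Elimination may increase
  the number of generators; what decreases is the number of short words that can be composed of the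
  leading words.\<close>

datatype ser = Ser (cf: "nat list \<Rightarrow> int")

lemma ser_eqI: "(\<And>w. cf f w = cf g w) \<Longrightarrow> f = g"
  by (cases f; cases g) auto

instantiation ser :: ring_1
begin

definition "0 = Ser (\<lambda>w. 0)"
definition "1 = Ser (\<lambda>w. if w = [] then 1 else 0)"
definition "f + g = Ser (\<lambda>w. cf f w + cf g w)"
definition "f - g = Ser (\<lambda>w. cf f w - cf g w)"
definition "- f = Ser (\<lambda>w. - cf f w)"
definition "f * g = Ser (\<lambda>w. \<Sum>i\<le>length w. cf f (take i w) * cf g (drop i w))"

instance
proof
  fix a b c :: ser
  show "a * b * c = a * (b * c)"
  proof (rule ser_eqI)
    fix w
    have "cf (a * b * c) w = (\<Sum>(i,j)\<in>Sigma {..length w} (\<lambda>i. {..i}).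
        cf a (take j w) * cf b (drop j (take i w)) * cf c (drop i w))"
      by (subst sum.Sigma[symmetric]) (auto simp: times_ser_def sum_distrib_right min_def intro!: sum.cong)
    \<comment> \<open>Both sides cut \<open>w\<close> twice; the pair of cut positions
      \<open>j \<le> i\<close> is exchanged for the first cut and the length
      \<open>k = i - j\<close> of the middle block.\<close>
    also have "\<dots> = (\<Sum>(j,k)\<in>Sigma {..length w} (\<lambda>j. {..length w - j}).
        cf a (take j w) * (cf b (take k (drop j w)) * cf c (drop k (drop j w))))"
      by (rule sum.reindex_bij_witness[of _ "\<lambda>(j,k). (j + k, j)" "\<lambda>(i,j). (j, i - j)"])
         (auto simp: take_drop mult.assoc)
    also have "\<dots> = cf (a * (b * c)) w"
      by (subst sum.Sigma[symmetric]) (auto simp: times_ser_def sum_distrib_left intro!: sum.cong)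
    finally show "cf (a * b * c) w = cf (a * (b * c)) w" .
  qed
  show "1 * a = a"
  proof (rule ser_eqI)
    fix w
    have "cf (1 * a) w = (\<Sum>i\<le>length w. if i = 0 then cf a w else 0)"
      unfolding times_ser_def one_ser_def ser.sel by (rule sum.cong) auto
    then show "cf (1 * a) w = cf a w" by simp
  qed
  show "a * 1 = a"
  proof (rule ser_eqI)
    fix w
    have "cf (a * 1) w = (\<Sum>i\<le>length w. if i = length w then cf a w else 0)"
      unfolding times_ser_def one_ser_def ser.sel by (rule sum.cong) auto
    then show "cf (a * 1) w = cf a w" by simp
  qed
qed (auto simp: plus_ser_def minus_ser_def uminus_ser_def zero_ser_def one_ser_def times_ser_def
       fun_eq_iff algebra_simps sum.distrib)

end

lemma cf_zero [simp]: "cf 0 w = 0"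
  and cf_one: "cf 1 w = (if w = [] then 1 else 0)"
  and cf_add [simp]: "cf (f + g) w = cf f w + cf g w"
  and cf_diff [simp]: "cf (f - g) w = cf f w - cf g w"
  and cf_uminus [simp]: "cf (- f) w = - cf f w"
  and cf_mult: "cf (f * g) w = (\<Sum>i\<le>length w. cf f (take i w) * cf g (drop i w))"
  by (simp_all add: zero_ser_def one_ser_def plus_ser_def minus_ser_def uminus_ser_def times_ser_def)

lemma cf_sum [simp]: "cf (sum f A) w = (\<Sum>x\<in>A. cf (f x) w)"
  by (induction A rule: infinite_finite_induct) auto

lemma cf_mult_Nil [simp]: "cf (f * g) [] = cf f [] * cf g []"
  by (simp add: cf_mult)

lemma cf_of_nat: "cf (of_nat k) w = (if w = [] then int k else 0)"
  by (induction k) (auto simp: cf_one)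

lemma cf_of_int: "cf (of_int k) w = (if w = [] then k else 0)"
  by (cases k) (auto simp: cf_of_nat cf_one simp del: of_nat_Suc)

lemma cf_of_int_mult [simp]: "cf (of_int k * f) w = k * cf f w"
proof -
  have "cf (of_int k * f) w = (\<Sum>i\<le>length w. if i = 0 then k * cf f w else 0)"
    unfolding cf_mult by (rule sum.cong) (auto simp: cf_of_int)
  then show ?thesis by simp
qed

lemma cf_of_nat_mult [simp]: "cf (of_nat k * f) w = int k * cf f w"
  using cf_of_int_mult[of "int k"] by simp

text \<open>\<open>1\<close> and \<open>b\<close> commute, so the binomial expansion survives in a
  noncommutative ring; the induction is Pascal's rule.\<close>

lemma one_plus_power:
  fixes b :: "'r::ring_1"
  shows "(1 + b) ^ n = (\<Sum>j\<le>n. of_nat (n choose j) * b ^ j)"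
proof (induction n)
  case (Suc n)
  have "(1 + b) ^ Suc n = (\<Sum>j\<le>n. of_nat (n choose j) * b ^ j) + b * (\<Sum>j\<le>n. of_nat (n choose j) * b ^ j)"
    by (simp add: Suc distrib_right)
  also have "b * (\<Sum>j\<le>n. of_nat (n choose j) * b ^ j) = (\<Sum>j\<le>n. of_nat (n choose j) * b ^ Suc j)"
    by (simp add: sum_distrib_left) (metis (no_types, lifting) mult.assoc mult_of_nat_commute)
  also have "(\<Sum>j\<le>n. of_nat (n choose j) * b ^ j) = 1 + (\<Sum>j\<le>n. of_nat (n choose Suc j) * b ^ Suc j)"
  proof -
    have "(\<Sum>j\<le>n. of_nat (n choose j) * b ^ j) = (\<Sum>j\<le>Suc n. of_nat (n choose j) * b ^ j)"
      by (simp add: binomial_eq_0)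
    also have "\<dots> = 1 + (\<Sum>j\<le>n. of_nat (n choose Suc j) * b ^ Suc j)"
      by (subst sum.atMost_Suc_shift) simp
    finally show ?thesis .
  qed
  also have "1 + (\<Sum>j\<le>n. of_nat (n choose Suc j) * b ^ Suc j) + (\<Sum>j\<le>n. of_nat (n choose j) * b ^ Suc j)
      = 1 + (\<Sum>j\<le>n. of_nat (Suc n choose Suc j) * b ^ Suc j)"
    by (simp add: sum.distrib[symmetric] distrib_right add.assoc add.commute)
  also have "\<dots> = (\<Sum>j\<le>Suc n. of_nat (Suc n choose j) * b ^ j)"
    by (subst sum.atMost_Suc_shift) simp
  finally show ?case .
qed simp

text \<open>Junk unless the constant term of \<open>f\<close> is 1.\<close>
fun ser_inv_coeff :: "ser \<Rightarrow> nat list \<Rightarrow> int" where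
  "ser_inv_coeff f w = (if w = [] then 1
     else - (\<Sum>i<length w. ser_inv_coeff f (take i w) * cf f (drop i w)))"

declare ser_inv_coeff.simps [simp del]

text \<open>In the convolution at a nonempty \<open>w\<close> the summand with empty suffix is
  \<open>ser_inv_coeff f w\<close>, because \<open>f\<close> has constant term 1; the recursion is
  chosen so that it cancels all the others.\<close>

lemma ser_left_inverse:
  assumes "cf f [] = 1"
  shows "Ser (ser_inv_coeff f) * f = 1"
proof (rule ser_eqI)
  fix w
  show "cf (Ser (ser_inv_coeff f) * f) w = cf 1 w"
  proof (cases "w = []")
    case False
    have "cf (Ser (ser_inv_coeff f) * f) w =
        (\<Sum>i<length w. ser_inv_coeff f (take i w) * cf f (drop i w)) + ser_inv_coeff f w"
      using assms by (simp add: cf_mult lessThan_Suc_atMost[symmetric])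
    then show ?thesis
      using False by (simp add: ser_inv_coeff.simps[of f w] cf_one)
  qed (simp add: assms cf_one ser_inv_coeff.simps)
qed

definition magnus :: "ser monoid" where
  "magnus = \<lparr>carrier = {f. cf f [] = 1}, mult = (*), one = 1\<rparr>"

lemma magnus_simps [simp]:
  "carrier magnus = {f. cf f [] = 1}" "mult magnus = (*)" "one magnus = 1"
  by (simp_all add: magnus_def)

lemma group_magnus: "group magnus"
proof (rule groupI)
  fix f assume "f \<in> carrier magnus"
  then show "\<exists>g\<in>carrier magnus. g \<otimes>\<^bsub>magnus\<^esub> f = \<one>\<^bsub>magnus\<^esub>"
    by (intro bexI[of _ "Ser (ser_inv_coeff f)"]) (auto simp: ser_left_inverse ser_inv_coeff.simps)
qed (auto simp: cf_one mult.assoc)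

lemma magnus_pow [simp]: "f [^]\<^bsub>magnus\<^esub> (k::nat) = f ^ k"
  by (induction k) (simp_all add: nat_pow_def power_commutes)

section \<open>Ideals defined by divisibility of coefficients\<close>

text \<open>Coefficients at words outside \<open>U\<close> are unconstrained. With all words over
  \<open>B\<close> letters this expresses congruences between Magnus expansions, with the factors of
  a single word congruences between triangular matrices.\<close>

definition adic :: "nat \<Rightarrow> nat list set \<Rightarrow> (nat \<Rightarrow> nat) \<Rightarrow> ser set" where
  "adic p U v = {f. \<forall>u\<in>U. int p ^ v (length u) dvd cf f u}"

text \<open>Under this condition the coefficients of a product at words of \<open>U\<close> depend
  only on coefficients of the factors at words of \<open>U\<close>.\<close>

definition factorial_closed :: "nat list set \<Rightarrow> bool" where
  "factorial_closed U \<longleftrightarrow> (\<forall>u\<in>U. \<forall>i. take i u \<in> U \<and> drop i u \<in> U)"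

lemma adic_zero [simp]: "0 \<in> adic p U v"
  and adic_add: "f \<in> adic p U v \<Longrightarrow> g \<in> adic p U v \<Longrightarrow> f + g \<in> adic p U v"
  and adic_diff: "f \<in> adic p U v \<Longrightarrow> g \<in> adic p U v \<Longrightarrow> f - g \<in> adic p U v"
  and adic_uminus: "f \<in> adic p U v \<Longrightarrow> - f \<in> adic p U v"
  by (auto simp: adic_def)

lemma adic_sum: "(\<And>x. x \<in> A \<Longrightarrow> f x \<in> adic p U v) \<Longrightarrow> sum f A \<in> adic p U v"
  by (induction A rule: infinite_finite_induct) (auto intro: adic_add)

lemma adic_mono: "f \<in> adic p U v \<Longrightarrow> (\<And>d. v' d \<le> v d) \<Longrightarrow> f \<in> adic p U v'"
  unfolding adic_def by (auto intro: power_le_dvd)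

lemma adic_mult:
  assumes "factorial_closed U" "f \<in> adic p U v" "g \<in> adic p U v'"
    and v: "\<And>d d'. v'' (d + d') \<le> v d + v' d'"
  shows "f * g \<in> adic p U v''"
  unfolding adic_def
proof safe
  fix u assume u: "u \<in> U"
  show "int p ^ v'' (length u) dvd cf (f * g) u"
    unfolding cf_mult
  proof (rule dvd_sum)
    fix i assume i: "i \<in> {..length u}"
    have "take i u \<in> U" "drop i u \<in> U"
      using assms(1) u by (auto simp: factorial_closed_def)
    then have "int p ^ v i dvd cf f (take i u)" "int p ^ v' (length u - i) dvd cf g (drop i u)"
      using assms(2,3) i unfolding adic_def by (force simp: min_def)+
    then have "int p ^ (v i + v' (length u - i)) dvd cf f (take i u) * cf g (drop i u)"
      unfolding power_add by (rule mult_dvd_mono)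
    moreover have "v'' (length u) \<le> v i + v' (length u - i)"
      using v[of i "length u - i"] i by simp
    ultimately show "int p ^ v'' (length u) dvd cf f (take i u) * cf g (drop i u)"
      by (rule power_le_dvd)
  qed
qed

lemma adic_trivial [simp]: "f \<in> adic p U (\<lambda>_. 0)"
  by (simp add: adic_def)

text \<open>A factor of \<open>u\<close> is no longer than \<open>u\<close>, so for antitone
  \<open>v\<close> it already carries the divisibility demanded at \<open>u\<close>. Together with
  \<open>adic_mult_right\<close> this makes the set a two-sided ideal.\<close>

lemma adic_mult_left:
  assumes "factorial_closed U" "antimono v" "f \<in> adic p U v"
  shows "g * f \<in> adic p U v"
  using assms(2) by (intro adic_mult[OF assms(1) adic_trivial assms(3)]) (auto simp: antimono_def)

lemma adic_mult_right:
  assumes "factorial_closed U" "antimono v" "f \<in> adic p U v"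
  shows "f * g \<in> adic p U v"
  using assms(2) by (intro adic_mult[OF assms(1) assms(3) adic_trivial]) (auto simp: antimono_def)

section \<open>Leading words\<close>

text \<open>The number whose base-\<open>B\<close> digits are the letters, most significant digit
  first.\<close>

fun num :: "nat \<Rightarrow> nat list \<Rightarrow> nat" where
  "num B [] = 0"
| "num B (a # u) = a * B ^ length u + num B u"

lemma num_append: "num B (u @ w) = num B u * B ^ length w + num B w"
  by (induction u) (auto simp: power_add algebra_simps)

lemma num_less: "u \<in> lists {..<B} \<Longrightarrow> num B u < B ^ length u"
proof (induction u)
  case (Cons a u)
  then have "num B u < B ^ length u" "a + 1 \<le> B" by auto
  then have "num B (a # u) < (a + 1) * B ^ length u" by simp
  also have "\<dots> \<le> B * B ^ length u"
    using \<open>a + 1 \<le> B\<close> by (rule mult_le_mono1)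
  finally show ?case by simp
qed simp

lemma num_inject:
  assumes "u \<in> lists {..<B}" "w \<in> lists {..<B}" "length u = length w" "num B u = num B w"
  shows "u = w"
  using assms
proof (induction u arbitrary: w rule: list.induct)
  case Nil
  then show ?case by simp
next
  case (Cons a u)
  have len: "length w = Suc (length u)" and au: "u \<in> lists {..<B}"
    and val: "a * B ^ length u + num B u = num B w" and wB: "w \<in> lists {..<B}"
    using Cons.prems by simp_all
  obtain b z where w: "w = b # z" "length z = length u" using len by (cases w) simp_all
  have zB: "z \<in> lists {..<B}" using wB by (simp add: w)
  have eq: "a * B ^ length u + num B u = b * B ^ length u + num B z"
    using val by (simp add: w)
  have less: "num B u < B ^ length u" "num B z < B ^ length u"
    using num_less[OF au] num_less[OF zB] w(2) by simp_all
  have quot: "(c * N + r) div N = c" if "r < N" for c r N :: nat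
    using that div_mult_self3[of N c r] by auto
  have "a = (a * B ^ length u + num B u) div B ^ length u"
    using quot[OF less(1)] by simp
  also have "\<dots> = b" unfolding eq using quot[OF less(2)] by simp
  finally have ab: "a = b" .
  then have "num B u = num B z" using eq by simp
  then have "u = z" using Cons.IH[OF au zB] w(2) by simp
  then show ?case using ab w by simp
qed

text \<open>Shorter words come first; words of equal length are ordered by decreasing numerical value
  in base \<open>B\<close>, that is, reverse lexicographically.\<close>
definition prec :: "nat \<Rightarrow> nat list \<Rightarrow> nat list \<Rightarrow> bool" where
  "prec B w u \<longleftrightarrow> length w < length u \<or> length w = length u \<and> num B u \<le> num B w"

text \<open>The leading coefficient is 1, not merely nonzero, so that leading words multiply over
  the integers and divisibility of coefficients can be read off. Words with letters from
  \<open>B\<close> on are ignored.\<close>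

definition lead :: "nat \<Rightarrow> ser \<Rightarrow> nat list \<Rightarrow> bool" where
  "lead B f w \<longleftrightarrow> cf f w = 1 \<and> (\<forall>u\<in>lists {..<B}. cf f u \<noteq> 0 \<longrightarrow> prec B w u)"

lemma prec_append:
  assumes "prec B w u" "prec B w' u'"
  shows "prec B (w @ w') (u @ u')"
proof (cases "length (w @ w') < length (u @ u')")
  case False
  then have "length w = length u" "length w' = length u'" "num B u \<le> num B w" "num B u' \<le> num B w'"
    using assms by (auto simp: prec_def)
  then show ?thesis by (simp add: prec_def num_append add_mono mult_le_mono1)
qed (simp add: prec_def)

lemma lists_take: "u \<in> lists A \<Longrightarrow> take i u \<in> lists A"
  and lists_drop: "u \<in> lists A \<Longrightarrow> drop i u \<in> lists A"
  by (metis in_lists_conv_set in_set_takeD) (metis in_lists_conv_set in_set_dropD)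

text \<open>Cutting \<open>w @ z\<close> inside \<open>w\<close> leaves a prefix shorter than
  \<open>w\<close>, cutting inside \<open>z\<close> a suffix shorter than \<open>z\<close>; the
  coefficient there vanishes, so a single cut contributes to the leading coefficient.\<close>

lemma lead_mult:
  assumes f: "lead B f w" and g: "lead B g z" and wz: "w \<in> lists {..<B}" "z \<in> lists {..<B}"
  shows "lead B (f * g) (w @ z)"
  unfolding lead_def
proof (intro conjI ballI impI)
  have "cf (f * g) (w @ z) = (\<Sum>i\<le>length (w @ z). if i = length w then 1 else 0)"
    unfolding cf_mult
  proof (rule sum.cong)
    fix i assume i: "i \<in> {..length (w @ z)}"
    have wzl: "w @ z \<in> lists {..<B}" using wz by simp
    consider "i < length w" | "i = length w" | "i > length w" by linarith
    then show "cf f (take i (w @ z)) * cf g (drop i (w @ z)) = (if i = length w then 1 else 0)"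
    proof cases
      case 1
      then have "\<not> prec B w (take i (w @ z))" by (auto simp: prec_def)
      then have "cf f (take i (w @ z)) = 0"
        using f lists_take[OF wzl] unfolding lead_def by blast
      then show ?thesis using 1 by simp
    next
      case 2
      then show ?thesis using f g by (simp add: lead_def)
    next
      case 3
      then have "\<not> prec B z (drop i (w @ z))" using i by (auto simp: prec_def)
      then have "cf g (drop i (w @ z)) = 0"
        using g lists_drop[OF wzl] unfolding lead_def by blast
      then show ?thesis using 3 by simp
    qed
  qed simp
  then show "cf (f * g) (w @ z) = 1" by simp
next
  fix u assume u: "u \<in> lists {..<B}" and "cf (f * g) u \<noteq> 0"
  then have "\<exists>i\<in>{..length u}. cf f (take i u) * cf g (drop i u) \<noteq> 0"
    unfolding cf_mult using sum.not_neutral_contains_not_neutral by meson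
  then obtain i where "cf f (take i u) * cf g (drop i u) \<noteq> 0" ..
  then have "cf f (take i u) \<noteq> 0" "cf g (drop i u) \<noteq> 0"
    by (metis mult_zero_left, metis mult_zero_right)
  then have "prec B w (take i u)" "prec B z (drop i u)"
    using f g lists_take[OF u, of i] lists_drop[OF u, of i] unfolding lead_def by simp_all
  then show "prec B (w @ z) u"
    using prec_append[of B w "take i u" z "drop i u"] by simp
qed

lemma lead_diff:
  assumes "lead B f w" "lead B g z" "length w = length z" "num B z < num B w" "w \<in> lists {..<B}"
  shows "lead B (f - g) w"
proof -
  have "\<not> prec B z w" using assms(3,4) by (simp add: prec_def)
  then have "cf g w = 0" using assms(2,5) unfolding lead_def by blast
  moreover have "prec B w u" if u: "u \<in> lists {..<B}" "cf (f - g) u \<noteq> 0" for u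
  proof -
    have "cf f u \<noteq> 0 \<or> cf g u \<noteq> 0" using u(2) by auto
    then have "prec B w u \<or> prec B z u" using assms(1,2) u(1) unfolding lead_def by blast
    then show ?thesis using assms(3,4) by (auto simp: prec_def)
  qed
  ultimately show ?thesis using assms(1) by (simp add: lead_def)
qed

lemma lead_Nil: "cf f [] = 1 \<Longrightarrow> lead B f []"
  by (auto simp: lead_def prec_def)

lemma lead_power:
  assumes "lead B b w" "w \<in> lists {..<B}"
  shows "lead B (b ^ j) (concat (replicate j w))"
proof (induction j)
  case 0
  then show ?case by (simp add: lead_Nil cf_one)
next
  case (Suc j)
  have "set (concat (replicate j w)) \<subseteq> set w" by auto
  then have "concat (replicate j w) \<in> lists {..<B}" using assms(2) by auto
  then show ?case using lead_mult[OF assms(1) Suc assms(2)] by simp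
qed

text \<open>Here \<open>h\<close> is inverse to \<open>g * f\<close>, so the series is
  \<open>h\<close> times the ring commutator of \<open>f - 1\<close> and \<open>g - 1\<close>. Its
  two products have leading words \<open>w @ z\<close> and \<open>z @ w\<close>; the hypothesis on
  \<open>num\<close> says that the former comes first, and \<open>h\<close> contributes only its
  constant term.\<close>

lemma lead_commutator:
  assumes f: "cf f [] = 1" "lead B (f - 1) w" "w \<in> lists {..<B}"
    and g: "cf g [] = 1" "lead B (g - 1) z" "z \<in> lists {..<B}"
    and less: "num B (z @ w) < num B (w @ z)"
    and h: "cf h [] = 1" "h * (g * f) = 1"
  shows "lead B (h * (f * g) - 1) (w @ z)"
proof -
  have "h * (f * g) - 1 = h * ((f - 1) * (g - 1) - (g - 1) * (f - 1))"
  proof -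
    have "(f - 1) * (g - 1) - (g - 1) * (f - 1) = f * g - g * f" by (simp add: algebra_simps)
    then show ?thesis using h(2) by (simp add: right_diff_distrib)
  qed
  moreover have "lead B ((f - 1) * (g - 1) - (g - 1) * (f - 1)) (w @ z)"
    using assms by (intro lead_diff[OF lead_mult lead_mult]) auto
  then have "lead B (h * ((f - 1) * (g - 1) - (g - 1) * (f - 1))) ([] @ w @ z)"
    using assms by (intro lead_mult lead_Nil) auto
  ultimately show ?thesis by simp
qed

text \<open>The system is unitriangular: at \<open>u\<close> the term \<open>c u\<close> occurs with
  coefficient 1, and every other contribution comes from an earlier leading word, whose coefficient
  is divisible by at least the same power of \<open>p\<close> since \<open>v\<close> is
  antitone.\<close>

lemma lead_independent:
  assumes fin: "finite Q" and Q: "Q \<subseteq> lists {..<B}" "\<And>u. u \<in> Q \<Longrightarrow> lead B (b u) u"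
    and Nil: "[] \<in> Q" "b [] = 1"
    and R: "(\<Sum>u\<in>Q. of_int (c u) * b u) - 1 \<in> adic p (lists {..<B}) v"
    and v: "antimono v"
    and u: "u \<in> Q" "u \<noteq> []"
  shows "int p ^ v (length u) dvd c u"
proof -
  \<comment> \<open>The order of leading words as a measure: length first, then decreasing
    \<open>num\<close>, which is turned around by subtracting it from
    \<open>B ^ length u\<close>.\<close>
  have "wf (inv_image (less_than <*lex*> less_than) (\<lambda>u. (length u, B ^ length u - num B u)))"
    by (intro wf_inv_image wf_lex_prod wf_less_than)
  then show ?thesis using u
proof (induction u rule: wf_induct_rule)
  case (less u)
  note \<open>u \<in> Q\<close> \<open>u \<noteq> []\<close>
  have "int p ^ v (length u) dvd cf ((\<Sum>w\<in>Q. of_int (c w) * b w) - 1) u"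
    using R Q(1) \<open>u \<in> Q\<close> unfolding adic_def by blast
  also have "cf ((\<Sum>w\<in>Q. of_int (c w) * b w) - 1) u = c u * cf (b u) u + (\<Sum>w\<in>Q-{u}. c w * cf (b w) u)"
    using \<open>u \<noteq> []\<close> by (simp add: cf_one sum.remove[OF fin \<open>u \<in> Q\<close>])
  also have "cf (b u) u = 1"
    using Q(2) \<open>u \<in> Q\<close> unfolding lead_def by blast
  finally have dvd: "int p ^ v (length u) dvd c u + (\<Sum>w\<in>Q-{u}. c w * cf (b w) u)"
    by simp
  have "int p ^ v (length u) dvd c w * cf (b w) u" if w: "w \<in> Q - {u}" for w
  proof (cases "cf (b w) u = 0")
    case False
    then have ne: "w \<noteq> []" using Nil \<open>u \<noteq> []\<close> by (auto simp: cf_one)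
    have pr: "prec B w u" using False Q w \<open>u \<in> Q\<close> unfolding lead_def by blast
    have lt: "num B u < B ^ length u" "num B w < B ^ length w"
      using num_less w \<open>u \<in> Q\<close> Q(1) by blast+
    have "num B w \<noteq> num B u" if "length w = length u"
      using num_inject that w \<open>u \<in> Q\<close> Q(1) by blast
    then have "(w, u) \<in> inv_image (less_than <*lex*> less_than) (\<lambda>u. (length u, B ^ length u - num B u))"
      using pr lt by (auto simp: prec_def)
    then have "int p ^ v (length w) dvd c w"
      using less.IH w ne by blast
    moreover have "v (length u) \<le> v (length w)"
      using v pr by (auto simp: prec_def antimono_def)
    ultimately show ?thesis by (meson dvd_mult2 power_le_dvd)
  qed simp
  then have "int p ^ v (length u) dvd (\<Sum>w\<in>Q-{u}. c w * cf (b w) u)"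
    by (rule dvd_sum)
  with dvd show ?case by (simp add: dvd_add_left_iff)
qed
qed

section \<open>Codes and elimination\<close>

text \<open>A code in the sense of free monoids: \<open>W\<close> freely generates
  \<open>star W\<close>.\<close>

definition code :: "'x list set \<Rightarrow> bool" where
  "code W \<longleftrightarrow> inj_on concat (lists W)"

definition star :: "'x list set \<Rightarrow> 'x list set" where
  "star W = concat ` lists W"

text \<open>Lazard elimination on the level of words: every word over \<open>W\<close> is a power of
  \<open>x\<close> followed by a word over the \<open>y x ... x\<close>. For suitable
  \<open>x\<close> these are the leading words of the iterated commutators of \<open>y\<close> with
  \<open>x\<close>.\<close>

definition elim_words :: "'x list set \<Rightarrow> 'x list \<Rightarrow> 'x list set" where
  "elim_words W x = (\<lambda>(y, k). y @ concat (replicate k x)) ` ((W - {x}) \<times> UNIV)"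

lemma code_Nil: "code W \<Longrightarrow> [] \<notin> W"
proof
  assume "code W" "[] \<in> W"
  then have "[[]] = ([] :: 'a list list)"
    by (intro inj_onD[of concat "lists W"]) (auto simp: code_def)
  then show False by simp
qed

lemma code_subset: "code W \<Longrightarrow> V \<subseteq> W \<Longrightarrow> code V"
  unfolding code_def by (meson inj_on_subset lists_mono)

lemma star_append: "u \<in> star W \<Longrightarrow> w \<in> star W \<Longrightarrow> u @ w \<in> star W"
proof -
  assume "u \<in> star W" "w \<in> star W"
  then obtain L M where "L \<in> lists W" "M \<in> lists W" "u = concat L" "w = concat M"
    unfolding star_def by blast
  then show ?thesis
    unfolding star_def by (intro image_eqI[of _ _ "L @ M"]) simp_all
qed

lemma star_Nil: "[] \<in> star W"
  unfolding star_def by (rule image_eqI[of _ _ "[]"]) simp_all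

lemma star_incl: "w \<in> W \<Longrightarrow> w \<in> star W"
  unfolding star_def by (rule image_eqI[of _ _ "[w]"]) auto

lemma star_replicate: "w \<in> W \<Longrightarrow> concat (replicate j w) \<in> star W"
  by (induction j) (auto intro: star_Nil star_append star_incl)

lemma star_least:
  assumes "V \<subseteq> star W"
  shows "star V \<subseteq> star W"
proof -
  have "concat L \<in> star W" if "L \<in> lists V" for L
    using that by induction (use assms in \<open>auto intro: star_Nil star_append\<close>)
  then show ?thesis unfolding star_def[of V] by blast
qed

lemma concat_map_concat: "concat (map concat N) = concat (concat N)"
  by (induction N) auto

lemma replicate_append_unique:
  assumes "replicate j x @ L = replicate j' x @ L'" "L = [] \<or> hd L \<noteq> x" "L' = [] \<or> hd L' \<noteq> x"
  shows "j = j' \<and> L = L'"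
  using assms
proof (induction j arbitrary: j')
  case 0
  then show ?case by (cases j') auto
next
  case (Suc j)
  then show ?case by (cases j') auto
qed

text \<open>Reading from the left, each letter other than \<open>x\<close> opens a new block, and
  the occurrences of \<open>x\<close> after it belong to that block.\<close>

lemma blocks_unique:
  assumes "N \<in> lists {y # replicate k x | y k. y \<noteq> x}" "N' \<in> lists {y # replicate k x | y k. y \<noteq> x}"
    and "replicate j x @ concat N = replicate j' x @ concat N'"
  shows "j = j' \<and> N = N'"
  using assms
proof (induction N arbitrary: j j' N' rule: list.induct)
  case Nil
  have "concat N' = [] \<or> hd (concat N') \<noteq> x"
    using Nil.prems by (cases N') auto
  then have "concat N' = [] \<and> j = j'"
    using replicate_append_unique[OF Nil.prems(3)] by auto
  then show ?case using Nil.prems(2) by (cases N') auto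
next
  case (Cons a N)
  have "hd (concat N') \<noteq> x \<or> concat N' = []"
    using Cons.prems by (cases N') auto
  then have eq: "j = j'" "concat (a # N) = concat N'"
    using replicate_append_unique[OF Cons.prems(3)] Cons.prems(1) by auto
  obtain y k where a: "a = y # replicate k x" "y \<noteq> x" using Cons.prems by auto
  then obtain a' N'' where N': "N' = a' # N''" using eq by (cases N') auto
  obtain y' k' where a': "a' = y' # replicate k' x" "y' \<noteq> x" using Cons.prems N' by auto
  have "y = y'" "replicate k x @ concat N = replicate k' x @ concat N''"
    using eq by (auto simp: a a' N')
  moreover have "k = k' \<and> N = N''"
    using Cons.IH[of N'' k k'] Cons.prems calculation by (auto simp: N')
  ultimately show ?case using eq by (simp add: a a' N')
qed

text \<open>Unique factorisation over \<open>W\<close> turns the equation between words into one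
  between lists over \<open>W\<close>, in which \<open>x\<close> is a single letter and
  \<open>blocks_unique\<close> applies. The initial power of \<open>x\<close> is kept because the
  monomials of the elimination begin with one.\<close>

lemma elim_unique:
  assumes W: "code W" "x \<in> W" and M: "M \<in> lists (elim_words W x)" "M' \<in> lists (elim_words W x)"
    and eq: "concat (replicate j x) @ concat M = concat (replicate j' x) @ concat M'"
  shows "j = j' \<and> M = M'"
proof -
  define P where "P = (\<lambda>(y, k). y # replicate k x) ` ((W - {x}) \<times> (UNIV :: nat set))"
  have "elim_words W x = concat ` P"
    unfolding P_def elim_words_def by (force simp: image_iff)
  then obtain N N' where N: "N \<in> lists P" "M = map concat N" "N' \<in> lists P" "M' = map concat N'"
    using M by (auto simp: lists_image)
  have PW: "P \<subseteq> lists W" using W by (auto simp: P_def)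
  have in_lists: "replicate i x @ concat L \<in> lists W" if "L \<in> lists P" for i L
  proof -
    have "concat L \<in> lists W" using that by induction (use PW in auto)
    then show ?thesis using W by auto
  qed
  have "replicate j x @ concat N = replicate j' x @ concat N'"
    using W(1) eq in_lists N unfolding code_def
    by (intro inj_onD[of concat "lists W"]) (auto simp: concat_map_concat)
  moreover have "lists P \<subseteq> lists {y # replicate k x | y k. y \<noteq> x}"
    by (rule lists_mono) (auto simp: P_def)
  ultimately show ?thesis using blocks_unique[of N x N' j j'] N by auto
qed

lemma code_elim: "code W \<Longrightarrow> x \<in> W \<Longrightarrow> code (elim_words W x)"
  unfolding code_def[of "elim_words W x"] using elim_unique[of W x _ _ 0 0]
  by (intro inj_onI) auto

lemma elim_star_unique:
  assumes "code W" "x \<in> W" "u \<in> star (elim_words W x)" "u' \<in> star (elim_words W x)"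
    and "concat (replicate j x) @ u = concat (replicate j' x) @ u'"
  shows "j = j' \<and> u = u'"
  using assms elim_unique[of W x _ _ j j'] unfolding star_def by blast

lemma elim_pair_unique:
  assumes "code W" "x \<in> W" "y \<in> W - {x}" "y' \<in> W - {x}"
    and "y @ concat (replicate k x) = y' @ concat (replicate k' x)"
  shows "y = y' \<and> k = k'"
proof -
  have "y # replicate k x = y' # replicate k' x"
    using assms(2-5) by (intro inj_onD[OF assms(1)[unfolded code_def]]) auto
  then show ?thesis by (auto dest: arg_cong[of _ _ length])
qed

lemma elim_words_star: "x \<in> W \<Longrightarrow> elim_words W x \<subseteq> star W"
  unfolding elim_words_def using star_append[OF star_incl star_replicate, of _ W x] by auto

text \<open>This makes the elimination terminate: the monoid of composable words loses at least
  \<open>x\<close>.\<close>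

lemma not_in_star_elim: "code W \<Longrightarrow> x \<in> W \<Longrightarrow> x \<notin> star (elim_words W x)"
  using elim_star_unique[of W x x "[]" 0 1] star_Nil by auto

text \<open>The word \<open>x\<close> minimises the value of the periodic base-\<open>B\<close> fraction \<open>0.xxx...\<close>.\<close>
lemma exists_minimal_word:
  assumes W: "finite W" "W \<noteq> {}" "code W" "W \<subseteq> lists {..<B}" and B: "2 \<le> B"
  shows "\<exists>x\<in>W. \<forall>y\<in>W-{x}. num B (x @ y) < num B (y @ x)"
proof -
  define val where "val u = real (num B u) / (real B ^ length u - 1)" for u
  obtain x where x: "x \<in> W" "\<And>y. y \<in> W \<Longrightarrow> val x \<le> val y"
    using W(1,2) by (metis arg_min_if_finite(1) arg_min_least)
  have "num B (x @ y) < num B (y @ x)" if y: "y \<in> W - {x}" for y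
  proof -
    have pos: "real B ^ length u - 1 > 0" if "u \<in> W" for u
    proof -
      have "u \<noteq> []" using code_Nil[OF W(3)] that by blast
      then show ?thesis using B by (simp add: one_less_power)
    qed
    have "val x \<le> val y" using x y by blast
    \<comment> \<open>Rearranged, this compares \<open>num B x * B ^ length y + num B y\<close> with
      the same expression for \<open>x\<close> and \<open>y\<close> exchanged, that is, the values
      of \<open>x @ y\<close> and \<open>y @ x\<close>.\<close>
    then have "real (num B x) * (real B ^ length y - 1) \<le> real (num B y) * (real B ^ length x - 1)"
      unfolding val_def using pos[of x] pos[of y] x y by (simp add: field_simps)
    then have "real (num B (x @ y)) \<le> real (num B (y @ x))"
      by (simp add: num_append algebra_simps)
    \<comment> \<open>Equal values would give \<open>x @ y = y @ x\<close>, two factorisations of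
      one word over a code.\<close>
    moreover have "num B (x @ y) \<noteq> num B (y @ x)"
    proof
      assume "num B (x @ y) = num B (y @ x)"
      moreover have "x @ y \<in> lists {..<B}" "y @ x \<in> lists {..<B}"
        using x y W(4) by auto
      ultimately have "x @ y = y @ x" using num_inject[of "x @ y" B "y @ x"] by simp
      then have "[x, y] = [y, x]"
        using inj_onD[OF W(3)[unfolded code_def], of "[x, y]" "[y, x]"] x(1) y by simp
      then have "x = y" by (rule list.inject[THEN iffD1, THEN conjunct1])
      then show False using y by simp
    qed
    ultimately show ?thesis by linarith
  qed
  then show ?thesis using x(1) by blast
qed

section \<open>Elimination in a group with a Magnus representation\<close>

lemma (in group) inv_cancel_left [simp]:
  assumes "x \<in> carrier G" "z \<in> carrier G"
  shows "x \<otimes> (inv x \<otimes> z) = z" "inv x \<otimes> (x \<otimes> z) = z"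
  using assms by (simp_all flip: m_assoc)

text \<open>The intended group is \<open>S \<times>\<times> magnus\<close>. \<open>C\<close> is the
  subgroup in which membership is to be proved, \<open>D\<close> consists of the elements that are
  neglected, and \<open>F\<close> controls iterated commutators. \<open>pow_C\<close> is the
  arithmetic input that turns divisibility of binomial coefficients into membership of a power;
  \<open>j * w\<close> is the length of the leading word of the \<open>j\<close>-th binomial
  term.\<close>

locale elimination = group G for G :: "('a, 'b) monoid_scheme" (structure) +
  fixes \<mu> :: "'a \<Rightarrow> ser" and F :: "nat \<Rightarrow> 'a set" and C D :: "'a set"
    and n B p q :: nat and v :: "nat \<Rightarrow> nat"
  assumes mu_hom: "\<mu> \<in> hom G magnus"
    and F_carrier: "\<And>i. F i \<subseteq> carrier G"
    and F_comm: "\<And>i j x y. 1 \<le> i \<Longrightarrow> 1 \<le> j \<Longrightarrow> x \<in> F i \<Longrightarrow> y \<in> F j \<Longrightarrow> comm G x y \<in> F (i + j)"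
    and F_deep: "\<And>i. n \<le> i \<Longrightarrow> F i \<subseteq> D"
    and normal_D: "normal D G" and D_C: "D \<subseteq> C" and subgroup_C: "subgroup C G"
    and mu_D: "\<And>d. d \<in> D \<Longrightarrow> \<mu> d - 1 \<in> adic p (lists {..<B}) v"
    and pow_D: "1 \<le> q" "\<And>x. x \<in> carrier G \<Longrightarrow> x [^] q \<in> D"
    and pow_C: "\<And>w x a. 1 \<le> w \<Longrightarrow> x \<in> F w \<Longrightarrow>
                  (\<And>j. 1 \<le> j \<Longrightarrow> p ^ v (j * w) dvd a choose j) \<Longrightarrow> x [^] a \<in> C"
    and v: "antimono v" and B: "2 \<le> B"
begin

abbreviation "L \<equiv> lists {..<B}"
abbreviation "R \<equiv> adic p L v"

lemma F_carr: "x \<in> F i \<Longrightarrow> x \<in> carrier G"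
  using F_carrier by blast

lemma factorial_closed_L: "factorial_closed L"
  using lists_take[of _ "{..<B}"] lists_drop[of _ "{..<B}"] by (simp add: factorial_closed_def)

lemma subgroup_D: "subgroup D G"
  by (rule normal_imp_subgroup[OF normal_D])

lemma mu_mult: "x \<in> carrier G \<Longrightarrow> y \<in> carrier G \<Longrightarrow> \<mu> (x \<otimes> y) = \<mu> x * \<mu> y"
  using hom_mult[OF mu_hom] by simp

lemma mu_one: "\<mu> \<one> = 1"
  using hom_one[OF mu_hom is_group group_magnus] by simp

lemma mu_Nil: "x \<in> carrier G \<Longrightarrow> cf (\<mu> x) [] = 1"
  using hom_in_carrier[OF mu_hom] by simp

lemma mu_pow: "x \<in> carrier G \<Longrightarrow> \<mu> (x [^] (a::nat)) = \<mu> x ^ a"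
  by (induction a) (simp_all add: mu_mult mu_one power_commutes)

lemma lead_comm:
  assumes x: "x \<in> carrier G" "lead B (\<mu> x - 1) w" "w \<in> L"
    and y: "y \<in> carrier G" "lead B (\<mu> y - 1) z" "z \<in> L"
    and less: "num B (z @ w) < num B (w @ z)"
  shows "lead B (\<mu> (comm G x y) - 1) (w @ z)"
proof -
  have "comm G x y = inv (y \<otimes> x) \<otimes> (x \<otimes> y)"
    using x y by (simp add: comm_def inv_mult_group m_assoc)
  moreover have "\<mu> (inv (y \<otimes> x)) * (\<mu> y * \<mu> x) = 1"
    using x y by (simp flip: mu_mult mu_one)
  ultimately show ?thesis
    using lead_commutator[OF mu_Nil[OF x(1)] x(2,3) mu_Nil[OF y(1)] y(2,3) less
        mu_Nil[of "inv (y \<otimes> x)"]] x y by (simp add: mu_mult)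
qed

text \<open>\<open>W\<close> is the set of leading words of the current generators \<open>g w\<close>, where \<open>w\<close> ranges over
  \<open>W\<close>.\<close>
definition good :: "nat list set \<Rightarrow> (nat list \<Rightarrow> 'a) \<Rightarrow> bool" where
  "good W g \<longleftrightarrow> code W \<and> W \<subseteq> L \<and>
     (\<forall>w\<in>W. length w < n \<and> g w \<in> F (length w) \<and> lead B (\<mu> (g w) - 1) w)"

text \<open>During the induction nothing is known about the series of the partial products, so
  divisibility of the coefficients enters as the premise of an implication. It is discharged once,
  for the whole product, in \<open>detected_imp\<close>.\<close>

definition detected :: "nat list set \<Rightarrow> 'a \<Rightarrow> bool" where
  "detected S g \<longleftrightarrow> (\<exists>Q c b. finite Q \<and> Q \<subseteq> S \<and> [] \<in> Q \<and> c [] = 1 \<and> b [] = 1 \<and>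
     (\<forall>u\<in>Q. lead B (b u) u) \<and> \<mu> g - (\<Sum>u\<in>Q. of_int (c u) * b u) \<in> R \<and>
     ((\<forall>u\<in>Q-{[]}. int p ^ v (length u) dvd c u) \<longrightarrow> g \<in> C))"

lemma detected_imp:
  assumes "detected S g" "S \<subseteq> L" "\<mu> g - 1 \<in> R"
  shows "g \<in> C"
proof -
  obtain Q c b where Q: "finite Q" "Q \<subseteq> S" "[] \<in> Q" "c [] = 1" "b [] = 1"
      "\<forall>u\<in>Q. lead B (b u) u" "\<mu> g - (\<Sum>u\<in>Q. of_int (c u) * b u) \<in> R"
      and C: "(\<forall>u\<in>Q-{[]}. int p ^ v (length u) dvd c u) \<longrightarrow> g \<in> C"
    using assms(1) unfolding detected_def by blast
  have "(\<Sum>u\<in>Q. of_int (c u) * b u) - 1 = (\<mu> g - 1) - (\<mu> g - (\<Sum>u\<in>Q. of_int (c u) * b u))"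
    by simp
  then have "(\<Sum>u\<in>Q. of_int (c u) * b u) - 1 \<in> R"
    using adic_diff[OF assms(3) Q(7)] by simp
  then have "int p ^ v (length u) dvd c u" if "u \<in> Q - {[]}" for u
    using lead_independent[of Q B b c p v u] Q assms(2) v that by blast
  then show ?thesis using C by blast
qed

text \<open>The inequality between \<open>x @ u\<close> and \<open>u @ x\<close> survives appending
  \<open>x\<close> on the right: both values are multiplied by \<open>B ^ length x\<close> and
  increased by \<open>num B x\<close>. Hence \<open>lead_comm\<close> applies at every
  stage.\<close>

lemma good_elim:
  assumes W: "good W g" and x: "x \<in> W" "\<forall>y\<in>W-{x}. num B (x @ y) < num B (y @ x)"
    and y: "y \<in> W - {x}"
  shows "((\<lambda>z. comm G z (g x)) ^^ k) (g y) \<in> F (length y + k * length x) \<and>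
    lead B (\<mu> (((\<lambda>z. comm G z (g x)) ^^ k) (g y)) - 1) (y @ concat (replicate k x)) \<and>
    y @ concat (replicate k x) \<in> L \<and>
    num B (x @ y @ concat (replicate k x)) < num B ((y @ concat (replicate k x)) @ x)"
proof (induction k)
  case 0
  then show ?case using W x y by (auto simp: good_def)
next
  case (Suc k)
  let ?z = "((\<lambda>z. comm G z (g x)) ^^ k) (g y)" and ?u = "y @ concat (replicate k x)"
  have u: "y @ concat (replicate (Suc k) x) = ?u @ x"
    by (induction k) auto
  have W': "code W" "x \<in> L" "y \<in> L" "g x \<in> F (length x)" "lead B (\<mu> (g x) - 1) x"
    using W x y by (auto simp: good_def)
  have ne: "1 \<le> length x" "1 \<le> length y"
    using code_Nil[OF W'(1)] x y by (cases x; auto; cases y; auto)+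
  have "comm G ?z (g x) \<in> F ((length y + k * length x) + length x)"
    using Suc W' ne by (intro F_comm) auto
  then have "comm G ?z (g x) \<in> F (length y + Suc k * length x)"
    by (simp add: algebra_simps)
  moreover have "lead B (\<mu> (comm G ?z (g x)) - 1) (?u @ x)"
    using Suc W' F_carr by (intro lead_comm) auto
  moreover have "?u @ x \<in> L" using Suc W' by auto
  moreover have "num B (x @ ?u @ x) < num B ((?u @ x) @ x)"
  proof -
    have "num B (x @ ?u) * B ^ length x + num B x < num B (?u @ x) * B ^ length x + num B x"
      using Suc B by simp
    then show ?thesis using num_append[of B "x @ ?u" x] num_append[of B "?u @ x" x]
      by (simp only: append_assoc)
  qed
  ultimately show ?case unfolding u by simp
qed

lemma conj_generate:
  assumes A: "A \<subseteq> carrier G" and x: "x \<in> carrier G"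
    and gen: "\<And>a. a \<in> A \<Longrightarrow> inv x \<otimes> a \<otimes> x \<in> generate G A"
    and h: "h \<in> generate G A"
  shows "inv x \<otimes> h \<otimes> x \<in> generate G A"
  using h
proof induction
  case one
  then show ?case using x by (simp add: generate.one)
next
  case (incl a)
  then show ?case by (rule gen)
next
  case (inv a)
  have "inv (inv x \<otimes> a \<otimes> x) \<in> generate G A"
    by (intro generate_m_inv_closed A gen inv)
  moreover have "inv (inv x \<otimes> a \<otimes> x) = inv x \<otimes> inv a \<otimes> x"
    using inv A x by (simp add: inv_mult_group m_assoc subset_iff)
  ultimately show ?case by simp
next
  case (eng h1 h2)
  have c: "h1 \<in> carrier G" "h2 \<in> carrier G"
    using eng generate_in_carrier[OF A] by auto
  have "inv x \<otimes> (h1 \<otimes> h2) \<otimes> x = (inv x \<otimes> h1 \<otimes> x) \<otimes> (inv x \<otimes> h2 \<otimes> x)"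
    using c x by (simp add: m_assoc)
  then show ?case using eng generate.eng by metis
qed

lemma conj_pow_generate:
  assumes A: "A \<subseteq> carrier G" and x: "x \<in> carrier G"
    and gen: "\<And>a. a \<in> A \<Longrightarrow> inv x \<otimes> a \<otimes> x \<in> generate G A"
    and h: "h \<in> generate G A"
  shows "inv (x [^] (k::nat)) \<otimes> h \<otimes> x [^] k \<in> generate G A"
proof (induction k)
  case 0
  then show ?case using h generate_in_carrier[OF A] by simp
next
  case (Suc k)
  have c: "h \<in> carrier G" using h generate_in_carrier[OF A] by auto
  have "inv (x [^] Suc k) \<otimes> h \<otimes> x [^] Suc k = inv x \<otimes> (inv (x [^] k) \<otimes> h \<otimes> x [^] k) \<otimes> x"
    using c x by (simp add: inv_mult_group m_assoc)
  then show ?case using conj_generate[OF A x gen Suc] by simp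
qed

text \<open>Conjugation by \<open>g x\<close> maps an iterated commutator \<open>z\<close> to
  \<open>z\<close> times the next one, \<open>comm G z (g x)\<close>. The subgroup generated by
  these commutators and \<open>D\<close> is therefore stable, and powers of \<open>g x\<close> can
  be collected on the left. Commutators belonging to words of length at least \<open>n\<close> lie
  in \<open>D\<close>, which is why only shorter words are retained.\<close>

lemma elim_generate:
  assumes W: "good W g" and x: "x \<in> W"
    and W': "W' = {u \<in> elim_words W x. length u < n}"
    and g': "\<And>y k. y \<in> W - {x} \<Longrightarrow>
               g' (y @ concat (replicate k x)) = ((\<lambda>z. comm G z (g x)) ^^ k) (g y)"
    and deep: "\<And>y k. y \<in> W - {x} \<Longrightarrow> n \<le> length y + k * length x \<Longrightarrow>
               ((\<lambda>z. comm G z (g x)) ^^ k) (g y) \<in> D"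
    and carr: "\<And>y k. y \<in> W - {x} \<Longrightarrow> ((\<lambda>z. comm G z (g x)) ^^ k) (g y) \<in> carrier G"
    and h: "h \<in> generate G (g ` W \<union> D)"
  shows "\<exists>(a::nat) h'. h = g x [^] a \<otimes> h' \<and> h' \<in> generate G (g' ` W' \<union> D)"
proof -
  let ?it = "\<lambda>k y. ((\<lambda>z. comm G z (g x)) ^^ k) (g y)"
  let ?A = "g' ` W' \<union> D"
  have gx: "g x \<in> carrier G" using W x F_carr by (auto simp: good_def)
  have D: "D \<subseteq> carrier G" using subgroup.subset[OF subgroup_D] .
  have mem: "?it k y \<in> generate G ?A" if y: "y \<in> W - {x}" for k y
  proof (cases "length y + k * length x < n")
    case True
    have len: "length (y @ concat (replicate k x)) = length y + k * length x"
      by (induction k) auto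
    then have "y @ concat (replicate k x) \<in> W'"
      using y True unfolding W' elim_words_def by force
    then show ?thesis using g'[OF y] by (metis UnI1 generate.incl image_eqI)
  next
    case False
    then show ?thesis using deep[OF y, of k] by (auto intro: generate.incl)
  qed
  have g'_image: "\<exists>y k. y \<in> W - {x} \<and> z = ?it k y" if z: "z \<in> g' ` W'" for z
  proof -
    obtain y k where "y \<in> W - {x}" "z = g' (y @ concat (replicate k x))"
      using z unfolding W' elim_words_def by (auto simp: image_iff)
    then show ?thesis using g' by metis
  qed
  have A: "?A \<subseteq> carrier G"
  proof
    fix z assume "z \<in> ?A"
    then consider "z \<in> D" | y k where "y \<in> W - {x}" "z = ?it k y"
      using g'_image[of z] by blast
    then show "z \<in> carrier G" using D carr by cases auto
  qed
  note gen_c = generate_in_carrier[OF A]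
  have conj1: "inv (g x) \<otimes> a \<otimes> g x \<in> generate G ?A" if a: "a \<in> ?A" for a
  proof (cases "a \<in> D")
    case True
    then have "inv (g x) \<otimes> a \<otimes> g x \<in> D"
      using normal.inv_op_closed1[OF normal_D gx] by simp
    then show ?thesis by (auto intro: generate.incl)
  next
    case False
    then obtain y k where y: "y \<in> W - {x}" "a = ?it k y"
      using a g'_image[of a] by blast
    have c: "?it k y \<in> carrier G" using carr[OF y(1)] .
    have "inv (g x) \<otimes> a \<otimes> g x = a \<otimes> ?it (Suc k) y"
      using c gx unfolding y(2) by (simp add: comm_def m_assoc)
    then show ?thesis using mem[OF y(1), of k] mem[OF y(1), of "Suc k"] y(2) by (simp add: generate.eng)
  qed
  have conj: "inv (g x [^] k) \<otimes> h \<otimes> g x [^] k \<in> generate G ?A" if "h \<in> generate G ?A" for h and k :: nat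
    using conj_pow_generate[OF A gx conj1 that] .
  show ?thesis
    using h
  proof induction
    case one
    show ?case by (intro exI[of _ "0::nat"] exI[of _ \<one>]) (simp add: generate.one)
  next
    case (incl a)
    consider "a = g x" | y where "y \<in> W - {x}" "a = g y" | "a \<in> D" using incl by blast
    then show ?case
    proof cases
      case 1
      then show ?thesis
        using gx by (intro exI[of _ "1::nat"] exI[of _ \<one>]) (simp add: generate.one)
    next
      case 2
      then show ?thesis using mem[OF 2(1), of 0] carr[OF 2(1), of 0] by (intro exI[of _ "0::nat"] exI[of _ a]) simp
    next
      case 3
      then show ?thesis using D by (intro exI[of _ "0::nat"] exI[of _ a]) (auto simp: generate.incl)
    qed
  next
    case (inv a)
    consider "a = g x" | y where "y \<in> W - {x}" "a = g y" | "a \<in> D" using inv by blast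
    then show ?case
    proof cases
      case 1
      have "g x [^] q \<in> D" by (rule pow_D(2)[OF gx])
      then have "inv (g x [^] q) \<in> generate G ?A" by (auto intro: generate.inv)
      \<comment> \<open>Negative exponents are avoided: since \<open>g x [^] q\<close> lies in
        \<open>D\<close>, the inverse is a nonnegative power up to a factor in
        \<open>D\<close>.\<close>
      moreover have "inv a = g x [^] (q - 1) \<otimes> inv (g x [^] q)"
      proof -
        have "g x [^] q = g x [^] (q - 1) \<otimes> g x"
          using pow_D(1) nat_pow_Suc[of "g x" "q - 1"] by simp
        also have "\<dots> = g x \<otimes> g x [^] (q - 1)"
          using gx by (metis nat_pow_Suc nat_pow_Suc2)
        finally have "inv (g x [^] q) = inv (g x [^] (q - 1)) \<otimes> inv (g x)"
          using gx by (simp add: inv_mult_group)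
        then show ?thesis using gx 1 by simp
      qed
      ultimately show ?thesis by blast
    next
      case 2
      then have "inv a \<in> generate G ?A"
        using generate_m_inv_closed[OF A mem[OF 2(1), of 0]] by simp
      then show ?thesis using gen_c by (intro exI[of _ "0::nat"] exI[of _ "inv a"]) simp
    next
      case 3
      then have "inv a \<in> generate G ?A" by (auto intro: generate.inv)
      then show ?thesis using gen_c by (intro exI[of _ "0::nat"] exI[of _ "inv a"]) simp
    qed
  next
    case (eng h1 h2)
    obtain a1 a2 :: nat and k1 k2 where k: "h1 = g x [^] a1 \<otimes> k1" "k1 \<in> generate G ?A"
        "h2 = g x [^] a2 \<otimes> k2" "k2 \<in> generate G ?A"
      using eng by blast
    have c: "k1 \<in> carrier G" "k2 \<in> carrier G" using k gen_c by auto
    \<comment> \<open>Moving \<open>g x [^] a2\<close> to the left past \<open>k1\<close> conjugates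
      \<open>k1\<close> by it.\<close>
    have "h1 \<otimes> h2 = g x [^] (a1 + a2) \<otimes> ((inv (g x [^] a2) \<otimes> k1 \<otimes> g x [^] a2) \<otimes> k2)"
      using c gx unfolding k by (simp add: nat_pow_mult[symmetric] m_assoc)
    moreover have "(inv (g x [^] a2) \<otimes> k1 \<otimes> g x [^] a2) \<otimes> k2 \<in> generate G ?A"
      using conj[OF k(2)] k(4) by (rule generate.eng)
    ultimately show ?case by blast
  qed
qed

lemma good_finite: "good W g \<Longrightarrow> finite W"
proof -
  assume W: "good W g"
  have "W \<subseteq> {u. set u \<subseteq> {..<B} \<and> length u \<le> n}"
    using W by (force simp: good_def)
  then show ?thesis by (rule finite_subset) (simp add: finite_lists_length_le)
qed

lemma star_L: "W \<subseteq> L \<Longrightarrow> star W \<subseteq> L"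
proof
  fix u assume W: "W \<subseteq> L" and "u \<in> star W"
  then obtain M where M: "M \<in> lists W" "u = concat M" unfolding star_def by blast
  have "concat M \<in> L" using M(1) by induction (use W in auto)
  then show "u \<in> L" using M by simp
qed

text \<open>Expanding the power gives the coefficients \<open>(a choose j) * c u\<close> at the
  words made of \<open>j\<close> copies of \<open>x\<close> followed by \<open>u\<close>, which are
  pairwise distinct by unique factorisation. The terms with \<open>j = 0\<close> return the
  coefficients of \<open>h\<close>, those with \<open>u = []\<close> the binomial coefficients
  needed for \<open>pow_C\<close>.\<close>

lemma detected_elim:
  assumes W: "code W" "x \<in> W" "W \<subseteq> L" "length x \<ge> 1" and W': "W' \<subseteq> elim_words W x"
    and gx: "gx \<in> F (length x)" "lead B (\<mu> gx - 1) x"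
    and h: "detected (star W') h" "h \<in> carrier G"
  shows "detected (star W) (gx [^] (a::nat) \<otimes> h)"
proof -
  obtain Q c b where Q: "finite Q" "Q \<subseteq> star W'" "[] \<in> Q" "c [] = 1" "b [] = 1"
      "\<And>u. u \<in> Q \<Longrightarrow> lead B (b u) u" "\<mu> h - (\<Sum>u\<in>Q. of_int (c u) * b u) \<in> R"
      and C: "(\<forall>u\<in>Q-{[]}. int p ^ v (length u) dvd c u) \<longrightarrow> h \<in> C"
    using h(1) unfolding detected_def by blast
  have W'e: "star W' \<subseteq> star (elim_words W x)"
    using W' star_incl[of _ "elim_words W x"] by (intro star_least) auto
  have gxc: "gx \<in> carrier G" using gx F_carr by auto
  define \<theta> where "\<theta> = (\<lambda>(j, u). concat (replicate j x) @ u)"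
  have inj: "inj_on \<theta> (UNIV \<times> star W')"
  proof (rule inj_onI)
    fix z z' assume z: "z \<in> UNIV \<times> star W'" "z' \<in> UNIV \<times> star W'" "\<theta> z = \<theta> z'"
    have "snd z \<in> star (elim_words W x)" "snd z' \<in> star (elim_words W x)"
      using z W'e by auto
    then show "z = z'"
      using elim_star_unique[OF W(1,2), of "snd z" "snd z'" "fst z" "fst z'"] z(3)
      by (simp add: \<theta>_def case_prod_unfold prod_eq_iff)
  qed
  \<comment> \<open>Decodes a word into its initial power of \<open>x\<close> and the rest, since
    the families in \<open>detected\<close> are indexed by words.\<close>
  define \<theta>' where "\<theta>' = inv_into (UNIV \<times> star W') \<theta>"
  have inv: "\<theta>' (\<theta> (j, u)) = (j, u)" if "u \<in> star W'" for j u
    unfolding \<theta>'_def using inj that by (intro inv_into_f_f) auto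
  define c2 where "c2 w = (case \<theta>' w of (j, u) \<Rightarrow> int (a choose j) * c u)" for w
  define b2 where "b2 w = (case \<theta>' w of (j, u) \<Rightarrow> (\<mu> gx - 1) ^ j * b u)" for w
  have c2: "c2 (\<theta> (j, u)) = int (a choose j) * c u"
    and b2: "b2 (\<theta> (j, u)) = (\<mu> gx - 1) ^ j * b u" if "u \<in> Q" for j u
    using inv[of u j] Q(2) that by (auto simp: c2_def b2_def)
  define Q2 where "Q2 = \<theta> ` ({..a} \<times> Q)"
  have th0: "\<theta> (0, u) = u" for u by (simp add: \<theta>_def)
  have Q2I: "\<theta> (j, u) \<in> Q2" if "j \<le> a" "u \<in> Q" for j u using that by (auto simp: Q2_def)
  have xL: "concat (replicate j x) \<in> L" for j
    using star_L[OF W(3)] star_replicate[OF W(2)] by blast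
  have starQ: "Q \<subseteq> star W"
    using Q(2) star_least[OF elim_words_star[OF W(2)]] W'e by blast
  have "detected (star W) (gx [^] a \<otimes> h)"
    unfolding detected_def
  proof (intro exI conjI)
    show "finite Q2" using Q(1) by (simp add: Q2_def)
    show "Q2 \<subseteq> star W"
      unfolding Q2_def \<theta>_def using star_append[OF star_replicate[OF W(2)]] starQ by auto
    show "[] \<in> Q2" using Q2I[of 0 "[]"] Q(3) by (simp add: th0)
    show "c2 [] = 1" using c2[of "[]" 0] Q(3,4) by (simp add: th0)
    show "b2 [] = 1" using b2[of "[]" 0] Q(3,5) by (simp add: th0)
    show "\<forall>w\<in>Q2. lead B (b2 w) w"
    proof
      fix w assume "w \<in> Q2"
      then obtain j u where w: "w = \<theta> (j, u)" "u \<in> Q" by (auto simp: Q2_def)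
      have "lead B ((\<mu> gx - 1) ^ j * b u) (concat (replicate j x) @ u)"
        using W gx Q(6)[OF w(2)] starQ w(2) star_L[OF W(3)] xL
        by (intro lead_mult lead_power) auto
      then show "lead B (b2 w) w" using b2[OF w(2)] w(1) by (simp add: \<theta>_def)
    qed
    show "\<mu> (gx [^] a \<otimes> h) - (\<Sum>w\<in>Q2. of_int (c2 w) * b2 w) \<in> R"
    proof -
      have "(\<Sum>w\<in>Q2. of_int (c2 w) * b2 w) = (\<Sum>(j,u)\<in>{..a} \<times> Q. of_int (c2 (\<theta> (j,u))) * b2 (\<theta> (j,u)))"
        unfolding Q2_def using inj_on_subset[OF inj, of "{..a} \<times> Q"] Q(2)
        by (subst sum.reindex) (auto simp: case_prod_unfold)
      also have "\<dots> = (\<Sum>(j,u)\<in>{..a} \<times> Q. (of_nat (a choose j) * (\<mu> gx - 1) ^ j) * (of_int (c u) * b u))"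
      proof (rule sum.cong)
        fix z assume "z \<in> {..a} \<times> Q"
        then obtain j u where z: "z = (j, u)" "u \<in> Q" by auto
        have "of_int (c2 (\<theta> (j,u))) * b2 (\<theta> (j,u)) =
            of_nat (a choose j) * (of_int (c u) * (\<mu> gx - 1) ^ j) * b u"
          using z by (simp add: c2 b2 mult.assoc)
        also have "of_int (c u) * (\<mu> gx - 1) ^ j = (\<mu> gx - 1) ^ j * of_int (c u)"
          by (rule mult_of_int_commute)
        finally show "(case z of (j, u) \<Rightarrow> of_int (c2 (\<theta> (j, u))) * b2 (\<theta> (j, u))) =
            (case z of (j, u) \<Rightarrow> of_nat (a choose j) * (\<mu> gx - 1) ^ j * (of_int (c u) * b u))"
          using z by (simp add: mult.assoc)
      qed simp
      also have "\<dots> = (\<Sum>j\<le>a. of_nat (a choose j) * (\<mu> gx - 1) ^ j) * (\<Sum>u\<in>Q. of_int (c u) * b u)"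
        by (simp add: sum_product sum.cartesian_product)
      also have "(\<Sum>j\<le>a. of_nat (a choose j) * (\<mu> gx - 1) ^ j) = \<mu> gx ^ a"
        using one_plus_power[of "\<mu> gx - 1" a] by simp
      finally have "\<mu> (gx [^] a \<otimes> h) - (\<Sum>w\<in>Q2. of_int (c2 w) * b2 w) =
          \<mu> gx ^ a * (\<mu> h - (\<Sum>u\<in>Q. of_int (c u) * b u))"
        using gxc h(2) by (simp add: mu_mult mu_pow right_diff_distrib)
      then show ?thesis
        using adic_mult_left[OF factorial_closed_L v Q(7)] by simp
    qed
    show "(\<forall>w\<in>Q2-{[]}. int p ^ v (length w) dvd c2 w) \<longrightarrow> gx [^] a \<otimes> h \<in> C"
    proof
      assume div: "\<forall>w\<in>Q2-{[]}. int p ^ v (length w) dvd c2 w"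
      have "int p ^ v (length u) dvd c u" if u: "u \<in> Q - {[]}" for u
        using bspec[OF div, of u] Q2I[of 0 u] c2[of u 0] u by (simp add: th0)
      then have hC: "h \<in> C" using C by blast
      have "p ^ v (j * length x) dvd a choose j" if j: "1 \<le> j" for j
      proof (cases "j \<le> a")
        case True
        have len: "length (\<theta> (j, [])) = j * length x"
          unfolding \<theta>_def by (induction j) auto
        then have "\<theta> (j, []) \<noteq> []" using W(4) j by (metis list.size(3) mult_is_0 not_one_le_zero)
        then have "int p ^ v (j * length x) dvd int (a choose j)"
          using bspec[OF div, of "\<theta> (j, [])"] Q2I[OF True Q(3)] c2[OF Q(3), of j] Q(4) len by simp
        then show ?thesis by (simp flip: of_nat_power)
      qed (simp add: binomial_eq_0)
      then have "gx [^] a \<in> C" using pow_C[OF W(4) gx(1)] by blast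
      then show "gx [^] a \<otimes> h \<in> C" using hC subgroup_C by (simp add: subgroup.m_closed)
    qed
  qed
  then show ?thesis .
qed

text \<open>\<open>W\<close> may grow in each elimination, so the induction is on the number of
  words of length at most \<open>n\<close> in \<open>star W\<close>. It drops strictly, since
  \<open>x\<close> is lost and nothing is gained. When no generator is left, the element lies in
  \<open>D\<close>.\<close>

theorem detected_generate:
  assumes "good W g" "h \<in> generate G (g ` W \<union> D)"
  shows "detected (star W) h"
  using assms
proof (induction "card (star W \<inter> {u. set u \<subseteq> {..<B} \<and> length u \<le> n})" arbitrary: W g h rule: less_induct)
  case less
  note W = less.prems(1)
  have Wc: "code W" "W \<subseteq> L" using W by (auto simp: good_def)
  show ?case
  proof (cases "W = {}")
    case True
    have "h \<in> D"
      using generate_subgroup_incl[OF _ subgroup_D, of D] less.prems(2) True by auto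
    then have "\<mu> h - 1 \<in> R" "h \<in> C" using mu_D D_C by auto
    then show ?thesis
      unfolding detected_def
      by (intro exI[of _ "{[]}"] exI[of _ "\<lambda>_. 1"])
         (simp add: star_Nil lead_Nil cf_one)
  next
    case False
    obtain x where x: "x \<in> W" "\<forall>y\<in>W-{x}. num B (x @ y) < num B (y @ x)"
      using exists_minimal_word[OF good_finite[OF W] False Wc B] by blast
    let ?it = "\<lambda>k y. ((\<lambda>z. comm G z (g x)) ^^ k) (g y)"
    let ?w = "\<lambda>(y, k). y @ concat (replicate k x)"
    have xne: "length x \<ge> 1" using code_Nil[OF Wc(1)] x(1) by (cases x) auto
    define W' where "W' = {u \<in> elim_words W x. length u < n}"
    \<comment> \<open>Both \<open>y\<close> and \<open>k\<close> can be recovered from the word, as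
      \<open>inj\<close> below shows.\<close>
    define g' where "g' u = (case inv_into ((W - {x}) \<times> UNIV) ?w u of (y, k) \<Rightarrow> ?it k y)" for u
    have inj: "inj_on ?w ((W - {x}) \<times> UNIV)"
    proof (rule inj_onI)
      fix z z' assume z: "z \<in> (W - {x}) \<times> UNIV" "z' \<in> (W - {x}) \<times> UNIV" "?w z = ?w z'"
      then show "z = z'"
        using elim_pair_unique[OF Wc(1) x(1), of "fst z" "fst z'" "snd z" "snd z'"]
        by (auto simp: case_prod_unfold prod_eq_iff)
    qed
    have g': "g' (y @ concat (replicate k x)) = ?it k y" if "y \<in> W - {x}" for y k
      using inv_into_f_f[OF inj, of "(y, k)"] that by (simp add: g'_def)
    note ge = good_elim[OF W x]
    have len: "length (y @ concat (replicate k x)) = length y + k * length x" for y k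
      by (induction k) auto
    have W': "good W' g'"
      unfolding good_def
    proof (intro conjI ballI)
      show "code W'" using code_subset[OF code_elim[OF Wc(1) x(1)]] by (simp add: W'_def)
      show "W' \<subseteq> L"
      proof
        fix u assume "u \<in> W'"
        then obtain y k where y: "y \<in> W - {x}" "u = y @ concat (replicate k x)"
          by (auto simp: W'_def elim_words_def)
        show "u \<in> L" using ge[OF y(1), of k] y(2) by blast
      qed
    next
      fix u assume u: "u \<in> W'"
      then obtain y k where y: "y \<in> W - {x}" "u = y @ concat (replicate k x)"
        by (auto simp: W'_def elim_words_def)
      show "length u < n" using u by (simp add: W'_def)
      show "g' u \<in> F (length u)" "lead B (\<mu> (g' u) - 1) u"
        using ge[OF y(1), of k] g'[OF y(1), of k] len[of y k] unfolding y(2) by simp_all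
    qed
    obtain a :: nat and h' where h': "h = g x [^] a \<otimes> h'" "h' \<in> generate G (g' ` W' \<union> D)"
    proof -
      have "?it k y \<in> D" if "y \<in> W - {x}" "n \<le> length y + k * length x" for y k
        using ge[OF that(1), of k] F_deep[OF that(2)] by blast
      moreover have "?it k y \<in> carrier G" if "y \<in> W - {x}" for y k
        using ge[OF that, of k] F_carr by blast
      ultimately show ?thesis
        using elim_generate[OF W x(1) W'_def g' _ _ less.prems(2)] that by blast
    qed
    have "h' \<in> carrier G"
    proof -
      have "g' ` W' \<union> D \<subseteq> carrier G"
        using W' F_carr subgroup.subset[OF subgroup_D] by (auto simp: good_def)
      then show ?thesis using h'(2) generate_in_carrier by blast
    qed
    moreover have "detected (star W') h'"
    proof (rule less.hyps[OF _ W' h'(2)])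
      let ?O = "{u. set u \<subseteq> {..<B} \<and> length u \<le> n}"
      have sub: "star W' \<subseteq> star (elim_words W x)"
        using star_incl[of _ "elim_words W x"] by (intro star_least) (auto simp: W'_def)
      have "x \<in> ?O" using W x(1) by (force simp: good_def)
      then have "star W' \<inter> ?O \<subset> star W \<inter> ?O"
        using sub star_least[OF elim_words_star[OF x(1)]] not_in_star_elim[OF Wc(1) x(1)]
          star_incl[OF x(1)] by blast
      then show "card (star W' \<inter> ?O) < card (star W \<inter> ?O)"
        by (intro psubset_card_mono) (simp_all add: finite_lists_length_le)
    qed
    ultimately show ?thesis
      unfolding h'(1) using W x(1) xne
      by (intro detected_elim[where x = x and W' = W']) (auto simp: good_def W'_def)
  qed
qed

corollary generate_imp_C:
  assumes "good W g" "h \<in> generate G (g ` W \<union> D)" "\<mu> h - 1 \<in> R"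
  shows "h \<in> C"
  using detected_imp[OF detected_generate[OF assms(1,2)] star_L assms(3)] assms(1)
  by (simp add: good_def)

end

section \<open>Topological groups\<close>

abbreviation dcont :: "'a topology \<Rightarrow> ('h, 'k) monoid_scheme \<Rightarrow> ('a \<Rightarrow> 'h) \<Rightarrow> bool" where
  "dcont T H \<equiv> continuous_map T (discrete_topology (carrier H))"

locale topgroup = group S for S :: "('a, 'b) monoid_scheme" (structure) and T :: "'a topology" +
  assumes topological_group: "topological_group S T"
begin

lemma topspace [simp]: "topspace T = carrier S"
  using topological_group by (simp add: topological_group_def)

lemma continuous_mult:
  assumes "continuous_map Z T f" "continuous_map Z T g"
  shows "continuous_map Z T (\<lambda>x. f x \<otimes> g x)"
proof -
  have "continuous_map (prod_topology T T) T (\<lambda>(x, y). x \<otimes> y)"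
    using topological_group by (simp add: topological_group_def)
  moreover have "continuous_map Z (prod_topology T T) (\<lambda>x. (f x, g x))"
    using assms by (simp add: continuous_map_paired)
  ultimately have "continuous_map Z T ((\<lambda>(x, y). x \<otimes> y) \<circ> (\<lambda>x. (f x, g x)))"
    by (rule continuous_map_compose[rotated])
  then show ?thesis by (simp add: o_def)
qed

lemma continuous_inv:
  assumes "continuous_map Z T f"
  shows "continuous_map Z T (\<lambda>x. inv (f x))"
proof -
  have "continuous_map T T (\<lambda>x. inv x)"
    using topological_group by (simp add: topological_group_def)
  then show ?thesis using continuous_map_compose[OF assms] by (simp add: o_def)
qed

lemma continuous_const: "a \<in> carrier S \<Longrightarrow> continuous_map Z T (\<lambda>x. a)"
  by simp

lemma closure_mem:
  assumes "x \<in> T closure_of H" "continuous_map T T f" "\<And>y. y \<in> H \<Longrightarrow> f y \<in> K" "closedin T K"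
  shows "f x \<in> K"
proof -
  have "f ` (T closure_of H) \<subseteq> T closure_of (f ` H)"
    by (rule continuous_map_image_closure_subset[OF assms(2)])
  also have "\<dots> \<subseteq> K" using assms(3,4) by (intro closure_of_minimal) auto
  finally show ?thesis using assms(1) by blast
qed

lemma closure_in_carrier: "x \<in> T closure_of H \<Longrightarrow> x \<in> carrier S"
  using closure_of_subset_topspace[of T H] by auto

lemma closure_subgroup:
  assumes "subgroup H S"
  shows "subgroup (T closure_of H) S"
proof
  have H: "H \<subseteq> T closure_of H"
    using subgroup.subset[OF assms] by (intro closure_of_subset) simp
  show "T closure_of H \<subseteq> carrier S" using closure_in_carrier by blast
  show "\<one> \<in> T closure_of H" using subgroup.one_closed[OF assms] H by blast
  have closed: "closedin T (T closure_of H)" by simp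
  have cid: "continuous_map T T (\<lambda>x. x)" by simp
  show "inv x \<in> T closure_of H" if x: "x \<in> T closure_of H" for x
  proof (rule closure_mem[OF x continuous_inv[OF cid] _ closed])
    fix y assume "y \<in> H"
    then show "inv y \<in> T closure_of H" using H subgroup.m_inv_closed[OF assms] by blast
  qed
  fix x y assume x: "x \<in> T closure_of H" and y: "y \<in> T closure_of H"
  \<comment> \<open>Closedness under products in two steps: first only the left factor runs through
    the closure, then the right one as well.\<close>
  have *: "x \<otimes> h \<in> T closure_of H" if h: "h \<in> H" for h
  proof (rule closure_mem[OF x continuous_mult[OF cid continuous_const] _ closed])
    show "h \<in> carrier S" using h subgroup.subset[OF assms] by blast
    fix y assume "y \<in> H"
    then show "y \<otimes> h \<in> T closure_of H" using h H subgroup.m_closed[OF assms] by blast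
  qed
  show "x \<otimes> y \<in> T closure_of H"
    by (rule closure_mem[OF y continuous_mult[OF continuous_const[OF closure_in_carrier[OF x]] cid] * closed])
qed

definition cnormal :: "'a set \<Rightarrow> bool" where
  "cnormal M \<longleftrightarrow> normal M S \<and> closedin T M"

lemma cnormalD:
  assumes "cnormal M"
  shows "subgroup M S" "M \<subseteq> carrier S" "closedin T M"
    "\<And>g h. g \<in> carrier S \<Longrightarrow> h \<in> M \<Longrightarrow> g \<otimes> h \<otimes> inv g \<in> M"
    "\<And>g h. g \<in> carrier S \<Longrightarrow> h \<in> M \<Longrightarrow> inv g \<otimes> h \<otimes> g \<in> M"
proof -
  have M: "normal M S" "closedin T M" using assms by (auto simp: cnormal_def)
  show "subgroup M S" by (rule normal_imp_subgroup[OF M(1)])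
  then show "M \<subseteq> carrier S" by (rule subgroup.subset)
  show "closedin T M" by (rule M(2))
  show "g \<otimes> h \<otimes> inv g \<in> M" if "g \<in> carrier S" "h \<in> M" for g h
    by (rule normal.inv_op_closed2[OF M(1) that])
  show "inv g \<otimes> h \<otimes> g \<in> M" if "g \<in> carrier S" "h \<in> M" for g h
    by (rule normal.inv_op_closed1[OF M(1) that])
qed

lemma cnormal_mem:
  assumes "cnormal M"
  shows "\<one> \<in> M" "x \<in> M \<Longrightarrow> inv x \<in> M" "x \<in> M \<Longrightarrow> y \<in> M \<Longrightarrow> x \<otimes> y \<in> M"
    "x \<in> M \<Longrightarrow> x \<in> carrier S"
  using subgroup.one_closed[OF cnormalD(1)[OF assms]] subgroup.m_inv_closed[OF cnormalD(1)[OF assms]]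
    subgroup.m_closed[OF cnormalD(1)[OF assms]] subsetD[OF cnormalD(2)[OF assms]] by simp_all

lemma cnormal_pow: "cnormal M \<Longrightarrow> x \<in> M \<Longrightarrow> x [^] (k::nat) \<in> M"
  by (induction k) (simp_all add: cnormal_mem)

lemma cnormal_carrier: "cnormal (carrier S)"
  unfolding cnormal_def using normal_invI[OF subgroup_self] closedin_topspace[of T] by simp

lemma closed_gen_closed: "closedin T (closed_gen S T A)"
  by (simp add: closed_gen_def)

lemma closed_gen_incl:
  assumes "A \<subseteq> carrier S"
  shows "A \<subseteq> closed_gen S T A"
proof -
  have "generate S A \<subseteq> closed_gen S T A"
    unfolding closed_gen_def using generate_incl[OF assms] by (intro closure_of_subset) simp
  moreover have "A \<subseteq> generate S A" by (rule subsetI) (rule generate.incl)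
  ultimately show ?thesis by simp
qed

lemma closed_gen_least:
  assumes "A \<subseteq> M" "subgroup M S" "closedin T M"
  shows "closed_gen S T A \<subseteq> M"
  unfolding closed_gen_def
  using generate_subgroup_incl[OF assms(1,2)] assms(3) by (rule closure_of_minimal)

lemma cnormal_closed_gen:
  assumes A: "A \<subseteq> carrier S" and conj: "\<And>g a. g \<in> carrier S \<Longrightarrow> a \<in> A \<Longrightarrow> g \<otimes> a \<otimes> inv g \<in> A"
  shows "cnormal (closed_gen S T A)"
proof -
  have nor: "normal (generate S A) S"
    using A conj by (intro normal_generateI) auto
  have "normal (closed_gen S T A) S"
  proof (rule normal_invI)
    show "subgroup (closed_gen S T A) S"
      unfolding closed_gen_def by (intro closure_subgroup generate_is_subgroup A)
    fix g x assume g: "g \<in> carrier S" and x: "x \<in> closed_gen S T A"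
    show "g \<otimes> x \<otimes> inv g \<in> closed_gen S T A"
    proof (rule closure_mem[OF x[unfolded closed_gen_def]])
      show "continuous_map T T (\<lambda>x. g \<otimes> x \<otimes> inv g)" 
        by (intro continuous_mult continuous_const g inv_closed) simp
      fix y assume "y \<in> generate S A"
      then have "g \<otimes> y \<otimes> inv g \<in> generate S A"
        using normal.inv_op_closed2[OF nor g] by blast
      then show "g \<otimes> y \<otimes> inv g \<in> closed_gen S T A"
        unfolding closed_gen_def using closure_of_subset[of "generate S A" T] generate_incl[OF A] by auto
    qed (rule closed_gen_closed)
  qed
  then show ?thesis by (simp add: cnormal_def closed_gen_closed)
qed

lemma comm_in_carrier [simp]: "x \<in> carrier S \<Longrightarrow> y \<in> carrier S \<Longrightarrow> comm S x y \<in> carrier S"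
  by (simp add: comm_def)

lemmas group_simps = comm_def m_assoc inv_mult_group inv_cancel_left

lemma conj_pow:
  assumes "g \<in> carrier S" "x \<in> carrier S"
  shows "g \<otimes> x [^] (k::nat) \<otimes> inv g = (g \<otimes> x \<otimes> inv g) [^] k"
proof (induction k)
  case (Suc k)
  have "g \<otimes> x [^] Suc k \<otimes> inv g = (g \<otimes> x [^] k \<otimes> inv g) \<otimes> (g \<otimes> x \<otimes> inv g)"
    using assms by (simp add: m_assoc inv_cancel_left)
  then show ?case using Suc by simp
qed (use assms in simp)

lemma conj_comm:
  assumes "g \<in> carrier S" "x \<in> carrier S" "y \<in> carrier S"
  shows "g \<otimes> comm S x y \<otimes> inv g = comm S (g \<otimes> x \<otimes> inv g) (g \<otimes> y \<otimes> inv g)"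
  using assms by (simp add: group_simps)

lemma commsub_incl:
  assumes "H \<subseteq> carrier S" "K \<subseteq> carrier S" "x \<in> H" "y \<in> K"
  shows "comm S x y \<in> commsub S T H K"
proof -
  have "{comm S x y | x y. x \<in> H \<and> y \<in> K} \<subseteq> commsub S T H K"
    unfolding commsub_def using assms(1,2) by (intro closed_gen_incl) (auto intro!: comm_in_carrier)
  then show ?thesis using assms(3,4) by blast
qed

lemma ppow_incl:
  assumes "H \<subseteq> carrier S" "x \<in> H"
  shows "x [^] p \<in> ppow S T p H"
proof -
  have "{x [^] p | x. x \<in> H} \<subseteq> ppow S T p H"
    unfolding ppow_def using assms(1) by (intro closed_gen_incl) (auto intro!: nat_pow_closed)
  then show ?thesis using assms(2) by blast
qed

lemma cnormal_commsub:
  assumes "cnormal H" "cnormal K"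
  shows "cnormal (commsub S T H K)"
  unfolding commsub_def
proof (rule cnormal_closed_gen)
  show "{comm S x y | x y. x \<in> H \<and> y \<in> K} \<subseteq> carrier S"
    using cnormalD(2)[OF assms(1)] cnormalD(2)[OF assms(2)] by (auto intro!: comm_in_carrier)
  fix g a assume g: "g \<in> carrier S" and "a \<in> {comm S x y | x y. x \<in> H \<and> y \<in> K}"
  then obtain x y where "x \<in> H" "y \<in> K" "a = comm S x y" by blast
  then show "g \<otimes> a \<otimes> inv g \<in> {comm S x y | x y. x \<in> H \<and> y \<in> K}"
    using conj_comm[of g x y] g cnormalD(4)[OF assms(1)] cnormalD(4)[OF assms(2)]
      cnormal_mem(4)[OF assms(1)] cnormal_mem(4)[OF assms(2)] by blast
qed

lemma cnormal_ppow:
  assumes "cnormal H"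
  shows "cnormal (ppow S T p H)"
  unfolding ppow_def
proof (rule cnormal_closed_gen)
  show "{x [^] p | x. x \<in> H} \<subseteq> carrier S"
    using cnormalD(2)[OF assms] by (auto intro!: nat_pow_closed)
  fix g a assume g: "g \<in> carrier S" and "a \<in> {x [^] p | x. x \<in> H}"
  then obtain x where "x \<in> H" "a = x [^] p" by blast
  then show "g \<otimes> a \<otimes> inv g \<in> {x [^] p | x. x \<in> H}"
    using conj_pow[of g x p] g cnormalD(4)[OF assms] cnormal_mem(4)[OF assms] by blast
qed

lemma cnormal_closed_gen_Un:
  assumes "\<And>M. M \<in> \<M> \<Longrightarrow> cnormal M"
  shows "cnormal (closed_gen S T (\<Union>\<M>))"
proof (rule cnormal_closed_gen)
  show "\<Union>\<M> \<subseteq> carrier S" using cnormalD(2)[OF assms] by (rule Union_least)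
  fix g a assume g: "g \<in> carrier S" and "a \<in> \<Union>\<M>"
  then obtain M where "M \<in> \<M>" "a \<in> M" by blast
  then show "g \<otimes> a \<otimes> inv g \<in> \<Union>\<M>" using cnormalD(4)[OF assms g] by blast
qed

lemma commsub_least:
  assumes "cnormal M" "\<And>x y. x \<in> H \<Longrightarrow> y \<in> K \<Longrightarrow> comm S x y \<in> M"
  shows "commsub S T H K \<subseteq> M"
  unfolding commsub_def using cnormalD(1,3)[OF assms(1)] assms(2) by (intro closed_gen_least) auto

lemma ppow_least:
  assumes "cnormal M" "\<And>x. x \<in> H \<Longrightarrow> x [^] p \<in> M"
  shows "ppow S T p H \<subseteq> M"
  unfolding ppow_def using cnormalD(1,3)[OF assms(1)] assms(2) by (intro closed_gen_least) auto

lemma comm_in_normal: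
  assumes M: "cnormal M" and x: "x \<in> carrier S" and y: "y \<in> carrier S" and xy: "x \<in> M \<or> y \<in> M"
  shows "comm S x y \<in> M"
  using xy
proof
  assume xM: "x \<in> M"
  have "inv x \<otimes> (inv y \<otimes> x \<otimes> y) \<in> M"
    by (rule cnormal_mem(3)[OF M cnormal_mem(2)[OF M xM] cnormalD(5)[OF M y xM]])
  then show ?thesis using x y by (simp add: group_simps)
next
  assume yM: "y \<in> M"
  have "(inv x \<otimes> inv y \<otimes> x) \<otimes> y \<in> M"
    by (rule cnormal_mem(3)[OF M cnormalD(5)[OF M x cnormal_mem(2)[OF M yM]] yM])
  then show ?thesis using x y by (simp add: group_simps)
qed

section \<open>The filtrations\<close>

lemma cnormal_lower_central: "cnormal (lower_central S T i)"
  by (induction i) (simp_all add: cnormal_carrier cnormal_commsub)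

lemma lower_central_comm:
  "1 \<le> i \<Longrightarrow> x \<in> lower_central S T i \<Longrightarrow> y \<in> carrier S \<Longrightarrow> comm S x y \<in> lower_central S T (Suc i)"
  using commsub_incl[OF cnormalD(2)[OF cnormal_lower_central] order.refl] by simp

lemma lower_central_Suc_subset: "lower_central S T (Suc i) \<subseteq> lower_central S T i"
proof (cases "i = 0")
  case False
  then show ?thesis
    using commsub_least[OF cnormal_lower_central, of "lower_central S T i" "carrier S" i]
      comm_in_normal[OF cnormal_lower_central] cnormal_mem(4)[OF cnormal_lower_central] by auto
qed simp

lemma lower_central_antimono: "i \<le> j \<Longrightarrow> lower_central S T j \<subseteq> lower_central S T i"
  by (rule lift_Suc_antimono_le) (rule lower_central_Suc_subset)

lemma hall_witt:
  assumes "x \<in> carrier S" "y \<in> carrier S" "z \<in> carrier S"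
  shows "(inv y \<otimes> comm S (comm S x (inv y)) z \<otimes> y) \<otimes>
    ((inv z \<otimes> comm S (comm S y (inv z)) x \<otimes> z) \<otimes>
     (inv x \<otimes> comm S (comm S z (inv x)) y \<otimes> x)) = \<one>"
  using assms by (simp add: group_simps)

lemma comm_swap: "x \<in> carrier S \<Longrightarrow> y \<in> carrier S \<Longrightarrow> inv (comm S x y) = comm S y x"
  by (simp add: group_simps)

lemma cnormal_conj_iff:
  assumes "cnormal M" "g \<in> carrier S" "x \<in> carrier S"
  shows "inv g \<otimes> x \<otimes> g \<in> M \<longleftrightarrow> x \<in> M"
proof
  assume "inv g \<otimes> x \<otimes> g \<in> M"
  then have "g \<otimes> (inv g \<otimes> x \<otimes> g) \<otimes> inv g \<in> M" using cnormalD(4)[OF assms(1,2)] by blast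
  then show "x \<in> M" using assms(2,3) by (simp add: m_assoc inv_cancel_left)
qed (rule cnormalD(5)[OF assms(1,2)])

text \<open>In the Hall-Witt identity two of the three conjugates lie in \<open>M\<close>, hence so
  does the third.\<close>

lemma three_subgroups:
  assumes M: "cnormal M" and c: "x \<in> carrier S" "y \<in> carrier S" "z \<in> carrier S"
    and "comm S (comm S x (inv y)) z \<in> M" "comm S (comm S z (inv x)) y \<in> M"
  shows "comm S (comm S y (inv z)) x \<in> M"
proof -
  let ?a = "inv y \<otimes> comm S (comm S x (inv y)) z \<otimes> y"
    and ?b = "inv z \<otimes> comm S (comm S y (inv z)) x \<otimes> z"
    and ?c = "inv x \<otimes> comm S (comm S z (inv x)) y \<otimes> x"
  have ac: "?a \<in> M" "?c \<in> M" using assms cnormalD(5)[OF M] by auto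
  have car: "?a \<in> carrier S" "?b \<in> carrier S" "?c \<in> carrier S" using c by auto
  have "?b = inv ?a \<otimes> (?a \<otimes> (?b \<otimes> ?c)) \<otimes> inv ?c"
    using car by (simp only: m_assoc inv_cancel_left inv_closed m_closed r_inv r_one)
  also have "\<dots> = inv ?a \<otimes> \<one> \<otimes> inv ?c"
    by (simp only: hall_witt[OF c])
  also have "\<dots> \<in> M"
    by (rule cnormal_mem(3)[OF M cnormal_mem(3)[OF M cnormal_mem(2)[OF M ac(1)] cnormal_mem(1)[OF M]]
          cnormal_mem(2)[OF M ac(2)]])
  finally have "?b \<in> M" .
  then show ?thesis using cnormal_conj_iff[OF M c(3)] c by simp
qed

text \<open>For fixed \<open>x\<close> the admissible \<open>y\<close> form a closed subgroup, so it
  suffices to treat the generators \<open>comm S u z\<close> of the next term. There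
  \<open>three_subgroups\<close> reduces the claim to the pairs \<open>(i, j)\<close> and
  \<open>(i + 1, j)\<close>, which is why \<open>i\<close> is arbitrary in the induction on
  \<open>j\<close>.\<close>

lemma lower_central_comm_general:
  assumes "1 \<le> i" "1 \<le> j" "x \<in> lower_central S T i" "y \<in> lower_central S T j"
  shows "comm S x y \<in> lower_central S T (i + j)"
  using assms(2,1,3,4)
proof (induction j arbitrary: i x y rule: dec_induct)
  case base
  then show ?case using lower_central_comm[of i x y] cnormal_mem(4)[OF cnormal_lower_central] by simp
next
  case (step j)
  let ?M = "lower_central S T (i + Suc j)"
  note M = cnormal_lower_central[of "i + Suc j"]
  have x: "x \<in> carrier S" using step.prems cnormal_mem(4)[OF cnormal_lower_central] by blast
  let ?Y = "{y \<in> carrier S. comm S x y \<in> ?M}"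
  have sub: "subgroup ?Y S"
  proof
    show "\<one> \<in> ?Y" using x cnormal_mem(1)[OF M] by (simp add: comm_def)
  next
    fix u w assume u: "u \<in> ?Y" and w: "w \<in> ?Y"
    \<comment> \<open>This product is \<open>comm S x (u \<otimes> w)\<close>.\<close>
    have "comm S x w \<otimes> (inv w \<otimes> comm S x u \<otimes> w) \<in> ?M"
      using u w cnormal_mem(3)[OF M _ cnormalD(5)[OF M]] by simp
    then show "u \<otimes> w \<in> ?Y" using u w x by (simp add: group_simps)
  next
    fix u assume u: "u \<in> ?Y"
    \<comment> \<open>This conjugate is \<open>comm S x (inv u)\<close>.\<close>
    have "u \<otimes> inv (comm S x u) \<otimes> inv u \<in> ?M"
      using u cnormalD(4)[OF M _ cnormal_mem(2)[OF M]] by simp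
    then show "inv u \<in> ?Y" using u x by (simp add: group_simps)
  qed auto
  have "closedin T {y \<in> topspace T. comm S x y \<in> ?M}"
    using cnormalD(3)[OF M] unfolding comm_def
    by (rule closedin_continuous_map_preimage[rotated])
       (intro continuous_mult continuous_inv continuous_const x inv_closed, simp_all)
  then have clo: "closedin T ?Y" by simp
  have "comm S u z \<in> ?Y" if u: "u \<in> lower_central S T j" and z: "z \<in> carrier S" for u z
  proof -
    have uc: "u \<in> carrier S" using u cnormal_mem(4)[OF cnormal_lower_central] by blast
    have "comm S x (inv u) \<in> lower_central S T (i + j)"
      using step.IH[OF step.prems(1,2)] cnormal_mem(2)[OF cnormal_lower_central u] by blast
    then have 1: "comm S (comm S x (inv u)) (inv z) \<in> ?M"
      using lower_central_comm[of "i + j"] step.prems z by simp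
    have "comm S (inv x) (inv z) \<in> lower_central S T (Suc i)"
      using lower_central_comm[OF step.prems(1)] cnormal_mem(2)[OF cnormal_lower_central step.prems(2)] z
      by simp
    then have "inv (comm S (inv x) (inv z)) \<in> lower_central S T (Suc i)"
      by (rule cnormal_mem(2)[OF cnormal_lower_central])
    then have "comm S (inv z) (inv x) \<in> lower_central S T (Suc i)"
      using x z by (simp add: comm_swap)
    then have 2: "comm S (comm S (inv z) (inv x)) u \<in> ?M"
      using step.IH[of "Suc i" _ u] u by simp
    have "comm S (comm S u (inv (inv z))) x \<in> ?M"
      using three_subgroups[OF M x uc _ 1 2] z by simp
    then have "inv (comm S (comm S u z) x) \<in> ?M"
      using z by (intro cnormal_mem(2)[OF M]) simp
    then show ?thesis using x uc z by (simp add: comm_swap)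
  qed
  then have "{comm S u z | u z. u \<in> lower_central S T j \<and> z \<in> carrier S} \<subseteq> ?Y"
    by blast
  then have "commsub S T (lower_central S T j) (carrier S) \<subseteq> ?Y"
    unfolding commsub_def using sub clo by (rule closed_gen_least)
  moreover have "lower_central S T (Suc j) = commsub S T (lower_central S T j) (carrier S)"
    using step.hyps(1) by simp
  ultimately have "lower_central S T (Suc j) \<subseteq> ?Y" by simp
  then show ?case using step.prems by blast
qed

section \<open>The descending p-central series\<close>

lemma p_central_Suc_gen:
  "1 \<le> i \<Longrightarrow> p_central p S T (Suc i) = closed_gen S T
     (\<Union>{ppow S T p (p_central p S T i), commsub S T (p_central p S T i) (carrier S)})"
  by simp

lemma cnormal_p_central: "cnormal (p_central p S T i)"
proof (induction i)
  case (Suc i)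
  show ?case
  proof (cases "i = 0")
    case False
    then have "1 \<le> i" by simp
    moreover have "cnormal (closed_gen S T
        (\<Union>{ppow S T p (p_central p S T i), commsub S T (p_central p S T i) (carrier S)}))"
      using cnormal_ppow[OF Suc] cnormal_commsub[OF Suc cnormal_carrier]
      by (intro cnormal_closed_gen_Un) blast
    ultimately show ?thesis by (simp only: p_central_Suc_gen)
  qed (simp add: cnormal_carrier)
qed (simp add: cnormal_carrier)

lemma p_central_Suc_supset:
  assumes "1 \<le> i"
  shows "ppow S T p (p_central p S T i) \<subseteq> p_central p S T (Suc i)"
    "commsub S T (p_central p S T i) (carrier S) \<subseteq> p_central p S T (Suc i)"
proof -
  let ?A = "ppow S T p (p_central p S T i) \<union> commsub S T (p_central p S T i) (carrier S)"
  have "?A \<subseteq> carrier S"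
    by (intro Un_least cnormalD(2) cnormal_ppow cnormal_commsub cnormal_p_central cnormal_carrier)
  then have "?A \<subseteq> closed_gen S T ?A" by (rule closed_gen_incl)
  then show "ppow S T p (p_central p S T i) \<subseteq> p_central p S T (Suc i)"
    "commsub S T (p_central p S T i) (carrier S) \<subseteq> p_central p S T (Suc i)"
    using assms by auto
qed

lemma p_central_pow:
  "1 \<le> i \<Longrightarrow> x \<in> p_central p S T i \<Longrightarrow> x [^] p \<in> p_central p S T (Suc i)"
  using p_central_Suc_supset(1) ppow_incl[OF cnormalD(2)[OF cnormal_p_central]] by blast

lemma p_central_pow_power:
  "1 \<le> i \<Longrightarrow> x \<in> p_central p S T i \<Longrightarrow> x [^] (p ^ k) \<in> p_central p S T (i + k)"
proof (induction k)
  case (Suc k)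
  have "x \<in> carrier S" using Suc.prems cnormal_mem(4)[OF cnormal_p_central] by blast
  then have "x [^] (p ^ Suc k) = (x [^] (p ^ k)) [^] p"
    by (simp add: nat_pow_pow mult.commute)
  then show ?case using p_central_pow[of "i + k"] Suc by simp
next
  case 0
  then show ?case using cnormal_mem(4)[OF cnormal_p_central] by simp
qed

lemma p_central_least:
  assumes "1 \<le> i" "cnormal M" "\<And>x. x \<in> p_central p S T i \<Longrightarrow> x [^] p \<in> M"
    "\<And>x y. x \<in> p_central p S T i \<Longrightarrow> y \<in> carrier S \<Longrightarrow> comm S x y \<in> M"
  shows "p_central p S T (Suc i) \<subseteq> M"
proof -
  have "closed_gen S T (ppow S T p (p_central p S T i) \<union> commsub S T (p_central p S T i) (carrier S)) \<subseteq> M"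
    using ppow_least[OF assms(2,3)] commsub_least[OF assms(2,4)] cnormalD(1,3)[OF assms(2)]
    by (intro closed_gen_least) auto
  then show ?thesis using assms(1) by simp
qed

lemma p_central_antimono: "i \<le> j \<Longrightarrow> p_central p S T j \<subseteq> p_central p S T i"
proof (rule lift_Suc_antimono_le)
  fix i
  show "p_central p S T (Suc i) \<subseteq> p_central p S T i"
  proof (cases "i = 0")
    case False
    then show ?thesis
      using cnormal_pow[OF cnormal_p_central] comm_in_normal[OF cnormal_p_central]
        cnormal_mem(4)[OF cnormal_p_central]
      by (intro p_central_least cnormal_p_central) auto
  qed simp
qed

lemma lower_central_p_central: "lower_central S T i \<subseteq> p_central p S T i"
proof (induction i)
  case (Suc i)
  show ?case
  proof (cases "i = 0")
    case False
    have "commsub S T (lower_central S T i) (carrier S) \<subseteq> p_central p S T (Suc i)"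
    proof (rule commsub_least[OF cnormal_p_central])
      fix x y assume "x \<in> lower_central S T i" "y \<in> carrier S"
      then have "comm S x y \<in> commsub S T (p_central p S T i) (carrier S)"
        using Suc commsub_incl[OF cnormalD(2)[OF cnormal_p_central] order.refl] by blast
      then show "comm S x y \<in> p_central p S T (Suc i)"
        using p_central_Suc_supset(2)[of i p] False by auto
    qed
    then show ?thesis using False by simp
  qed simp
qed simp

end

declare zassenhaus.simps [simp del]

context topgroup
begin

section \<open>The Zassenhaus filtration\<close>

definition zassenhaus_parts :: "nat \<Rightarrow> nat \<Rightarrow> 'a set set" where
  "zassenhaus_parts p n = insert (ppow S T p (zassenhaus p S T ((n + p - 1) div p)))
     ((\<lambda>i. commsub S T (zassenhaus p S T i) (zassenhaus p S T (n - i))) ` {1..<n})"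

lemma zassenhaus_eq:
  assumes "2 \<le> p" "2 \<le> n"
  shows "zassenhaus p S T n = closed_gen S T (\<Union>(zassenhaus_parts p n))"
  using assms by (subst zassenhaus.simps) (simp add: zassenhaus_parts_def)

lemma zassenhaus_1: "n \<le> 1 \<Longrightarrow> zassenhaus p S T n = carrier S"
  by (subst zassenhaus.simps) simp

lemma cnormal_zassenhaus:
  assumes "2 \<le> p"
  shows "cnormal (zassenhaus p S T n)"
proof (induction n rule: less_induct)
  case (less n)
  show ?case
  proof (cases "n \<le> 1")
    case False
    have "(n + p - 1) div p < n" using ceil_div_less[of n p] False assms by simp
    then have "cnormal M" if "M \<in> zassenhaus_parts p n" for M
      using that less by (auto simp: zassenhaus_parts_def intro!: cnormal_ppow cnormal_commsub)
    then show ?thesis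
      using False assms by (simp add: zassenhaus_eq cnormal_closed_gen_Un)
  qed (simp add: zassenhaus_1 cnormal_carrier)
qed

lemma zassenhaus_supset:
  assumes "2 \<le> p" "2 \<le> n" "M \<in> zassenhaus_parts p n"
  shows "M \<subseteq> zassenhaus p S T n"
proof -
  have "cnormal M'" if "M' \<in> zassenhaus_parts p n" for M'
    using that cnormal_zassenhaus[OF assms(1)]
    by (auto simp: zassenhaus_parts_def intro!: cnormal_ppow cnormal_commsub)
  then have "\<Union>(zassenhaus_parts p n) \<subseteq> carrier S"
    using cnormalD(2) by blast
  then show ?thesis using closed_gen_incl assms zassenhaus_eq by blast
qed

lemma zassenhaus_comm:
  assumes p: "2 \<le> p" and "1 \<le> i" "1 \<le> j" "x \<in> zassenhaus p S T i" "y \<in> zassenhaus p S T j"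
  shows "comm S x y \<in> zassenhaus p S T (i + j)"
proof -
  have "comm S x y \<in> commsub S T (zassenhaus p S T i) (zassenhaus p S T (i + j - i))"
    using assms cnormalD(2)[OF cnormal_zassenhaus[OF p]] by (intro commsub_incl) auto
  moreover have "commsub S T (zassenhaus p S T i) (zassenhaus p S T (i + j - i)) \<in> zassenhaus_parts p (i + j)"
    using assms by (auto simp: zassenhaus_parts_def intro!: image_eqI[of _ _ i])
  ultimately show ?thesis using zassenhaus_supset[OF p, of "i + j"] assms by fastforce
qed

lemma zassenhaus_pow_ceil:
  assumes p: "2 \<le> p" and "2 \<le> n" "x \<in> zassenhaus p S T ((n + p - 1) div p)"
  shows "x [^] p \<in> zassenhaus p S T n"
proof -
  have "x [^] p \<in> ppow S T p (zassenhaus p S T ((n + p - 1) div p))"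
    using assms cnormalD(2)[OF cnormal_zassenhaus[OF p]] by (intro ppow_incl) auto
  then show ?thesis
    using zassenhaus_supset[OF p, of n] assms by (auto simp: zassenhaus_parts_def)
qed

lemma zassenhaus_least:
  assumes p: "2 \<le> p" and n: "2 \<le> n" and M: "cnormal M"
    and pow: "\<And>x. x \<in> zassenhaus p S T ((n + p - 1) div p) \<Longrightarrow> x [^] p \<in> M"
    and com: "\<And>i x y. 1 \<le> i \<Longrightarrow> i < n \<Longrightarrow> x \<in> zassenhaus p S T i \<Longrightarrow> y \<in> zassenhaus p S T (n - i) \<Longrightarrow>
                comm S x y \<in> M"
  shows "zassenhaus p S T n \<subseteq> M"
  unfolding zassenhaus_eq[OF p n]
proof (rule closed_gen_least)
  have "ppow S T p (zassenhaus p S T ((n + p - 1) div p)) \<subseteq> M"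
    by (rule ppow_least[OF M pow])
  moreover have "commsub S T (zassenhaus p S T i) (zassenhaus p S T (n - i)) \<subseteq> M"
    if "i \<in> {1..<n}" for i
    using that by (intro commsub_least[OF M com]) auto
  ultimately have "Z \<subseteq> M" if "Z \<in> zassenhaus_parts p n" for Z
    using that unfolding zassenhaus_parts_def by blast
  then show "\<Union>(zassenhaus_parts p n) \<subseteq> M" by blast
qed (use cnormalD[OF M] in auto)

text \<open>The ceiling of \<open>(n + 1) / p\<close> may be that of \<open>n / p\<close> or one
  more; in the second case the inclusion of consecutive earlier terms is needed, so the induction is
  over all smaller indices.\<close>

lemma zassenhaus_Suc_subset:
  assumes p: "2 \<le> p"
  shows "zassenhaus p S T (Suc n) \<subseteq> zassenhaus p S T n"
proof (induction n rule: less_induct)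
  case (less n)
  note cn = cnormal_zassenhaus[OF p]
  show ?case
  proof (cases "n \<le> 1")
    case True
    then show ?thesis using zassenhaus_1[of n] cnormalD(2)[OF cn] by simp
  next
    case False
    show ?thesis
    proof (rule zassenhaus_least[OF p _ cn])
      fix x assume x: "x \<in> zassenhaus p S T ((Suc n + p - 1) div p)"
      let ?m = "(n + p - 1) div p"
      have "(Suc n + p - 1) div p = ?m \<or> (Suc n + p - 1) div p = Suc ?m"
      proof -
        have "Suc n + p - 1 = Suc (n + p - 1)" using p by simp
        then show ?thesis by (simp only: div_Suc) simp
      qed
      moreover have "?m < n" using ceil_div_less[of n p] False p by simp
      ultimately have "x \<in> zassenhaus p S T ?m" using x subsetD[OF less[of ?m]] by fastforce
      then show "x [^] p \<in> zassenhaus p S T n" using zassenhaus_pow_ceil[OF p] False by simp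
    next
      fix i x y assume i: "1 \<le> i" "i < Suc n"
        and x: "x \<in> zassenhaus p S T i" and y: "y \<in> zassenhaus p S T (Suc n - i)"
      show "comm S x y \<in> zassenhaus p S T n"
      proof (cases "i = n")
        \<comment> \<open>Here \<open>x\<close> already lies in the \<open>n\<close>-th term, and
          normality is enough.\<close>
        case True
        then show ?thesis using x y zassenhaus_1[of 1] comm_in_normal[OF cn] cnormal_mem(4)[OF cn] by blast
      next
        case False
        then have "y \<in> zassenhaus p S T (n - i)"
          using y i subsetD[OF less[of "n - i"], of y] by (simp add: Suc_diff_le)
        then show ?thesis using zassenhaus_comm[OF p i(1) _ x, of "n - i"] False i by simp
      qed
    qed (use False in simp)
  qed
qed

lemma zassenhaus_antimono: "2 \<le> p \<Longrightarrow> i \<le> j \<Longrightarrow> zassenhaus p S T j \<subseteq> zassenhaus p S T i"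
  by (rule lift_Suc_antimono_le) (rule zassenhaus_Suc_subset)

lemma zassenhaus_pow:
  assumes p: "2 \<le> p" and i: "1 \<le> i" "x \<in> zassenhaus p S T i"
  shows "x [^] p \<in> zassenhaus p S T (i * p)"
proof -
  have "(i * p + p - 1) div p = i" 
  proof -
    have "i * p + p - 1 = (p - 1) + i * p" using p by simp
    then show ?thesis using p by (simp only: div_mult_self1) simp
  qed
  moreover have "2 \<le> i * p" using p i(1) mult_le_mono[of 1 i 2 p] by simp
  ultimately show ?thesis using zassenhaus_pow_ceil[OF p] i by simp
qed

lemma zassenhaus_pow_power:
  assumes p: "2 \<le> p" and i: "1 \<le> i" "x \<in> zassenhaus p S T i"
  shows "x [^] (p ^ k) \<in> zassenhaus p S T (i * p ^ k)"
proof (induction k)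
  case 0
  then show ?case using i cnormal_mem(4)[OF cnormal_zassenhaus[OF p]] by simp
next
  case (Suc k)
  have "x \<in> carrier S" using i cnormal_mem(4)[OF cnormal_zassenhaus[OF p]] by blast
  then have "x [^] (p ^ Suc k) = (x [^] (p ^ k)) [^] p"
    by (simp add: nat_pow_pow mult.commute)
  then show ?case using zassenhaus_pow[OF p, of "i * p ^ k"] Suc i p by (simp add: ac_simps)
qed

end

section \<open>Profinite groups and universal properties\<close>

text \<open>The connected component of \<open>s\<close> is \<open>{s}\<close>, and in a compact
  Hausdorff space a component has clopen neighbourhoods inside any given open neighbourhood.\<close>

lemma (in topgroup) clopen_separation:
  assumes "profinite_group S T" "closedin T F" "s \<in> carrier S" "s \<notin> F"
  obtains V where "openin T V" "closedin T V" "s \<in> V" "V \<inter> F = {}"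
proof -
  have T: "compact_space T" "Hausdorff_space T" "connected_component_of_set T s = {s}"
    using assms by (auto simp: profinite_group_def)
  have "{s} \<in> connected_components_of T"
    unfolding connected_components_of_def using T(3) assms(3) by (intro image_eqI[of _ _ s]) auto
  moreover have "openin T (carrier S - F)"
    using assms(2) by (simp add: closedin_def)
  ultimately obtain U V where UV: "openin T U" "openin T V" "disjnt U V" "U \<union> V = topspace T"
      "{s} \<subseteq> U" "U \<subseteq> carrier S - F"
    using wilder_locally_compact_component_thm[OF compact_imp_locally_compact_space[OF T(1)] T(2),
        of "{s}" "carrier S - F"] assms(3,4) by auto
  have "topspace T - U = V" using UV(3,4) by (auto simp: disjnt_def)
  then have "closedin T U"
    using UV(2) openin_subset[OF UV(1)] by (simp add: closedin_def)
  then show thesis using that[of U] UV by blast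
qed

lemma (in topgroup) openin_preimage:
  assumes "continuous_map T Z f" "openin Z U"
  shows "openin T {x \<in> carrier S. f x \<in> U}"
  using openin_continuous_map_preimage[OF assms] by simp

text \<open>\<open>N\<close> consists of those \<open>x\<close> that may be inserted anywhere in a
  product without affecting membership in \<open>V\<close>: the class of the identity under the
  syntactic congruence of \<open>V\<close>. Its complement is the projection of the closed set
  \<open>E\<close> along the compact space of pairs \<open>(a, b)\<close>, and such projections are
  closed maps, so \<open>N\<close> is open.\<close>

lemma (in topgroup) open_normal_core:
  assumes cpt: "compact_space T" and V: "openin T V" "closedin T V" "s \<in> V"
  obtains N where "openin T N" "normal N S" "\<And>x. x \<in> N \<Longrightarrow> s \<otimes> x \<in> V"
proof -
  have Vc: "V \<subseteq> carrier S" using openin_subset[OF V(1)] by simp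
  define N where "N = {x \<in> carrier S. \<forall>a\<in>carrier S. \<forall>b\<in>carrier S. a \<otimes> x \<otimes> b \<in> V \<longleftrightarrow> a \<otimes> b \<in> V}"
  let ?P = "prod_topology (prod_topology T T) T"
  define f where "f = (\<lambda>((a, b), x). a \<otimes> x \<otimes> b)"
  define g where "g = (\<lambda>((a, b), x :: 'a). a \<otimes> b)"
  have f1: "continuous_map ?P T (\<lambda>z. fst (fst z))" and f2: "continuous_map ?P T (\<lambda>z. snd (fst z))"
    and f3: "continuous_map ?P T snd"
  proof -
    have "continuous_map ?P T (fst \<circ> fst)"
      by (rule continuous_map_compose[OF continuous_map_fst continuous_map_fst])
    then show "continuous_map ?P T (\<lambda>z. fst (fst z))" by (simp add: o_def)
    have "continuous_map ?P T (snd \<circ> fst)"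
      by (rule continuous_map_compose[OF continuous_map_fst continuous_map_snd])
    then show "continuous_map ?P T (\<lambda>z. snd (fst z))" by (simp add: o_def)
  qed (rule continuous_map_snd)
  have f: "continuous_map ?P T f" and g: "continuous_map ?P T g"
    unfolding f_def g_def case_prod_unfold by (intro continuous_mult f1 f2 f3)+
  let ?Z = "\<lambda>h U. {z \<in> topspace ?P. h z \<in> U}"
  have clo: "closedin ?P (?Z h V)" "closedin ?P (?Z h (carrier S - V))" if "continuous_map ?P T h" for h
    using closedin_continuous_map_preimage[OF that V(2)]
      closedin_continuous_map_preimage[OF that, of "carrier S - V"] V(1) openin_closedin_eq[of T V] by simp_all
  define E where "E = (?Z f V \<inter> ?Z g (carrier S - V)) \<union> (?Z f (carrier S - V) \<inter> ?Z g V)"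
  have "closedin ?P E"
    unfolding E_def using clo[OF f] clo[OF g] by (intro closedin_Un closedin_Int) auto
  moreover have "closed_map ?P T snd"
    using cpt by (intro closed_map_snd) (simp add: compact_space_prod_topology)
  ultimately have "closedin T (snd ` E)" by (simp add: closed_map_def)
  moreover have "snd ` E = carrier S - N"
  proof
    show "snd ` E \<subseteq> carrier S - N"
      unfolding E_def N_def f_def g_def by auto
    show "carrier S - N \<subseteq> snd ` E"
    proof
      fix x assume "x \<in> carrier S - N"
      then obtain a b where "a \<in> carrier S" "b \<in> carrier S" "x \<in> carrier S"
          "(a \<otimes> x \<otimes> b \<in> V) \<noteq> (a \<otimes> b \<in> V)" unfolding N_def by blast
      then have "((a, b), x) \<in> E" unfolding E_def f_def g_def by auto
      then show "x \<in> snd ` E" by force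
    qed
  qed
  moreover have Nc: "N \<subseteq> carrier S" by (auto simp: N_def)
  ultimately have "openin T N" by (simp add: openin_closedin)
  moreover have "normal N S"
  proof (rule normal_invI)
    show "subgroup N S"
    proof
      fix x y assume x: "x \<in> N" and y: "y \<in> N"
      have xy: "x \<in> carrier S" "y \<in> carrier S" using x y Nc by auto
      have "a \<otimes> (x \<otimes> y) \<otimes> b \<in> V \<longleftrightarrow> a \<otimes> b \<in> V" if ab: "a \<in> carrier S" "b \<in> carrier S" for a b
      proof -
        have "a \<otimes> (x \<otimes> y) \<otimes> b = a \<otimes> x \<otimes> (y \<otimes> b)" using ab xy by (simp add: m_assoc)
        moreover have "a \<otimes> x \<otimes> (y \<otimes> b) \<in> V \<longleftrightarrow> a \<otimes> (y \<otimes> b) \<in> V"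
          using x ab xy unfolding N_def by simp
        moreover have "a \<otimes> y \<otimes> b \<in> V \<longleftrightarrow> a \<otimes> b \<in> V"
          using y ab unfolding N_def by simp
        ultimately show ?thesis using ab xy by (simp add: m_assoc)
      qed
      then show "x \<otimes> y \<in> N" using xy by (simp add: N_def)
    next
      fix x assume x: "x \<in> N"
      then have xc: "x \<in> carrier S" using Nc by auto
      have "a \<otimes> inv x \<otimes> b \<in> V \<longleftrightarrow> a \<otimes> b \<in> V" if ab: "a \<in> carrier S" "b \<in> carrier S" for a b
      proof -
        have "a \<otimes> x \<otimes> (inv x \<otimes> b) \<in> V \<longleftrightarrow> a \<otimes> (inv x \<otimes> b) \<in> V"
          using x ab xc unfolding N_def by simp
        moreover have "a \<otimes> x \<otimes> (inv x \<otimes> b) = a \<otimes> b" using ab xc by (simp add: m_assoc inv_cancel_left)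
        ultimately show ?thesis using ab xc by (simp add: m_assoc)
      qed
      then show "inv x \<in> N" using xc by (simp add: N_def)
    qed (auto simp: N_def)
    fix y x assume y: "y \<in> carrier S" and x: "x \<in> N"
    then have xc: "x \<in> carrier S" using Nc by auto
    have "a \<otimes> (y \<otimes> x \<otimes> inv y) \<otimes> b \<in> V \<longleftrightarrow> a \<otimes> b \<in> V" if ab: "a \<in> carrier S" "b \<in> carrier S" for a b
    proof -
      have "(a \<otimes> y) \<otimes> x \<otimes> (inv y \<otimes> b) \<in> V \<longleftrightarrow> (a \<otimes> y) \<otimes> (inv y \<otimes> b) \<in> V"
        using x ab y unfolding N_def by simp
      then show ?thesis using ab xc y by (simp add: m_assoc inv_cancel_left)
    qed
    then show "y \<otimes> x \<otimes> inv y \<in> N" using xc y by (simp add: N_def)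
  qed
  moreover have "s \<otimes> x \<in> V" if "x \<in> N" for x
  proof -
    have "s \<otimes> x \<otimes> \<one> \<in> V \<longleftrightarrow> s \<otimes> \<one> \<in> V" using that V(3) Vc unfolding N_def by blast
    then show ?thesis using that V(3) Vc Nc by (simp add: subset_iff)
  qed
  ultimately show thesis using that by blast
qed

lemma (in topgroup) openin_translate:
  assumes "openin T N" "a \<in> carrier S"
  shows "openin T {x \<in> carrier S. a \<otimes> x \<in> N}"
proof (rule openin_preimage[OF _ assms(1)])
  have "continuous_map T T (\<lambda>x. x)" by simp
  then show "continuous_map T T (\<lambda>x. a \<otimes> x)" using assms(2) by (intro continuous_mult continuous_const)
qed

text \<open>A clopen set around \<open>s\<close> that misses \<open>F\<close> contains a whole coset
  of \<open>s\<close> modulo an open normal \<open>N\<close>; then \<open>C\<close> is the product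
  of \<open>F\<close> and \<open>N\<close>.\<close>

lemma (in topgroup) exists_open_normal:
  assumes S: "profinite_group S T" and F: "cnormal F" and s: "s \<in> carrier S" "s \<notin> F"
  obtains C where "openin T C" "normal C S" "F \<subseteq> C" "s \<notin> C"
proof -
  obtain V where V: "openin T V" "closedin T V" "s \<in> V" "V \<inter> F = {}"
    using clopen_separation[OF S cnormalD(3)[OF F] s] by metis
  have cpt: "compact_space T" using S by (simp add: profinite_group_def)
  obtain N where N: "openin T N" "normal N S" "\<And>x. x \<in> N \<Longrightarrow> s \<otimes> x \<in> V"
    using open_normal_core[OF cpt V(1-3)] by metis
  have Nsub: "subgroup N S" by (rule normal_imp_subgroup[OF N(2)])
  have Nc: "N \<subseteq> carrier S" by (rule subgroup.subset[OF Nsub])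
  note Fc = cnormal_mem(4)[OF F]
  define C where "C = {x \<in> carrier S. \<exists>f\<in>F. inv f \<otimes> x \<in> N}"
  have "C = (\<Union>f\<in>F. {x \<in> carrier S. inv f \<otimes> x \<in> N})" by (auto simp: C_def)
  then have "openin T C"
    using openin_translate[OF N(1)] Fc by (auto intro!: openin_Union)
  moreover have "normal C S"
  proof (rule normal_invI)
    show "subgroup C S"
    proof
      fix x y assume "x \<in> C" "y \<in> C"
      then obtain f f' where x: "x \<in> carrier S" "f \<in> F" "inv f \<otimes> x \<in> N"
          and y: "y \<in> carrier S" "f' \<in> F" "inv f' \<otimes> y \<in> N" by (auto simp: C_def)
      have fc: "f \<in> carrier S" "f' \<in> carrier S" using x y Fc by auto
      have "(inv f' \<otimes> (inv f \<otimes> x) \<otimes> f') \<otimes> (inv f' \<otimes> y) \<in> N"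
        by (intro subgroup.m_closed[OF Nsub] normal.inv_op_closed1[OF N(2)] x y fc)
      moreover have "(inv f' \<otimes> (inv f \<otimes> x) \<otimes> f') \<otimes> (inv f' \<otimes> y) = inv (f \<otimes> f') \<otimes> (x \<otimes> y)"
        using x y fc by (simp add: m_assoc inv_cancel_left inv_mult_group)
      ultimately have "\<exists>h\<in>F. inv h \<otimes> (x \<otimes> y) \<in> N"
        using cnormal_mem(3)[OF F x(2) y(2)] by auto
      then show "x \<otimes> y \<in> C" using x y by (simp add: C_def)
    next
      fix x assume "x \<in> C"
      then obtain f where x: "x \<in> carrier S" "f \<in> F" "inv f \<otimes> x \<in> N" by (auto simp: C_def)
      have fc: "f \<in> carrier S" using x Fc by auto
      have "f \<otimes> inv (inv f \<otimes> x) \<otimes> inv f \<in> N"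
        by (intro normal.inv_op_closed2[OF N(2)] subgroup.m_inv_closed[OF Nsub] x fc)
      moreover have "f \<otimes> inv (inv f \<otimes> x) \<otimes> inv f = inv (inv f) \<otimes> inv x"
        using x fc by (simp add: m_assoc inv_cancel_left inv_mult_group)
      ultimately have "\<exists>h\<in>F. inv h \<otimes> inv x \<in> N"
        using cnormal_mem(2)[OF F x(2)] by auto
      then show "inv x \<in> C" using x by (simp add: C_def)
    next
      show "\<one> \<in> C" using cnormal_mem(1)[OF F] subgroup.one_closed[OF Nsub] by (force simp: C_def)
    qed (auto simp: C_def)
    fix g x assume g: "g \<in> carrier S" and "x \<in> C"
    then obtain f where x: "x \<in> carrier S" "f \<in> F" "inv f \<otimes> x \<in> N" by (auto simp: C_def)
    have fc: "f \<in> carrier S" using x Fc by auto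
    have "g \<otimes> (inv f \<otimes> x) \<otimes> inv g \<in> N"
      by (intro normal.inv_op_closed2[OF N(2)] x g)
    moreover have "g \<otimes> (inv f \<otimes> x) \<otimes> inv g = inv (g \<otimes> f \<otimes> inv g) \<otimes> (g \<otimes> x \<otimes> inv g)"
      using x fc g by (simp add: m_assoc inv_cancel_left inv_mult_group)
    ultimately have "\<exists>h\<in>F. inv h \<otimes> (g \<otimes> x \<otimes> inv g) \<in> N"
      using cnormalD(4)[OF F g x(2)] by auto
    then show "g \<otimes> x \<otimes> inv g \<in> C" using x g by (simp add: C_def)
  qed
  moreover have "F \<subseteq> C"
  proof
    fix f assume "f \<in> F"
    moreover from this have "inv f \<otimes> f = \<one>" using Fc by simp
    ultimately show "f \<in> C" using Fc subgroup.one_closed[OF Nsub] unfolding C_def by force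
  qed
  moreover have "s \<notin> C"
  proof
    assume "s \<in> C"
    then obtain f where f: "f \<in> F" "inv f \<otimes> s \<in> N" by (auto simp: C_def)
    have fc: "f \<in> carrier S" using f Fc by auto
    have "s \<otimes> inv (inv f \<otimes> s) \<in> V" using subgroup.m_inv_closed[OF Nsub f(2)] N(3) by blast
    moreover have "s \<otimes> (inv s \<otimes> f) = f" using s fc by (simp add: inv_cancel_left)
    ultimately show False using f(1) V(4) s fc by (auto simp: inv_mult_group)
  qed
  ultimately show thesis using that by blast
qed

section \<open>Continuous maps into discrete groups\<close>

lemma (in topgroup) continuous_discreteI:
  assumes "\<And>x. x \<in> carrier S \<Longrightarrow> f x \<in> A" "\<And>a. a \<in> A \<Longrightarrow> openin T {x \<in> carrier S. f x = a}"
  shows "continuous_map T (discrete_topology A) f"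
proof -
  have "openin T {x \<in> topspace T. f x \<in> U}" if "U \<subseteq> A" for U
  proof -
    have "{x \<in> topspace T. f x \<in> U} = (\<Union>a\<in>U. {x \<in> carrier S. f x = a})" by auto
    then show ?thesis using assms(2) that by (auto intro!: openin_Union)
  qed
  then show ?thesis using assms(1) by (auto simp: continuous_map_def Pi_iff)
qed

lemma (in topgroup) continuous_discreteD:
  assumes "continuous_map T (discrete_topology A) f"
  shows "x \<in> carrier S \<Longrightarrow> f x \<in> A" "openin T {x \<in> carrier S. P (f x)}"
proof -
  show fA: "f x \<in> A" if "x \<in> carrier S" for x
    using continuous_map_image_subset_topspace[OF assms] that by auto
  have "{x \<in> carrier S. P (f x)} = {x \<in> carrier S. f x \<in> {a \<in> A. P a}}" using fA by auto
  then show "openin T {x \<in> carrier S. P (f x)}"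
    using openin_preimage[OF assms, of "{a \<in> A. P a}"] by simp
qed

lemma (in topgroup) continuous_Mod:
  assumes "openin T N" "normal N S"
  shows "dcont T (S Mod N) (\<lambda>x. N #> x)"
proof (rule continuous_discreteI)
  have N: "subgroup N S" by (rule normal_imp_subgroup[OF assms(2)])
  show "N #> x \<in> carrier (S Mod N)" if "x \<in> carrier S" for x
    using that by (auto simp: carrier_FactGroup)
  fix A assume "A \<in> carrier (S Mod N)"
  then obtain y where y: "y \<in> carrier S" "A = N #> y" by (auto simp: carrier_FactGroup)
  have "N #> x = N #> y \<longleftrightarrow> inv y \<otimes> x \<in> N" if x: "x \<in> carrier S" for x
  proof -
    have "N #> x = N #> y \<longleftrightarrow> x \<in> N #> y"
      using x y N by (metis repr_independence rcos_self)
    also have "\<dots> \<longleftrightarrow> x \<otimes> inv y \<in> N"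
      using subgroup.rcos_module[OF N is_group y(1) x] by simp
    \<comment> \<open>Conjugation by \<open>y\<close> turns the right translate of \<open>N\<close>
      into the left one covered by \<open>openin_translate\<close>.\<close>
    also have "\<dots> \<longleftrightarrow> inv y \<otimes> (x \<otimes> inv y) \<otimes> y \<in> N"
    proof
      assume "inv y \<otimes> (x \<otimes> inv y) \<otimes> y \<in> N"
      then have "y \<otimes> (inv y \<otimes> (x \<otimes> inv y) \<otimes> y) \<otimes> inv y \<in> N"
        by (rule normal.inv_op_closed2[OF assms(2) y(1)])
      then show "x \<otimes> inv y \<in> N" using x y by (simp add: m_assoc inv_cancel_left)
    qed (rule normal.inv_op_closed1[OF assms(2) y(1)])
    also have "inv y \<otimes> (x \<otimes> inv y) \<otimes> y = inv y \<otimes> x"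
      using x y by (simp add: m_assoc)
    finally show ?thesis .
  qed
  then have "{x \<in> carrier S. N #> x = A} = {x \<in> carrier S. inv y \<otimes> x \<in> N}" unfolding y(2) by blast
  then show "openin T {x \<in> carrier S. N #> x = A}"
    using openin_translate[OF assms(1), of "inv y"] y(1) by simp
qed

lemma (in group) pow_index_mem:
  assumes "normal N G" "card (rcosets N) = m" "0 < m" "x \<in> carrier G"
  shows "x [^] m \<in> N"
proof -
  interpret Q: group "G Mod N" by (rule normal.factorgroup_is_group[OF assms(1)])
  have "N #> x \<in> carrier (G Mod N)" using assms(4) by (auto simp: carrier_FactGroup)
  moreover have "order (G Mod N) = m" using assms(2) by (simp add: order_def FactGroup_def)
  ultimately have "(N #> x) [^]\<^bsub>G Mod N\<^esub> m = N" using Q.pow_order_eq_1[of "N #> x"] by simp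
  then have "N #> (x [^] m) = N" using normal.FactGroup_pow[OF assms(1,4)] by simp
  then show ?thesis
    using rcos_self[OF nat_pow_closed[OF assms(4), of m] normal_imp_subgroup[OF assms(1)]] by simp
qed

section \<open>Free pro-p groups\<close>

text \<open>The regular wreath product of the integers modulo \<open>p\<close> by \<open>G\<close>.
  Functions are extensional, so that it is finite for finite \<open>G\<close>.\<close>

definition wreath :: "nat \<Rightarrow> 'a monoid \<Rightarrow> (('a \<Rightarrow> int) \<times> 'a) monoid" where
  "wreath p G = \<lparr>carrier = (carrier G \<rightarrow>\<^sub>E {0..<int p}) \<times> carrier G,
     monoid.mult = (\<lambda>(u, g) (u', g'). (\<lambda>x\<in>carrier G. (u (g' \<otimes>\<^bsub>G\<^esub> x) + u' x) mod int p, g \<otimes>\<^bsub>G\<^esub> g')),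
     one = (\<lambda>x\<in>carrier G. 0, \<one>\<^bsub>G\<^esub>)\<rparr>"

lemma wreath_mult:
  "(u, g) \<otimes>\<^bsub>wreath p G\<^esub> (u', g') =
     (\<lambda>x\<in>carrier G. (u (g' \<otimes>\<^bsub>G\<^esub> x) + u' x) mod int p, g \<otimes>\<^bsub>G\<^esub> g')"
  by (simp add: wreath_def)

lemma group_wreath:
  assumes "group G" "0 < p"
  shows "group (wreath p G)"
proof -
  interpret group G by fact
  show ?thesis
  proof (rule groupI)
    fix a assume a: "a \<in> carrier (wreath p G)"
    obtain u g where ug: "a = (u, g)" by (cases a)
    have u: "u \<in> carrier G \<rightarrow>\<^sub>E {0..<int p}" and g: "g \<in> carrier G" using a by (auto simp: wreath_def ug)
    show "\<one>\<^bsub>wreath p G\<^esub> \<otimes>\<^bsub>wreath p G\<^esub> a = a"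
    proof -
      have "(\<lambda>x\<in>carrier G. ((\<lambda>x\<in>carrier G. 0) (g \<otimes>\<^bsub>G\<^esub> x) + u x) mod int p) x = u x" for x
        using u g by (cases "x \<in> carrier G") (auto simp: PiE_iff extensional_def)
      then show ?thesis using g by (simp add: wreath_def ug fun_eq_iff)
    qed
    let ?i = "(\<lambda>x\<in>carrier G. (- u (inv\<^bsub>G\<^esub> g \<otimes>\<^bsub>G\<^esub> x)) mod int p, inv\<^bsub>G\<^esub> g)"
    have "(\<lambda>x\<in>carrier G. ((\<lambda>x\<in>carrier G. (- u (inv\<^bsub>G\<^esub> g \<otimes>\<^bsub>G\<^esub> x)) mod int p) (g \<otimes>\<^bsub>G\<^esub> x) + u x) mod int p)
        = (\<lambda>x\<in>carrier G. 0)"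
      using g by (intro restrict_ext) (simp add: m_assoc[symmetric] mod_add_left_eq)
    then show "\<exists>y\<in>carrier (wreath p G). y \<otimes>\<^bsub>wreath p G\<^esub> a = \<one>\<^bsub>wreath p G\<^esub>"
      using g assms(2) by (intro bexI[of _ ?i]) (auto simp: wreath_def ug)
  next
    fix a b c assume "a \<in> carrier (wreath p G)" "b \<in> carrier (wreath p G)" "c \<in> carrier (wreath p G)"
    then show "a \<otimes>\<^bsub>wreath p G\<^esub> b \<otimes>\<^bsub>wreath p G\<^esub> c = a \<otimes>\<^bsub>wreath p G\<^esub> (b \<otimes>\<^bsub>wreath p G\<^esub> c)"
      by (auto simp: wreath_def m_assoc mod_add_left_eq mod_add_right_eq add.assoc intro!: restrict_ext)
  next
    fix a b assume "a \<in> carrier (wreath p G)" "b \<in> carrier (wreath p G)"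
    then show "a \<otimes>\<^bsub>wreath p G\<^esub> b \<in> carrier (wreath p G)"
      using assms(2) by (cases a; cases b) (simp add: wreath_def)
  next
    show "\<one>\<^bsub>wreath p G\<^esub> \<in> carrier (wreath p G)" using assms(2) by (simp add: wreath_def)
  qed
qed

locale free_pro_p = topgroup S T for S :: "'a monoid" (structure) and T :: "'a topology" +
  fixes p :: nat and Y :: "'a set"
  assumes prime: "Factorial_Ring.prime p"
    and pro_p: "pro_p_group p S T"
    and Y_carrier: "Y \<subseteq> carrier S"
    and Y_cofinite: "\<And>U. openin T U \<Longrightarrow> \<one> \<in> U \<Longrightarrow> finite (Y - U)"
    and universal: "\<And>(H :: nat monoid) f. group H \<Longrightarrow> finite (carrier H) \<Longrightarrow> \<exists>e. card (carrier H) = p ^ e \<Longrightarrow>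
      \<forall>x\<in>Y. f x \<in> carrier H \<Longrightarrow> finite {x\<in>Y. f x \<noteq> \<one>\<^bsub>H\<^esub>} \<Longrightarrow>
      \<exists>\<phi>. \<phi> \<in> hom S H \<and> dcont T H \<phi> \<and> (\<forall>x\<in>Y. \<phi> x = f x) \<and>
        (\<forall>\<psi>. \<psi> \<in> hom S H \<and> dcont T H \<psi> \<and>
             (\<forall>x\<in>Y. \<psi> x = f x) \<longrightarrow> (\<forall>s\<in>carrier S. \<psi> s = \<phi> s))"
begin

lemma profinite: "profinite_group S T"
  using pro_p by (simp add: pro_p_group_def)

lemma card_index:
  assumes "openin T N" "normal N S"
  obtains e where "card (rcosets N) = p ^ e"
  using pro_p assms unfolding pro_p_group_def by blast

text \<open>The universal property is stated for groups on natural numbers; the structure of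
  \<open>H\<close> is transported along an enumeration of its carrier.\<close>

lemma universal_general:
  fixes H :: "('h, 'k) monoid_scheme"
  assumes H: "group H" "finite (carrier H)" "card (carrier H) = p ^ e"
    and f: "\<And>x. x \<in> Y \<Longrightarrow> f x \<in> carrier H" "finite {x\<in>Y. f x \<noteq> \<one>\<^bsub>H\<^esub>}"
  shows "\<exists>\<phi>. \<phi> \<in> hom S H \<and> dcont T H \<phi> \<and> (\<forall>x\<in>Y. \<phi> x = f x) \<and>
        (\<forall>\<psi>. \<psi> \<in> hom S H \<and> dcont T H \<psi> \<and>
             (\<forall>x\<in>Y. \<psi> x = f x) \<longrightarrow> (\<forall>s\<in>carrier S. \<psi> s = \<phi> s))"
proof -
  interpret H: group H by fact
  obtain t where t: "bij_betw t (carrier H) {0..<p ^ e}"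
    using ex_bij_betw_finite_nat[OF H(2)] H(3) by auto
  define r where "r = inv_into (carrier H) t"
  have rt: "r (t a) = a" if "a \<in> carrier H" for a
    using t that unfolding r_def bij_betw_def by (simp add: inv_into_f_f)
  have tr: "t (r i) = i" "r i \<in> carrier H" if "i \<in> {0..<p ^ e}" for i
    using t that unfolding r_def bij_betw_def by (auto intro: f_inv_into_f inv_into_into)
  have tc: "t a \<in> {0..<p ^ e}" if "a \<in> carrier H" for a using t that by (auto simp: bij_betw_def)
  define N :: "nat monoid" where
    "N = \<lparr>carrier = {0..<p ^ e}, monoid.mult = \<lambda>i j. t (r i \<otimes>\<^bsub>H\<^esub> r j), one = t \<one>\<^bsub>H\<^esub>\<rparr>"
  have N: "carrier N = {0..<p ^ e}" "\<And>i j. i \<otimes>\<^bsub>N\<^esub> j = t (r i \<otimes>\<^bsub>H\<^esub> r j)" "\<one>\<^bsub>N\<^esub> = t \<one>\<^bsub>H\<^esub>"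
    by (simp_all add: N_def)
  have gN: "group N"
  proof (rule groupI)
    fix i assume i: "i \<in> carrier N"
    then have ri: "r i \<in> carrier H" using tr(2) by (simp only: N)
    show "\<exists>j\<in>carrier N. j \<otimes>\<^bsub>N\<^esub> i = \<one>\<^bsub>N\<^esub>"
      using tc[OF H.inv_closed[OF ri]] rt[OF H.inv_closed[OF ri]] ri
      by (intro bexI[of _ "t (inv\<^bsub>H\<^esub> r i)"]) (simp_all only: N H.l_inv)
    show "\<one>\<^bsub>N\<^esub> \<otimes>\<^bsub>N\<^esub> i = i"
      using tr(1)[of i] rt[OF H.one_closed] ri i by (simp only: N H.l_one)
  next
    fix i j k assume "i \<in> carrier N" "j \<in> carrier N" "k \<in> carrier N"
    then have c: "r i \<in> carrier H" "r j \<in> carrier H" "r k \<in> carrier H" using tr(2) by (simp_all only: N)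
    show "i \<otimes>\<^bsub>N\<^esub> j \<otimes>\<^bsub>N\<^esub> k = i \<otimes>\<^bsub>N\<^esub> (j \<otimes>\<^bsub>N\<^esub> k)"
      using c by (simp only: N rt H.m_closed H.m_assoc)
  next
    fix i j assume "i \<in> carrier N" "j \<in> carrier N"
    then have c: "r i \<in> carrier H" "r j \<in> carrier H" using tr(2) by (simp_all only: N)
    then show "i \<otimes>\<^bsub>N\<^esub> j \<in> carrier N" using tc by (simp only: N H.m_closed)
  qed (use tc[OF H.one_closed] in \<open>simp only: N\<close>)
  have fN: "finite (carrier N)" and cN: "\<exists>e. card (carrier N) = p ^ e" by (auto simp: N(1))
  have tf: "\<forall>x\<in>Y. t (f x) \<in> carrier N" using f(1) tc by (simp add: N(1))
  have "finite {x\<in>Y. t (f x) \<noteq> \<one>\<^bsub>N\<^esub>}"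
    by (rule finite_subset[OF _ f(2)]) (auto simp: N(3))
  from universal[OF gN fN cN tf this] obtain \<phi> where \<phi>:
      "\<phi> \<in> hom S N \<and> dcont T N \<phi> \<and> (\<forall>x\<in>Y. \<phi> x = t (f x)) \<and>
        (\<forall>\<psi>. \<psi> \<in> hom S N \<and> dcont T N \<psi> \<and>
             (\<forall>x\<in>Y. \<psi> x = t (f x)) \<longrightarrow> (\<forall>s\<in>carrier S. \<psi> s = \<phi> s))" by (rule exE)
  then have phi: "\<phi> \<in> hom S N" "dcont T N \<phi>"
      "\<forall>x\<in>Y. \<phi> x = t (f x)" by simp_all
  have uniq: "\<psi> s = \<phi> s" if "\<psi> \<in> hom S N" "dcont T N \<psi>"
      "\<forall>x\<in>Y. \<psi> x = t (f x)" "s \<in> carrier S" for \<psi> s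
    using \<phi> that by simp
  have phic: "\<phi> x \<in> {0..<p ^ e}" if "x \<in> carrier S" for x
    using hom_in_carrier[OF phi(1) that] by (simp only: N)
  show ?thesis
  proof (intro exI conjI ballI allI impI)
    show "(\<lambda>x. r (\<phi> x)) \<in> hom S H"
    proof (rule homI)
      fix x y assume xy: "x \<in> carrier S" "y \<in> carrier S"
      have "\<phi> (x \<otimes> y) = t (r (\<phi> x) \<otimes>\<^bsub>H\<^esub> r (\<phi> y))" using hom_mult[OF phi(1) xy] by (simp only: N)
      then show "r (\<phi> (x \<otimes> y)) = r (\<phi> x) \<otimes>\<^bsub>H\<^esub> r (\<phi> y)"
        using tr(2)[OF phic] xy by (simp add: rt)
    qed (use phic tr in auto)
    show "dcont T H (\<lambda>x. r (\<phi> x))"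
    proof (rule continuous_discreteI)
      show "openin T {x \<in> carrier S. r (\<phi> x) = a}" for a
        by (rule continuous_discreteD(2)[OF phi(2)])
    qed (use phic tr in auto)
    show "r (\<phi> x) = f x" if "x \<in> Y" for x using phi(3) rt f(1) that by simp
    fix \<psi> s assume psi: "\<psi> \<in> hom S H \<and> dcont T H \<psi> \<and> (\<forall>x\<in>Y. \<psi> x = f x)"
      and s: "s \<in> carrier S"
    have psic: "\<psi> x \<in> carrier H" if "x \<in> carrier S" for x using psi that by (auto intro: hom_in_carrier)
    have "(\<lambda>x. t (\<psi> x)) \<in> hom S N"
    proof (rule homI)
      fix x y assume xy: "x \<in> carrier S" "y \<in> carrier S"
      then show "t (\<psi> (x \<otimes> y)) = t (\<psi> x) \<otimes>\<^bsub>N\<^esub> t (\<psi> y)"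
        using hom_mult[of \<psi> S H x y] psi psic by (simp add: N rt)
    qed (use psic tc in \<open>auto simp: N\<close>)
    moreover have "dcont T N (\<lambda>x. t (\<psi> x))"
    proof (rule continuous_discreteI)
      have psi': "dcont T H \<psi>" using psi by blast
      show "openin T {x \<in> carrier S. t (\<psi> x) = a}" for a
        by (rule continuous_discreteD(2)[OF psi'])
    qed (use psic tc in \<open>simp add: N\<close>)
    ultimately have "t (\<psi> s) = \<phi> s" using uniq[of "\<lambda>x. t (\<psi> x)" s] psi s by simp
    then show "\<psi> s = r (\<phi> s)" using rt psic s by metis
  qed
qed

text \<open>The kernel of \<open>\<phi>\<close> is open and the generators converge to 1, so almost
  all of them are mapped to 1, and the uniqueness clause of the universal property applies to the
  values of \<open>\<phi>\<close> on \<open>Y\<close>.\<close>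

lemma hom_eqI:
  fixes H :: "('h, 'k) monoid_scheme"
  assumes H: "group H" "finite (carrier H)" "card (carrier H) = p ^ e"
    and phi: "\<phi> \<in> hom S H" "dcont T H \<phi>"
    and psi: "\<psi> \<in> hom S H" "dcont T H \<psi>"
    and eq: "\<And>x. x \<in> Y \<Longrightarrow> \<phi> x = \<psi> x" and s: "s \<in> carrier S"
  shows "\<phi> s = \<psi> s"
proof -
  have "openin T {x \<in> carrier S. \<phi> x = \<one>\<^bsub>H\<^esub>}" by (rule continuous_discreteD(2)[OF phi(2)])
  moreover have "\<phi> \<one> = \<one>\<^bsub>H\<^esub>" by (rule hom_one[OF phi(1) is_group H(1)])
  ultimately have "finite (Y - {x \<in> carrier S. \<phi> x = \<one>\<^bsub>H\<^esub>})" by (intro Y_cofinite) auto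
  then have fin: "finite {x\<in>Y. \<phi> x \<noteq> \<one>\<^bsub>H\<^esub>}" by (rule finite_subset[rotated]) auto
  have "\<phi> x \<in> carrier H" if "x \<in> Y" for x
    using hom_in_carrier[OF phi(1)] Y_carrier that by blast
  from universal_general[OF H this fin] obtain \<theta> where \<theta>:
      "\<theta> \<in> hom S H \<and> dcont T H \<theta> \<and> (\<forall>x\<in>Y. \<theta> x = \<phi> x) \<and>
        (\<forall>\<psi>. \<psi> \<in> hom S H \<and> dcont T H \<psi> \<and>
             (\<forall>x\<in>Y. \<psi> x = \<phi> x) \<longrightarrow> (\<forall>s\<in>carrier S. \<psi> s = \<theta> s))" by (rule exE)
  have "\<phi> s = \<theta> s" using \<theta> phi s by simp
  moreover have "\<psi> s = \<theta> s" using \<theta> psi eq s by simp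
  ultimately show ?thesis by simp
qed

text \<open>The two homomorphisms \<open>g \<mapsto> (0, Q g)\<close> and \<open>g \<mapsto> (\<chi> g - \<chi>, Q g)\<close> into the wreath product,
  with \<open>\<chi>\<close> the indicator function of \<open>H/Q\<close>, agree exactly on \<open>H\<close>.\<close>
lemma generation:
  assumes Q: "openin T Q" "normal Q S" and H: "subgroup H S" "Q \<subseteq> H" "Y \<subseteq> H"
  shows "H = carrier S"
proof -
  let ?G = "S Mod Q"
  interpret G: group ?G by (rule normal.factorgroup_is_group[OF Q(2)])
  obtain e where e: "card (rcosets Q) = p ^ e" using card_index[OF Q] .
  have p0: "0 < p" using prime by (simp add: prime_gt_0_nat)
  have cG: "card (carrier ?G) = p ^ e" using e by (simp add: FactGroup_def)
  have fG: "finite (carrier ?G)" using cG p0 by (metis card.infinite power_not_zero less_not_refl)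
  let ?W = "wreath p ?G"
  have W: "group ?W" by (rule group_wreath[OF G.is_group p0])
  have fW: "finite (carrier ?W)" using fG by (simp add: wreath_def finite_PiE)
  \<comment> \<open>The functions live on the \<open>p ^ e\<close> elements of
    \<open>S Mod Q\<close>; the target is thus again a finite \<open>p\<close>-group.\<close>
  have cW: "card (carrier ?W) = p ^ (p ^ e + e)"
    using fG cG by (simp add: wreath_def card_cartesian_product card_PiE power_add)
  define \<pi> where "\<pi> x = Q #> x" for x
  have pi_hom: "\<pi> \<in> hom S ?G" unfolding \<pi>_def by (rule normal.r_coset_hom_Mod[OF Q(2)])
  have pic: "\<pi> x \<in> carrier ?G" if "x \<in> carrier S" for x using hom_in_carrier[OF pi_hom that] .
  have pi_mult: "\<pi> (x \<otimes> y) = \<pi> x \<otimes>\<^bsub>?G\<^esub> \<pi> y" if "x \<in> carrier S" "y \<in> carrier S" for x y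
    using hom_mult[OF pi_hom that] .
  have Qs: "subgroup Q S" by (rule normal_imp_subgroup[OF Q(2)])
  have Hc: "H \<subseteq> carrier S" by (rule subgroup.subset[OF H(1)])
  define K where "K = \<pi> ` H"
  have K: "\<pi> x \<in> K \<longleftrightarrow> x \<in> H" if x: "x \<in> carrier S" for x
  proof
    assume "\<pi> x \<in> K"
    then obtain h where h: "h \<in> H" "Q #> x = Q #> h" by (auto simp: K_def \<pi>_def)
    have "x \<in> Q #> h" using rcos_self[OF x Qs] h(2) by simp
    then obtain q where "q \<in> Q" "x = q \<otimes> h" by (auto simp: r_coset_def)
    then show "x \<in> H" using h H(2) subgroup.m_closed[OF H(1)] by blast
  qed (simp add: K_def)
  have Ksub: "subgroup K ?G"
    unfolding K_def by (rule group_hom.subgroup_img_is_subgroup[OF group_hom.intro[OF is_group G.is_group] H(1)])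
      (simp add: group_hom_axioms_def pi_hom)
  define ind where "ind A = (if A \<in> K then 1 else 0 :: int)" for A
  define \<phi> where "\<phi> x = ((\<lambda>A\<in>carrier ?G. 0 :: int), \<pi> x)" for x
  define \<psi> where "\<psi> x = ((\<lambda>A\<in>carrier ?G. (ind (\<pi> x \<otimes>\<^bsub>?G\<^esub> A) - ind A) mod int p), \<pi> x)" for x
  have phi: "\<phi> \<in> hom S ?W"
  proof (rule homI)
    fix x y assume xy: "x \<in> carrier S" "y \<in> carrier S"
    have "(\<lambda>A\<in>carrier ?G. 0) = (\<lambda>A\<in>carrier ?G. ((\<lambda>A\<in>carrier ?G. 0) (\<pi> y \<otimes>\<^bsub>?G\<^esub> A) +
        (\<lambda>A\<in>carrier ?G. 0) A) mod int p)"
      using G.m_closed[OF pic[OF xy(2)]] by (intro restrict_ext) (simp del: mult_FactGroup)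
    from this[symmetric] show "\<phi> (x \<otimes> y) = \<phi> x \<otimes>\<^bsub>?W\<^esub> \<phi> y"
      by (simp only: \<phi>_def wreath_mult pi_mult[OF xy])
  qed (use pic p0 in \<open>simp add: \<phi>_def wreath_def\<close>)
  have psi: "\<psi> \<in> hom S ?W"
  proof (rule homI)
    fix x y assume xy: "x \<in> carrier S" "y \<in> carrier S"
    have "(ind (\<pi> (x \<otimes> y) \<otimes>\<^bsub>?G\<^esub> A) - ind A) mod int p =
      ((\<lambda>A\<in>carrier ?G. (ind (\<pi> x \<otimes>\<^bsub>?G\<^esub> A) - ind A) mod int p) (\<pi> y \<otimes>\<^bsub>?G\<^esub> A) +
        (\<lambda>A\<in>carrier ?G. (ind (\<pi> y \<otimes>\<^bsub>?G\<^esub> A) - ind A) mod int p) A) mod int p"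
      if A: "A \<in> carrier ?G" for A
    proof -
      have "\<pi> (x \<otimes> y) \<otimes>\<^bsub>?G\<^esub> A = \<pi> x \<otimes>\<^bsub>?G\<^esub> (\<pi> y \<otimes>\<^bsub>?G\<^esub> A)"
        using A xy pic by (simp only: pi_mult G.m_assoc)
      moreover have "\<pi> y \<otimes>\<^bsub>?G\<^esub> A \<in> carrier ?G" using A xy pic by (intro G.m_closed)
      ultimately show ?thesis using A by (simp add: mod_add_eq del: mult_FactGroup)
    qed
    from restrict_ext[OF this, of "carrier ?G", symmetric]
    show "\<psi> (x \<otimes> y) = \<psi> x \<otimes>\<^bsub>?W\<^esub> \<psi> y"
      by (simp only: \<psi>_def wreath_mult pi_mult[OF xy, symmetric])
  qed (use pic p0 in \<open>auto simp: \<psi>_def wreath_def\<close>)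
  have cont: "dcont T ?W \<theta>"
    if "\<theta> \<in> hom S ?W" "\<And>x. \<theta> x = h (\<pi> x)" for \<theta> h
  proof (rule continuous_discreteI)
    have "dcont T ?G \<pi>"
      unfolding \<pi>_def by (rule continuous_Mod[OF Q])
    then show "openin T {x \<in> carrier S. \<theta> x = a}" for a
      unfolding that(2) by (rule continuous_discreteD(2))
  qed (rule hom_in_carrier[OF that(1)])
  have eqH: "\<phi> x = \<psi> x \<longleftrightarrow> x \<in> H" if x: "x \<in> carrier S" for x
  proof
    assume "\<phi> x = \<psi> x"
    \<comment> \<open>At the identity coset the function of \<open>\<psi> x\<close> has the value
      \<open>ind (\<pi> x) - 1\<close>, which is 0 modulo \<open>p\<close> only if
      \<open>\<pi> x \<in> K\<close>.\<close>
    then have "fst (\<phi> x) \<one>\<^bsub>?G\<^esub> = fst (\<psi> x) \<one>\<^bsub>?G\<^esub>" by (rule arg_cong)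
    then have "(ind (\<pi> x) - ind \<one>\<^bsub>?G\<^esub>) mod int p = 0"
      using G.one_closed G.r_one[OF pic[OF x]]
      by (simp add: \<phi>_def \<psi>_def del: one_FactGroup mult_FactGroup)
    moreover have "ind \<one>\<^bsub>?G\<^esub> = 1" using subgroup.one_closed[OF Ksub] by (simp add: ind_def del: one_FactGroup)
    moreover have "2 \<le> int p" using prime_ge_2_nat[OF prime] by simp
    ultimately have "\<pi> x \<in> K" by (auto simp: ind_def zmod_minus1 split: if_splits)
    then show "x \<in> H" using K x by blast
  next
    assume "x \<in> H"
    then have xK: "\<pi> x \<in> K" using K x by blast
    have iff: "\<pi> x \<otimes>\<^bsub>?G\<^esub> A \<in> K \<longleftrightarrow> A \<in> K" if A: "A \<in> carrier ?G" for A
    proof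
      assume "\<pi> x \<otimes>\<^bsub>?G\<^esub> A \<in> K"
      then have "inv\<^bsub>?G\<^esub> \<pi> x \<otimes>\<^bsub>?G\<^esub> (\<pi> x \<otimes>\<^bsub>?G\<^esub> A) \<in> K"
        by (rule subgroup.m_closed[OF Ksub subgroup.m_inv_closed[OF Ksub xK]])
      moreover have "inv\<^bsub>?G\<^esub> \<pi> x \<otimes>\<^bsub>?G\<^esub> (\<pi> x \<otimes>\<^bsub>?G\<^esub> A) = A"
        using A pic[OF x] by (simp only: G.m_assoc[symmetric] G.inv_closed G.l_inv G.l_one)
      ultimately show "A \<in> K" by (simp only:)
    qed (rule subgroup.m_closed[OF Ksub xK])
    have "(\<lambda>A\<in>carrier ?G. (ind (\<pi> x \<otimes>\<^bsub>?G\<^esub> A) - ind A) mod int p) = (\<lambda>A\<in>carrier ?G. 0)"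
    proof (rule restrict_ext)
      fix A assume A: "A \<in> carrier ?G"
      show "(ind (\<pi> x \<otimes>\<^bsub>?G\<^esub> A) - ind A) mod int p = 0"
        by (simp only: ind_def iff[OF A]) simp
    qed
    then show "\<phi> x = \<psi> x" by (simp only: \<phi>_def \<psi>_def)
  qed
  have "\<phi> s = \<psi> s" if s: "s \<in> carrier S" for s
  proof (rule hom_eqI[OF W fW cW phi _ psi _ _ s])
    show "dcont T ?W \<phi>"
      by (rule cont[OF phi, of "\<lambda>A. ((\<lambda>A\<in>carrier ?G. 0 :: int), A)"]) (simp add: \<phi>_def)
    show "dcont T ?W \<psi>"
      by (rule cont[OF psi, of "\<lambda>B. ((\<lambda>A\<in>carrier ?G. (ind (B \<otimes>\<^bsub>?G\<^esub> A) - ind A) mod int p), B)"])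
         (simp add: \<psi>_def)
    show "\<phi> x = \<psi> x" if "x \<in> Y" for x using eqH H(3) Y_carrier that by blast
  qed
  then show ?thesis using eqH Hc by blast
qed

end

lemma free_pro_p_groupE:
  assumes "Factorial_Ring.prime p" "free_pro_p_group p S T"
  obtains Y where "free_pro_p S T p Y"
proof -
  obtain Y where Y: "Y \<subseteq> carrier S" "\<forall>U. openin T U \<and> \<one>\<^bsub>S\<^esub> \<in> U \<longrightarrow> finite (Y - U)"
    and univ: "\<forall>H :: nat monoid. \<forall>f. group H \<and> finite (carrier H) \<and> (\<exists>e::nat. card (carrier H) = p ^ e) \<and>
            (\<forall>x\<in>Y. f x \<in> carrier H) \<and> finite {x\<in>Y. f x \<noteq> \<one>\<^bsub>H\<^esub>} \<longrightarrow>
           (\<exists>\<phi>. \<phi> \<in> hom S H \<and> dcont T H \<phi> \<and>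
                 (\<forall>x\<in>Y. \<phi> x = f x) \<and>
                 (\<forall>\<psi>. \<psi> \<in> hom S H \<and> dcont T H \<psi> \<and>
                       (\<forall>x\<in>Y. \<psi> x = f x) \<longrightarrow> (\<forall>s\<in>carrier S. \<psi> s = \<phi> s)))"
    using assms(2) unfolding free_pro_p_group_def by (elim conjE exE)
  have pro: "pro_p_group p S T" using assms(2) by (simp add: free_pro_p_group_def)
  then have tg: "topological_group S T" by (simp add: pro_p_group_def profinite_group_def)
  have "free_pro_p S T p Y"
    unfolding free_pro_p_def topgroup_def topgroup_axioms_def free_pro_p_axioms_def
    using tg assms(1) pro Y univ by (simp add: topological_group_def)
  then show thesis by (rule that)
qed

section \<open>Unitriangular groups over residue rings\<close>

abbreviation UT :: "int \<Rightarrow> nat \<Rightarrow> (nat \<Rightarrow> nat \<Rightarrow> int) monoid" where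
  "UT q \<equiv> unitri (residue_ring q)"

lemma residue_ring_simps:
  "carrier (residue_ring q) = {0..q - 1}" "\<one>\<^bsub>residue_ring q\<^esub> = 1" "\<zero>\<^bsub>residue_ring q\<^esub> = 0"
  "x \<otimes>\<^bsub>residue_ring q\<^esub> y = x * y mod q"
  by (simp_all add: residue_ring_def)

lemma finsum_residue_ring:
  assumes "1 < q" "finite I" "\<And>i. i \<in> I \<Longrightarrow> f i \<in> {0..<q}"
  shows "finsum (residue_ring q) f I = (\<Sum>i\<in>I. f i) mod q"
proof -
  interpret residues q "residue_ring q"
    using assms(1) by (simp add: residues_def)
  show ?thesis
    using assms(2,3)
  proof (induction rule: finite_induct)
    case (insert x I)
    have f: "f \<in> I \<rightarrow> carrier (residue_ring q)" "f x \<in> carrier (residue_ring q)"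
      using insert.prems by (auto simp: residue_ring_simps)
    then have "finsum (residue_ring q) f (insert x I) =
        (f x + finsum (residue_ring q) f I) mod q"
      using insert.hyps by (simp add: finsum_insert res_add_eq)
    then show ?case
      using insert by (simp add: mod_add_right_eq)
  qed (simp add: res_zero_eq)
qed

lemma unitri_residue_simps:
  "carrier (UT q m) = {A. \<forall>i j. (i < m \<and> j < m \<longrightarrow> 0 \<le> A i j \<and> A i j < q) \<and>
     (i < m \<and> j < i \<longrightarrow> A i j = 0) \<and> (i < m \<longrightarrow> A i i = 1) \<and> (\<not> (i < m \<and> j < m) \<longrightarrow> A i j = 0)}"
  "\<one>\<^bsub>UT q m\<^esub> = (\<lambda>i j. if i < m \<and> j < m \<and> i = j then 1 else 0)"
  by (auto simp: unitri_def residue_ring_simps fun_eq_iff)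

lemma unitri_residueD:
  assumes "A \<in> carrier (UT q m)"
  shows "i < m \<Longrightarrow> j < m \<Longrightarrow> 0 \<le> A i j" "i < m \<Longrightarrow> j < m \<Longrightarrow> A i j < q"
    "i < m \<Longrightarrow> j < i \<Longrightarrow> A i j = 0" "i < m \<Longrightarrow> A i i = 1" "\<not> (i < m \<and> j < m) \<Longrightarrow> A i j = 0"
  using assms unfolding unitri_residue_simps by blast+

lemma unitri_residue_mult_full:
  assumes "1 < q" "i < m" "j < m"
  shows "(A \<otimes>\<^bsub>UT q m\<^esub> B) i j = (\<Sum>k<m. A i k * B k j) mod q"
proof -
  have "(A \<otimes>\<^bsub>UT q m\<^esub> B) i j =
      finsum (residue_ring q) (\<lambda>k. (A i k * B k j) mod q) {..<m}"
    using assms(2,3) by (simp add: unitri_def residue_ring_simps)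
  also have "\<dots> = (\<Sum>k<m. (A i k * B k j) mod q) mod q"
    using assms(1) by (intro finsum_residue_ring) auto
  also have "\<dots> = (\<Sum>k<m. A i k * B k j) mod q" by (rule mod_sum_eq)
  finally show ?thesis .
qed

lemma unitri_residue_mult_outside:
  "\<not> (i < m \<and> j < m) \<Longrightarrow> (A \<otimes>\<^bsub>UT q m\<^esub> B) i j = 0"
  by (simp only: unitri_def monoid.simps if_False residue_ring_simps)

lemma unitri_residue_mult:
  assumes "1 < q" "A \<in> carrier (UT q m)" "B \<in> carrier (UT q m)"
    and "i < m" "j < m"
  shows "(A \<otimes>\<^bsub>UT q m\<^esub> B) i j = (\<Sum>k=i..j. A i k * B k j) mod q"
proof -
  have "(\<Sum>k<m. A i k * B k j) = (\<Sum>k=i..j. A i k * B k j)"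
  proof (rule sum.mono_neutral_right)
    show "\<forall>k\<in>{..<m} - {i..j}. A i k * B k j = 0"
    proof
      fix k assume "k \<in> {..<m} - {i..j}"
      then have "k < m" "k < i \<or> j < k" by auto
      then show "A i k * B k j = 0"
        using unitri_residueD(3)[OF assms(2,4), of k] unitri_residueD(3)[OF assms(3), of k j] by auto
    qed
    show "{i..j} \<subseteq> {..<m}" using assms(5) by auto
  qed simp
  then show ?thesis using unitri_residue_mult_full[OF assms(1,4,5), of A B] by simp
qed

text \<open>A word \<open>u\<close> of length \<open>l\<close> turns a series \<open>f\<close> into the matrix whose entry at \<open>i \<le> j \<le> l\<close> is the
  coefficient of \<open>f\<close> at the factor \<open>u\<^sub>i ... u\<^sub>(\<^sub>j\<^sub>-\<^sub>1\<^sub>)\<close>; beyond index \<open>l\<close> it is the identity.\<close>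
definition word_matrix :: "nat \<Rightarrow> nat list \<Rightarrow> int \<Rightarrow> ser \<Rightarrow> nat \<Rightarrow> nat \<Rightarrow> int" where
  "word_matrix m u q f i j =
     (if i < m \<and> j < m then
        if i \<le> j \<and> j \<le> length u then cf f (drop i (take j u)) mod q else if i = j then 1 else 0
      else 0)"

lemma word_matrix_carrier:
  "1 < q \<Longrightarrow> cf f [] = 1 \<Longrightarrow> word_matrix m u q f \<in> carrier (UT q m)"
  by (auto simp: unitri_residue_simps word_matrix_def)

lemma word_matrix_one:
  "1 < q \<Longrightarrow> word_matrix m u q 1 = \<one>\<^bsub>UT q m\<^esub>"
  by (auto simp: unitri_residue_simps word_matrix_def cf_one fun_eq_iff)

lemma cf_mult_segment:
  assumes "i \<le> j" "j \<le> length u"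
  shows "cf (f * g) (drop i (take j u)) =
    (\<Sum>k=i..j. cf f (drop i (take k u)) * cf g (drop k (take j u)))"
proof -
  have "cf (f * g) (drop i (take j u)) =
      (\<Sum>k\<le>j - i. cf f (take k (drop i (take j u))) * cf g (drop k (drop i (take j u))))"
    using assms by (simp add: cf_mult min_def)
  also have "\<dots> = (\<Sum>k=i..j. cf f (drop i (take k u)) * cf g (drop k (take j u)))"
    using assms
    by (intro sum.reindex_bij_witness[of _ "\<lambda>k. k - i" "\<lambda>k. k + i"])
       (auto simp: take_drop add.commute min_def)
  finally show ?thesis .
qed

text \<open>A coefficient of \<open>f * g\<close> at the factor from \<open>i\<close> to
  \<open>j\<close> is a sum over the intermediate cuts, and this is the product of upper triangular
  matrices. The columns beyond \<open>length u\<close> are those of the identity.\<close>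

lemma word_matrix_mult:
  assumes q: "1 < q" and f: "cf f [] = 1" "cf g [] = 1"
  shows "word_matrix m u q (f * g) =
    word_matrix m u q f \<otimes>\<^bsub>UT q m\<^esub> word_matrix m u q g"
proof (intro ext)
  fix i j
  show "word_matrix m u q (f * g) i j =
    (word_matrix m u q f \<otimes>\<^bsub>UT q m\<^esub> word_matrix m u q g) i j"
  proof (cases "i < m \<and> j < m")
    case False
    then show ?thesis
      by (simp only: unitri_residue_mult_outside[OF False] word_matrix_def if_False)
  next
    case True
    have eq: "(word_matrix m u q f \<otimes>\<^bsub>UT q m\<^esub> word_matrix m u q g) i j =
        (\<Sum>k=i..j. word_matrix m u q f i k * word_matrix m u q g k j) mod q"
      using True q f by (intro unitri_residue_mult word_matrix_carrier) auto
    consider "j < i" | "i \<le> j" "j \<le> length u" | "i \<le> j" "length u < j" by linarith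
    then show ?thesis
    proof cases
      case 1
      then show ?thesis unfolding eq using True by (simp add: word_matrix_def)
    next
      case 2
      have "(\<Sum>k=i..j. word_matrix m u q f i k * word_matrix m u q g k j) mod q =
          (\<Sum>k=i..j. (cf f (drop i (take k u)) mod q) * (cf g (drop k (take j u)) mod q)) mod q"
        using 2 True by (intro arg_cong[of _ _ "\<lambda>x. x mod q"] sum.cong) (auto simp: word_matrix_def)
      also have "\<dots> = (\<Sum>k=i..j. cf f (drop i (take k u)) * cf g (drop k (take j u))) mod q"
        by (subst (1 2) mod_sum_eq[symmetric]) (simp add: mod_mult_eq)
      finally show ?thesis
        unfolding eq using 2 True by (simp add: word_matrix_def cf_mult_segment)
    next
      case 3
      have "(\<Sum>k=i..j. word_matrix m u q f i k * word_matrix m u q g k j) =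
          (\<Sum>k=i..j. if k = j then word_matrix m u q f i j else 0)"
        using 3 True by (intro sum.cong) (auto simp: word_matrix_def)
      then show ?thesis
        unfolding eq using 3 True q by (simp add: word_matrix_def)
    qed
  qed
qed

text \<open>The word \<open>0, 1, ..., m - 1\<close> has pairwise distinct factors, so every matrix is of the form above.\<close>
definition matrix_ser :: "(nat \<Rightarrow> nat \<Rightarrow> int) \<Rightarrow> ser" where
  "matrix_ser A = Ser (\<lambda>u. if u = [] then 1 else if u = [hd u..<Suc (last u)] then A (hd u) (Suc (last u)) else 0)"

lemma matrix_ser_upt: "i < j \<Longrightarrow> cf (matrix_ser A) [i..<j] = A i j"
  by (simp add: matrix_ser_def hd_upt last_upt del: upt_Suc)

lemma matrix_ser_Nil [simp]: "cf (matrix_ser A) [] = 1"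
  by (simp add: matrix_ser_def)

lemma word_matrix_matrix_ser:
  assumes "1 < q" "A \<in> carrier (UT q m)"
  shows "word_matrix m [0..<m] q (matrix_ser A) = A"
proof (intro ext)
  fix i j
  consider "i < m \<and> j < m" "i < j" | "i < m \<and> j < m" "j \<le> i" | "\<not> (i < m \<and> j < m)" by linarith
  then show "word_matrix m [0..<m] q (matrix_ser A) i j = A i j"
  proof cases
    case 1
    then show ?thesis
      using assms(1) unitri_residueD(1,2)[OF assms(2), of i j]
      by (simp add: word_matrix_def matrix_ser_upt)
  next
    case 2
    then show ?thesis
      using assms(1) unitri_residueD(3,4)[OF assms(2), of i] by (cases "i = j") (simp_all add: word_matrix_def)
  next
    case 3
    then show ?thesis
      using unitri_residueD(5)[OF assms(2) 3] by (simp only: word_matrix_def if_not_P[OF 3] if_False)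
  qed
qed

text \<open>The group laws are inherited from the group of series, which \<open>word_matrix\<close>
  maps onto the unitriangular matrices.\<close>

lemma group_unitri_residue:
  assumes "1 < q"
  shows "group (UT q m)"
proof -
  let ?U = "UT q m" and ?h = "word_matrix m [0..<m] q"
  have hom: "?h \<in> hom magnus ?U"
    using assms by (intro homI) (simp_all add: word_matrix_carrier word_matrix_mult)
  have "?h ` carrier magnus = carrier ?U"
  proof
    show "?h ` carrier magnus \<subseteq> carrier ?U" using assms by (auto intro: word_matrix_carrier)
    show "carrier ?U \<subseteq> ?h ` carrier magnus"
    proof
      fix A assume "A \<in> carrier ?U"
      then have "A = ?h (matrix_ser A)" by (rule word_matrix_matrix_ser[OF assms, symmetric])
      then show "A \<in> ?h ` carrier magnus" by (rule image_eqI) simp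
    qed
  qed
  moreover have "?h \<one>\<^bsub>magnus\<^esub> = \<one>\<^bsub>?U\<^esub>" using assms by (simp add: word_matrix_one)
  ultimately show ?thesis
    using group.hom_imp_img_group[OF group_magnus hom] by simp
qed

lemma card_unitri_residue:
  assumes "1 < q"
  shows "finite (carrier (UT q m))"
    "card (carrier (UT q m)) = nat q ^ card {(i, j). i < j \<and> j < m}"
proof -
  let ?U = "carrier (UT q m)"
  let ?P = "{(i, j). i < j \<and> j < m}"
  have fin: "finite ?P" by (rule finite_subset[of _ "{..<m} \<times> {..<m}"]) auto
  let ?f = "\<lambda>A. \<lambda>z\<in>?P. A (fst z) (snd z)"
  let ?g = "\<lambda>h i j. if i < j \<and> j < m then h (i, j) else if i = j \<and> j < m then 1 else (0::int)"
  have bij: "bij_betw ?f ?U (?P \<rightarrow>\<^sub>E {0..<q})"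
  proof (rule bij_betw_byWitness[where f' = ?g])
    show "\<forall>A\<in>?U. ?g (?f A) = A"
    proof
      fix A assume A: "A \<in> ?U"
      have "?g (?f A) i j = A i j" for i j
        using unitri_residueD(3,5)[OF A, of i j] unitri_residueD(4)[OF A, of i]
        by (cases i j rule: linorder_cases) auto
      then show "?g (?f A) = A" by blast
    qed
    show "\<forall>h\<in>?P \<rightarrow>\<^sub>E {0..<q}. ?f (?g h) = h"
      by (auto simp: fun_eq_iff PiE_iff extensional_def)
    show "?f ` ?U \<subseteq> ?P \<rightarrow>\<^sub>E {0..<q}"
    proof
      fix h assume "h \<in> ?f ` ?U"
      then obtain A where A: "A \<in> ?U" "h = ?f A" by blast
      show "h \<in> ?P \<rightarrow>\<^sub>E {0..<q}"
        using unitri_residueD(1,2)[OF A(1)] unfolding A(2) by (auto intro!: restrict_PiE[THEN iffD2])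
    qed
    show "?g ` (?P \<rightarrow>\<^sub>E {0..<q}) \<subseteq> ?U"
    proof
      fix A assume "A \<in> ?g ` (?P \<rightarrow>\<^sub>E {0..<q})"
      then obtain h where h: "h \<in> ?P \<rightarrow>\<^sub>E {0..<q}" "A = ?g h" by blast
      have "0 \<le> h (i, j) \<and> h (i, j) < q" if "i < j" "j < m" for i j
        using PiE_mem[OF h(1), of "(i, j)"] that by simp
      then show "A \<in> ?U" unfolding h(2) unitri_residue_simps using assms by auto
    qed
  qed
  show "finite ?U" using bij_betw_finite[OF bij] fin by (simp add: finite_PiE)
  show "card ?U = nat q ^ card ?P" using bij_betw_same_card[OF bij] fin by (simp add: card_PiE)
qed

section \<open>Unitriangular representations kill the filtrations\<close>

lemma adic_pow:
  assumes U: "factorial_closed U" and b: "b \<in> adic p U (v i)"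
    and v: "\<And>i j d d'. v (i + j) (d + d') \<le> v i d + v j d'" "\<And>d. v 0 d = 0"
  shows "b ^ k \<in> adic p U (v (i * k))"
proof (induction k)
  case 0
  then show ?case using v(2) by (simp add: adic_def)
next
  case (Suc k)
  have "v (i * Suc k) (d + d') \<le> v i d + v (i * k) d'" for d d'
    using v(1)[of i "i * k" d d'] by simp
  then show ?case using adic_mult[OF U b Suc] by simp
qed

text \<open>The inner binomial coefficients are divisible by \<open>p\<close> and raise the exponent
  by one; the bound for the last term \<open>b ^ p\<close> is a separate hypothesis.\<close>

lemma adic_one_plus_prime_power:
  assumes U: "factorial_closed U" and p: "Factorial_Ring.prime p" and v: "antimono v"
    and b: "b \<in> adic p U v" "b ^ p \<in> adic p U w" and w: "\<And>d. w d \<le> Suc (v d)"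
  shows "(1 + b) ^ p - 1 \<in> adic p U w"
proof -
  have p1: "1 \<le> p" using prime_ge_1_nat[OF p] .
  have "{..p} = insert 0 (insert p {1..<p})" using p1 by auto
  then have eq: "(1 + b) ^ p = 1 + (b ^ p + (\<Sum>j\<in>{1..<p}. of_nat (p choose j) * b ^ j))"
    unfolding one_plus_power using p1 by simp
  have "of_nat (p choose j) * b ^ j \<in> adic p U w" if j: "j \<in> {1..<p}" for j
  proof -
    have "p dvd p choose j" using j by (intro dvd_choose_prime[OF _ _ _ p]) auto
    then have dvd: "int p dvd int (p choose j)" by simp
    have "b ^ j = b * b ^ (j - 1)" using j by (cases j) auto
    then have "b ^ j \<in> adic p U v" using adic_mult_right[OF U v b(1)] by simp
    then have *: "int p ^ Suc (v (length u)) dvd int (p choose j) * cf (b ^ j) u" if "u \<in> U" for u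
      using that dvd unfolding adic_def power_Suc by (intro mult_dvd_mono) auto
    have "int p ^ w (length u) dvd int (p choose j) * cf (b ^ j) u" if "u \<in> U" for u
      by (rule power_le_dvd[OF *[OF that] w])
    then show ?thesis by (simp add: adic_def)
  qed
  then have "(\<Sum>j\<in>{1..<p}. of_nat (p choose j) * b ^ j) \<in> adic p U w" by (rule adic_sum)
  then show ?thesis unfolding eq using adic_add[OF b(2)] by simp
qed

text \<open>The factors of the word \<open>0, 1, ..., m - 2\<close>; the factor
  \<open>[i..<j]\<close> stands for the matrix entry in row \<open>i\<close> and column
  \<open>j\<close>.\<close>

definition segments :: "nat \<Rightarrow> nat list set" where
  "segments m = {[i..<j] | i j. i \<le> j \<and> j < m}"

lemma factorial_closed_segments: "factorial_closed (segments m)"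
  unfolding factorial_closed_def segments_def
proof (intro ballI allI)
  fix u k assume "u \<in> {[i..<j] | i j. i \<le> j \<and> j < m}"
  then obtain i j where u: "u = [i..<j]" "i \<le> j" "j < m" by blast
  have "take k u = [i..<min j (i + k)]" "drop k u = [min j (i + k)..<j]"
    using u by (auto simp: min_def)
  then show "take k u \<in> {[i..<j] | i j. i \<le> j \<and> j < m} \<and> drop k u \<in> {[i..<j] | i j. i \<le> j \<and> j < m}"
    using u by (intro conjI CollectI) (metis le_add1 min.bounded_iff min.cobounded1 order_le_less_trans)+
qed

locale unitri_rep = topgroup S T for S :: "('a, 'b) monoid_scheme" (structure) and T :: "'a topology" +
  fixes p e c m :: nat and \<rho> :: "'a \<Rightarrow> nat \<Rightarrow> nat \<Rightarrow> int"
  assumes p: "Factorial_Ring.prime p" and e: "1 \<le> e" and c: "1 \<le> c"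
    and hom: "\<rho> \<in> hom S (UT (int p ^ e) m)"
    and cont: "dcont T (UT (int p ^ e) m) \<rho>"
begin

abbreviation "q \<equiv> int p ^ e"
abbreviation "I \<equiv> adic p (segments m)"

definition lift :: "'a \<Rightarrow> ser" where "lift x = matrix_ser (\<rho> x)"
text \<open>The exponent of \<open>p\<close> that step \<open>i\<close> of the filtration demands at
  distance \<open>d\<close> from the diagonal, capped at \<open>e\<close> because entries are known
  only modulo \<open>p ^ e\<close>. With \<open>c = 1\<close> it grows by one per step; with
  \<open>c = e\<close> the entries at distances \<open>0 < d < i\<close> have to vanish.\<close>

definition weight :: "nat \<Rightarrow> nat \<Rightarrow> nat" where "weight i d = min e (c * (i - d))"
definition fil :: "nat \<Rightarrow> 'a set" where "fil i = {x \<in> carrier S. lift x - 1 \<in> I (weight i)}"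

lemma q1: "1 < q"
  using prime_gt_1_nat[OF p] e by (simp add: one_less_power)

lemma rho_carrier: "x \<in> carrier S \<Longrightarrow> \<rho> x \<in> carrier (UT q m)"
  by (rule hom_in_carrier[OF hom])

lemma weight_add: "weight (i + j) (d + d') \<le> weight i d + weight j d'"
proof -
  have "c * ((i + j) - (d + d')) \<le> c * ((i - d) + (j - d'))" by (intro mult_le_mono2) simp
  then show ?thesis unfolding weight_def distrib_left by linarith
qed

lemma weight_le: "weight i d \<le> e" and weight_0: "weight 0 d = 0"
  by (simp_all add: weight_def)

lemma weight_mono: "i \<le> j \<Longrightarrow> weight i d \<le> weight j d"
  unfolding weight_def by (intro min.mono mult_le_mono2) auto

lemma antimono_weight: "antimono (weight i)"
  unfolding antimono_def weight_def by (intro allI impI min.mono mult_le_mono2) auto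

lemmas ideal_left = adic_mult_left[OF factorial_closed_segments antimono_weight]
lemmas ideal_right = adic_mult_right[OF factorial_closed_segments antimono_weight]

lemma modulus_I: "f \<in> I (\<lambda>_. e) \<Longrightarrow> f \<in> I (weight i)"
  by (erule adic_mono) (rule weight_le)

lemma weight_ideal_mono: "i \<le> j \<Longrightarrow> f \<in> I (weight j) \<Longrightarrow> f \<in> I (weight i)"
  by (erule adic_mono) (rule weight_mono)

text \<open>\<open>lift\<close> is multiplicative only modulo \<open>p ^ e\<close> and only at
  segments; the cap in \<open>weight\<close> makes these errors harmless in every ideal of the
  filtration.\<close>

lemma lift_mult:
  assumes "x \<in> carrier S" "y \<in> carrier S"
  shows "lift (x \<otimes> y) - lift x * lift y \<in> I (weight k)"
proof (rule modulus_I, unfold adic_def segments_def, safe)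
  fix i j assume ij: "i \<le> j" "j < m"
  have "\<rho> (x \<otimes> y) = word_matrix m [0..<m] q (lift x) \<otimes>\<^bsub>UT q m\<^esub> word_matrix m [0..<m] q (lift y)"
    unfolding lift_def word_matrix_matrix_ser[OF q1 rho_carrier[OF assms(1)]]
      word_matrix_matrix_ser[OF q1 rho_carrier[OF assms(2)]]
    using hom_mult[OF hom assms] .
  also have "\<dots> = word_matrix m [0..<m] q (lift x * lift y)"
    by (rule word_matrix_mult[OF q1, symmetric]) (simp_all add: lift_def)
  finally have "\<rho> (x \<otimes> y) i j = cf (lift x * lift y) [i..<j] mod q"
    using ij by (simp add: word_matrix_def)
  then show "q dvd cf (lift (x \<otimes> y) - lift x * lift y) [i..<j]"
    using ij by (cases "i = j") (simp_all add: lift_def matrix_ser_upt mod_0_imp_dvd mod_diff_left_eq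
        minus_mod_eq_mult_div mult.commute dvd_minus_mod)
qed

lemma lift_one: "lift \<one> - 1 \<in> I (weight k)"
proof (rule modulus_I, unfold adic_def segments_def, safe)
  fix i j assume ij: "i \<le> j" "j < m"
  have "\<rho> \<one> = \<one>\<^bsub>UT q m\<^esub>"
    using hom_one[OF hom is_group group_unitri_residue[OF q1]] .
  then show "q dvd cf (lift \<one> - 1) [i..<j]"
    using ij by (cases "i = j") (simp_all add: lift_def matrix_ser_upt cf_one unitri_residue_simps)
qed

lemma lift_inv:
  assumes "x \<in> carrier S"
  shows "lift (inv x) * lift x - 1 \<in> I (weight k)"
proof -
  have "lift (inv x) * lift x - 1 = (lift \<one> - 1) - (lift (inv x \<otimes> x) - lift (inv x) * lift x)"
    using assms by simp
  then show ?thesis using adic_diff[OF lift_one lift_mult[of "inv x" x]] assms by simp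
qed

text \<open>At positive length \<open>weight 1\<close> is 0, and at the empty word both series have
  coefficient 1.\<close>

lemma fil_1: "fil 1 = carrier S"
proof -
  have "lift x - 1 \<in> I (weight 1)" for x
    unfolding adic_def segments_def
  proof safe
    fix i j :: nat assume "i \<le> j" "j < m"
    then show "int p ^ weight 1 (length [i..<j]) dvd cf (lift x - 1) [i..<j]"
      by (cases "i = j") (simp_all add: weight_def lift_def cf_one)
  qed
  then show ?thesis by (simp add: fil_def)
qed

lemma fil_antimono: "i \<le> j \<Longrightarrow> fil j \<subseteq> fil i"
  unfolding fil_def using weight_ideal_mono by blast

lemma fil_comm:
  assumes x: "x \<in> fil i" and y: "y \<in> fil j"
  shows "comm S x y \<in> fil (i + j)"
proof -
  have xc: "x \<in> carrier S" and yc: "y \<in> carrier S" and xI: "lift x - 1 \<in> I (weight i)"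
    and yI: "lift y - 1 \<in> I (weight j)" using x y by (auto simp: fil_def)
  let ?V = "lift (inv (y \<otimes> x))" and ?k = "i + j"
  have 1: "(lift x - 1) * (lift y - 1) \<in> I (weight ?k)"
    by (rule adic_mult[OF factorial_closed_segments xI yI weight_add])
  have "weight (i + j) (d + d') \<le> weight j d + weight i d'" for d d'
    using weight_add[of j i d d'] by (simp add: add.commute)
  then have 2: "(lift y - 1) * (lift x - 1) \<in> I (weight ?k)"
    by (rule adic_mult[OF factorial_closed_segments yI xI])
  have "comm S x y = inv (y \<otimes> x) \<otimes> (x \<otimes> y)" using xc yc by (simp add: group_simps)
  then have 3: "lift (comm S x y) - ?V * lift (x \<otimes> y) \<in> I (weight ?k)"
    using lift_mult[of "inv (y \<otimes> x)" "x \<otimes> y"] xc yc by simp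
  have 4: "?V * lift (y \<otimes> x) - 1 \<in> I (weight ?k)" using lift_inv[of "y \<otimes> x"] xc yc by simp
  \<comment> \<open>Up to the errors of \<open>lift\<close> on the products involved, this is
    \<open>?V\<close> times the ring commutator of \<open>lift x - 1\<close> and
    \<open>lift y - 1\<close>.\<close>
  have "lift (comm S x y) - 1 = (lift (comm S x y) - ?V * lift (x \<otimes> y)) + (?V * lift (y \<otimes> x) - 1) +
      ?V * ((lift (x \<otimes> y) - lift x * lift y) - (lift (y \<otimes> x) - lift y * lift x) +
        ((lift x - 1) * (lift y - 1) - (lift y - 1) * (lift x - 1)))"
    by (simp add: algebra_simps)
  also have "\<dots> \<in> I (weight ?k)"
    using xc yc by (intro adic_add adic_diff ideal_left 1 2 3 4 lift_mult)
  finally show ?thesis using xc yc by (simp add: fil_def)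
qed

lemma cnormal_fil:
  assumes i: "1 \<le> i"
  shows "cnormal (fil i)"
proof -
  have "normal (fil i) S"
  proof (rule normal_invI)
    show sub: "subgroup (fil i) S"
    proof
      show "fil i \<subseteq> carrier S" by (auto simp: fil_def)
      show "\<one> \<in> fil i" using lift_one by (simp add: fil_def)
    next
      fix x y assume "x \<in> fil i" "y \<in> fil i"
      then have x: "x \<in> carrier S" "lift x - 1 \<in> I (weight i)"
        and y: "y \<in> carrier S" "lift y - 1 \<in> I (weight i)" by (auto simp: fil_def)
      have "lift (x \<otimes> y) - 1 = (lift (x \<otimes> y) - lift x * lift y) + (lift x - 1) * lift y + (lift y - 1)"
        by (simp add: algebra_simps)
      also have "\<dots> \<in> I (weight i)" by (rule adic_add[OF adic_add[OF lift_mult[OF x(1) y(1)] ideal_right[OF x(2)]] y(2)])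
      finally show "x \<otimes> y \<in> fil i" using x y by (simp add: fil_def)
    next
      fix x assume "x \<in> fil i"
      then have x: "x \<in> carrier S" "lift x - 1 \<in> I (weight i)" by (auto simp: fil_def)
      have "lift (inv x) - 1 = (lift (inv x) * lift x - 1) - lift (inv x) * (lift x - 1)"
        by (simp add: algebra_simps)
      also have "\<dots> \<in> I (weight i)" by (rule adic_diff[OF lift_inv[OF x(1)] ideal_left[OF x(2)]])
      finally show "inv x \<in> fil i" using x by (simp add: fil_def)
    qed
    fix g x assume g: "g \<in> carrier S" and x: "x \<in> fil i"
    have xc: "x \<in> carrier S" using x by (simp add: fil_def)
    \<comment> \<open>The conjugate of \<open>x\<close> by \<open>g\<close> is
      \<open>x \<otimes> comm S x (inv g)\<close>, so normality follows from \<open>fil_comm\<close>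
      and \<open>fil_1\<close>.\<close>
    have "comm S x (inv g) \<in> fil (i + 1)"
      using fil_comm[OF x, of "inv g" 1] g unfolding fil_1 by simp
    then have "comm S x (inv g) \<in> fil i" using fil_antimono[of i "i + 1"] by auto
    then have "x \<otimes> comm S x (inv g) \<in> fil i" by (rule subgroup.m_closed[OF sub x])
    then show "g \<otimes> x \<otimes> inv g \<in> fil i" using g xc by (simp add: group_simps)
  qed
  moreover have "closedin T (fil i)"
  proof -
    have "openin T {x \<in> carrier S. \<not> (matrix_ser (\<rho> x) - 1 \<in> I (weight i))}"
      by (rule continuous_discreteD(2)[OF cont])
    moreover have "carrier S - fil i = {x \<in> carrier S. \<not> (matrix_ser (\<rho> x) - 1 \<in> I (weight i))}"
      by (auto simp: fil_def lift_def)
    moreover have "fil i \<subseteq> carrier S" by (auto simp: fil_def)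
    ultimately show ?thesis by (simp add: closedin_def)
  qed
  ultimately show ?thesis by (simp add: cnormal_def)
qed

lemma lift_pow:
  assumes "x \<in> carrier S"
  shows "lift (x [^] (k::nat)) - lift x ^ k \<in> I (weight i)"
proof (induction k)
  case 0
  then show ?case using lift_one by simp
next
  case (Suc k)
  have "lift (x [^] Suc k) - lift x ^ Suc k =
      (lift (x [^] k \<otimes> x) - lift (x [^] k) * lift x) + (lift (x [^] k) - lift x ^ k) * lift x"
    by (simp add: algebra_simps power_commutes)
  also have "\<dots> \<in> I (weight i)" using assms by (intro adic_add ideal_right lift_mult Suc nat_pow_closed)
  finally show ?case .
qed

text \<open>The bound on \<open>weight j\<close> accounts for the inner binomial terms, which gain
  one factor \<open>p\<close>; the bound \<open>j \<le> i * p\<close> accounts for the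
  \<open>p\<close>-th power of \<open>lift x - 1\<close>.\<close>

lemma fil_pow:
  assumes x: "x \<in> fil i" and w: "\<And>d. weight j d \<le> Suc (weight i d)" "j \<le> i * p"
  shows "x [^] p \<in> fil j"
proof -
  have xc: "x \<in> carrier S" and xI: "lift x - 1 \<in> I (weight i)" using x by (auto simp: fil_def)
  have "(lift x - 1) ^ p \<in> I (weight (i * p))"
    by (rule adic_pow[where v = weight, OF factorial_closed_segments xI weight_add weight_0])
  then have "(lift x - 1) ^ p \<in> I (weight j)" by (rule weight_ideal_mono[OF w(2)])
  then have "(1 + (lift x - 1)) ^ p - 1 \<in> I (weight j)"
    by (rule adic_one_plus_prime_power[OF factorial_closed_segments p antimono_weight xI _ w(1)])
  then have "lift x ^ p - 1 \<in> I (weight j)" by simp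
  then have "(lift (x [^] p) - lift x ^ p) + (lift x ^ p - 1) \<in> I (weight j)"
    using lift_pow[OF xc] by (intro adic_add)
  then show ?thesis using xc by (simp add: fil_def)
qed

text \<open>An entry above the diagonal is divisible by \<open>p ^ e\<close> and lies between 0 and
  \<open>p ^ e - 1\<close>.\<close>

lemma fil_kernel:
  assumes "x \<in> fil n" and w: "\<And>d. 1 \<le> d \<Longrightarrow> d < m \<Longrightarrow> e \<le> weight n d"
  shows "\<rho> x = \<one>\<^bsub>UT q m\<^esub>"
proof (intro ext)
  fix i j
  have xc: "x \<in> carrier S" and xI: "lift x - 1 \<in> I (weight n)" using assms(1) by (auto simp: fil_def)
  note D = unitri_residueD[OF rho_carrier[OF xc]]
  show "\<rho> x i j = \<one>\<^bsub>UT q m\<^esub> i j"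
  proof (cases "i < j \<and> j < m")
    case True
    then have "[i..<j] \<in> segments m"
      unfolding segments_def by (intro CollectI exI[of _ i] exI[of _ j]) auto
    then have "int p ^ weight n (j - i) dvd cf (lift x - 1) [i..<j]"
      using xI unfolding adic_def by force
    then have "int p ^ weight n (j - i) dvd \<rho> x i j"
      using True by (simp add: lift_def matrix_ser_upt cf_one)
    moreover have "e \<le> weight n (j - i)" by (rule w) (use True in auto)
    ultimately have "q dvd \<rho> x i j" by (rule power_le_dvd)
    moreover have "0 \<le> \<rho> x i j" "\<rho> x i j < q" using D(1,2)[of i j] True by auto
    ultimately have "\<rho> x i j = 0" using zdvd_not_zless[of "\<rho> x i j" q] by linarith
    then show ?thesis using True by (simp add: unitri_residue_simps)
  next
    case False
    then have "i < m \<and> j < i \<or> i < m \<and> j = i \<or> \<not> (i < m \<and> j < m)" by auto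
    then show ?thesis
      using D(3)[of i j] D(4)[of i] D(5)[of i j] by (auto simp: unitri_residue_simps)
  qed
qed

lemma lower_central_fil: "1 \<le> i \<Longrightarrow> lower_central S T i \<subseteq> fil i"
proof (induction i rule: dec_induct)
  case base
  then show ?case using fil_1 by simp
next
  case (step i)
  have "commsub S T (lower_central S T i) (carrier S) \<subseteq> fil (Suc i)"
  proof (rule commsub_least[OF cnormal_fil])
    fix x y assume "x \<in> lower_central S T i" "y \<in> carrier S"
    then show "comm S x y \<in> fil (Suc i)" using step.IH fil_comm[of x i y 1] fil_1 by auto
  qed simp
  then show ?case using step.hyps by simp
qed

text \<open>With \<open>c = 1\<close> the weight grows by at most one from step \<open>i\<close> to
  step \<open>i + 1\<close>, and \<open>i + 1 \<le> i * p\<close>, so \<open>fil_pow\<close>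
  applies.\<close>

lemma p_central_fil:
  assumes "c = 1" "1 \<le> i"
  shows "p_central p S T i \<subseteq> fil i"
  using assms(2)
proof (induction i rule: dec_induct)
  case base
  then show ?case using fil_1 by simp
next
  case (step i)
  show ?case
  proof (rule p_central_least[OF _ cnormal_fil])
    fix x assume "x \<in> p_central p S T i"
    then have "x \<in> fil i" using step.IH by blast
    moreover have "Suc i \<le> i * p"
      using mult_le_mono2[OF prime_ge_2_nat[OF p], of i] step.hyps(1) by linarith
    moreover have "weight (Suc i) d \<le> Suc (weight i d)" for d
      unfolding weight_def unfolding assms(1) by (auto simp: min_def)
    ultimately show "x [^] p \<in> fil (Suc i)" by (intro fil_pow)
  next
    fix x y assume "x \<in> p_central p S T i" "y \<in> carrier S"
    then show "comm S x y \<in> fil (Suc i)" using step.IH fil_comm[of x i y 1] fil_1 by auto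
  qed (use step.hyps in auto)
qed

text \<open>For \<open>e = 1\<close> weights are at most 1, which gives the first condition of
  \<open>fil_pow\<close>; the second says that \<open>n\<close> is at most \<open>p\<close> times
  the ceiling of \<open>n / p\<close>.\<close>

lemma zassenhaus_fil:
  assumes "e = 1" "1 \<le> i"
  shows "zassenhaus p S T i \<subseteq> fil i"
  using assms(2)
proof (induction i rule: less_induct)
  case (less n)
  have p2: "2 \<le> p" using prime_ge_2_nat[OF p] .
  show ?case
  proof (cases "n = 1")
    case True
    then show ?thesis using zassenhaus_1 fil_1 by simp
  next
    case False
    then have n: "2 \<le> n" using less.prems by simp
    show ?thesis
    proof (rule zassenhaus_least[OF p2 n cnormal_fil[OF less.prems]])
      fix x assume x: "x \<in> zassenhaus p S T ((n + p - 1) div p)"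
      let ?k = "(n + p - 1) div p"
      have "?k < n" using ceil_div_less[of n p] n p2 by simp
      moreover have "1 \<le> ?k" using n p2 by (simp add: Suc_le_eq div_greater_zero_iff)
      ultimately have "x \<in> fil ?k" using x less.IH by blast
      moreover have "n \<le> ?k * p"
      proof -
        have "n + p - 1 = ?k * p + (n + p - 1) mod p" by simp
        moreover have "(n + p - 1) mod p < p" using p2 by simp
        ultimately show ?thesis by linarith
      qed
      moreover have "weight n d \<le> Suc (weight ?k d)" for d
        using weight_le[of n d] assms(1) by simp
      ultimately show "x [^] p \<in> fil n" by (intro fil_pow)
    next
      fix i x y assume i: "1 \<le> i" "i < n" and x: "x \<in> zassenhaus p S T i" and y: "y \<in> zassenhaus p S T (n - i)"
      have "x \<in> fil i" "y \<in> fil (n - i)"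
        using less.IH[of i] less.IH[of "n - i"] i x y by (auto simp: Suc_le_eq)
      then show "comm S x y \<in> fil n" using fil_comm[of x i y "n - i"] i by simp
    qed
  qed
qed

end

section \<open>Detection of elements by unitriangular representations\<close>

definition letter :: "nat \<Rightarrow> ser" where
  "letter i = Ser (\<lambda>u. if u = [i] then 1 else 0)"

lemma (in group) subgroup_pow: "subgroup H G \<Longrightarrow> x \<in> H \<Longrightarrow> x [^] (k::nat) \<in> H"
  by (induction k) (simp_all add: subgroup.one_closed subgroup.m_closed)

lemma magnus_inv:
  assumes "cf f [] = 1"
  shows "cf (inv\<^bsub>magnus\<^esub> f) [] = 1" "inv\<^bsub>magnus\<^esub> f * f = 1" "f * inv\<^bsub>magnus\<^esub> f = 1"
  using group.inv_closed[OF group_magnus, of f] group.l_inv[OF group_magnus, of f]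
    group.r_inv[OF group_magnus, of f] assms by simp_all

text \<open>The slope \<open>K\<close> will be \<open>v 0\<close>: from step \<open>n\<close> on,
  this ideal is contained in the one defined by \<open>v\<close>.\<close>

lemma magnus_comm_adic:
  assumes U: "factorial_closed U" and f: "cf f [] = 1" "f - 1 \<in> adic p U (\<lambda>d. K * (i - d))"
    and g: "cf g [] = 1" "g - 1 \<in> adic p U (\<lambda>d. K * (j - d))"
  shows "comm magnus f g - 1 \<in> adic p U (\<lambda>d. K * (i + j - d))"
proof -
  let ?f = "inv\<^bsub>magnus\<^esub> f" and ?g = "inv\<^bsub>magnus\<^esub> g" and ?w = "\<lambda>d. K * (i + j - d)"
  have w: "K * (i + j - (d + d')) \<le> K * (i - d) + K * (j - d')" for d d'
    unfolding distrib_left[symmetric] by (rule mult_le_mono2) simp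
  have w': "K * (i + j - (d + d')) \<le> K * (j - d) + K * (i - d')" for d d'
    unfolding distrib_left[symmetric] by (rule mult_le_mono2) simp
  have am: "antimono ?w" unfolding antimono_def by (intro allI impI mult_le_mono2) auto
  have "?f * ?g * (g * f) = ?f * (?g * g) * f" by (simp only: mult.assoc)
  then have 1: "?f * ?g * (g * f) = 1" using magnus_inv(2)[OF f(1)] magnus_inv(2)[OF g(1)] by simp
  have "comm magnus f g - 1 = ?f * ?g * (f * g) - ?f * ?g * (g * f)"
    by (simp add: comm_def mult.assoc 1[unfolded mult.assoc])
  also have "\<dots> = ?f * ?g * ((f - 1) * (g - 1) - (g - 1) * (f - 1))"
    by (simp add: algebra_simps)
  also have "\<dots> \<in> adic p U ?w"
    by (intro adic_mult_left[OF U am] adic_diff adic_mult[OF U f(2) g(2) w] adic_mult[OF U g(2) f(2) w'])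
  finally show ?thesis .
qed

text \<open>Provides one exponent for all series at once: each further \<open>p\<close>-th power
  gains a factor \<open>p\<close>, independently of \<open>f\<close>.\<close>

lemma magnus_power_adic:
  assumes U: "factorial_closed U" and p: "Factorial_Ring.prime p" and f: "cf f [] = 1"
  shows "f ^ (p ^ k) - 1 \<in> adic p U (\<lambda>d. Suc k - d)"
proof (induction k)
  case 0
  have "int p ^ (Suc 0 - length u) dvd cf (f - 1) u" for u
    using f by (cases u) (simp_all add: cf_one)
  then show ?case by (simp add: adic_def)
next
  case (Suc k)
  let ?b = "f ^ (p ^ k) - 1" and ?v = "\<lambda>i d. i - d :: nat"
  have p2: "2 \<le> p" using prime_ge_2_nat[OF p] .
  have "?b ^ p \<in> adic p U (?v (Suc k * p))"
    by (rule adic_pow[where v = ?v, OF U Suc]) auto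
  moreover have "Suc (Suc k) \<le> Suc k * p" using mult_le_mono2[OF p2, of "Suc k"] by simp
  ultimately have b: "?b ^ p \<in> adic p U (\<lambda>d. Suc (Suc k) - d)"
    by (elim adic_mono) (simp add: diff_le_mono)
  have am: "antimono (\<lambda>d. Suc k - d)" by (auto simp: antimono_def)
  have "(1 + ?b) ^ p - 1 \<in> adic p U (\<lambda>d. Suc (Suc k) - d)"
    by (rule adic_one_plus_prime_power[OF U p am Suc b]) simp
  moreover have "(1 + ?b) ^ p = f ^ (p ^ Suc k)" by (simp add: power_mult[symmetric] mult.commute)
  ultimately show ?case by simp
qed

lemma DirProd_magnus_simps:
  assumes "group S"
  shows "carrier (S \<times>\<times> magnus) = {(x, f). x \<in> carrier S \<and> cf f [] = 1}"
    "(x, f) \<otimes>\<^bsub>S \<times>\<times> magnus\<^esub> (y, g) = (x \<otimes>\<^bsub>S\<^esub> y, f * g)"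
    "\<one>\<^bsub>S \<times>\<times> magnus\<^esub> = (\<one>\<^bsub>S\<^esub>, 1)"
    "x \<in> carrier S \<Longrightarrow> cf f [] = 1 \<Longrightarrow> inv\<^bsub>S \<times>\<times> magnus\<^esub> (x, f) = (inv\<^bsub>S\<^esub> x, inv\<^bsub>magnus\<^esub> f)"
    "x \<in> carrier S \<Longrightarrow> cf f [] = 1 \<Longrightarrow> (x, f) [^]\<^bsub>S \<times>\<times> magnus\<^esub> (k::nat) = (x [^]\<^bsub>S\<^esub> k, f ^ k)"
proof -
  interpret group S by fact
  interpret P: group "S \<times>\<times> magnus" by (rule DirProd_group[OF assms group_magnus])
  show "carrier (S \<times>\<times> magnus) = {(x, f). x \<in> carrier S \<and> cf f [] = 1}"
    and m: "\<And>x y f g. (x, f) \<otimes>\<^bsub>S \<times>\<times> magnus\<^esub> (y, g) = (x \<otimes>\<^bsub>S\<^esub> y, f * g)"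
    and one: "\<one>\<^bsub>S \<times>\<times> magnus\<^esub> = (\<one>\<^bsub>S\<^esub>, 1)"
    by (auto simp: DirProd_def)
  show "inv\<^bsub>S \<times>\<times> magnus\<^esub> (x, f) = (inv\<^bsub>S\<^esub> x, inv\<^bsub>magnus\<^esub> f)" if "x \<in> carrier S" "cf f [] = 1"
    using inv_DirProd[OF assms group_magnus] that by simp
  show "(x, f) [^]\<^bsub>S \<times>\<times> magnus\<^esub> k = (x [^]\<^bsub>S\<^esub> k, f ^ k)" if "x \<in> carrier S" "cf f [] = 1" for k :: nat
    by (induction k) (simp_all add: m one power_commutes)
qed

lemma normal_magnus_product:
  assumes S: "group S" and C: "normal C S" and U: "factorial_closed U" "antimono v"
  shows "normal {(x, f). x \<in> C \<and> cf f [] = 1 \<and> f - 1 \<in> adic p U v} (S \<times>\<times> magnus)"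
    (is "normal ?D ?P")
proof -
  interpret group S by fact
  interpret P: group ?P by (rule DirProd_group[OF S group_magnus])
  note simps = DirProd_magnus_simps[OF S]
  have Cs: "subgroup C S" by (rule normal_imp_subgroup[OF C])
  have Cc: "x \<in> carrier S" if "x \<in> C" for x using subgroup.mem_carrier[OF Cs that] .
  note left = adic_mult_left[OF U] and right = adic_mult_right[OF U]
  show ?thesis
  proof (rule P.normal_invI)
    show "subgroup ?D ?P"
    proof
      show "?D \<subseteq> carrier ?P" using Cc by (auto simp: simps(1))
      show "\<one>\<^bsub>?P\<^esub> \<in> ?D" using subgroup.one_closed[OF Cs] by (simp add: simps(3) cf_one)
    next
      fix z z' assume "z \<in> ?D" "z' \<in> ?D"
      then obtain x f y g where z: "z = (x, f)" "z' = (y, g)" "x \<in> C" "y \<in> C" "cf f [] = 1" "cf g [] = 1"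
        "f - 1 \<in> adic p U v" "g - 1 \<in> adic p U v" by auto
      have "f * g - 1 = (f - 1) * g + (g - 1)" by (simp add: algebra_simps)
      also have "\<dots> \<in> adic p U v" by (rule adic_add[OF right[OF z(7)] z(8)])
      finally have "f * g - 1 \<in> adic p U v" .
      then show "z \<otimes>\<^bsub>?P\<^esub> z' \<in> ?D"
        using z(3-6) subgroup.m_closed[OF Cs] by (simp add: z(1,2) simps(2))
    next
      fix z assume "z \<in> ?D"
      then obtain x f where z: "z = (x, f)" "x \<in> C" "cf f [] = 1" "f - 1 \<in> adic p U v" by auto
      have "inv\<^bsub>magnus\<^esub> f - 1 = - (inv\<^bsub>magnus\<^esub> f * (f - 1))"
        using magnus_inv(2)[OF z(3)] by (simp add: algebra_simps)
      also have "\<dots> \<in> adic p U v" by (rule adic_uminus[OF left[OF z(4)]])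
      finally have "inv\<^bsub>magnus\<^esub> f - 1 \<in> adic p U v" .
      then show "inv\<^bsub>?P\<^esub> z \<in> ?D"
        using z(2,3) subgroup.m_inv_closed[OF Cs] Cc magnus_inv(1) by (simp add: z(1) simps(4))
    qed
    fix w z assume "w \<in> carrier ?P" "z \<in> ?D"
    then obtain y g x f where z: "w = (y, g)" "z = (x, f)" "y \<in> carrier S" "x \<in> C" "cf g [] = 1" "cf f [] = 1"
        "f - 1 \<in> adic p U v" by (auto simp: simps(1))
    have "g * f * inv\<^bsub>magnus\<^esub> g - 1 = g * (f - 1) * inv\<^bsub>magnus\<^esub> g"
      using magnus_inv(3)[OF z(5)] by (simp add: algebra_simps)
    also have "\<dots> \<in> adic p U v" by (rule right[OF left[OF z(7)]])
    finally have "g * f * inv\<^bsub>magnus\<^esub> g - 1 \<in> adic p U v" .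
    then show "w \<otimes>\<^bsub>?P\<^esub> z \<otimes>\<^bsub>?P\<^esub> inv\<^bsub>?P\<^esub> w \<in> ?D"
      using z(3-6) normal.inv_op_closed2[OF C] magnus_inv(1)[OF z(5)]
      by (simp add: z(1,2) simps(2) simps(4)[OF z(3,5)])
  qed
qed

lemma code_singletons: "code ((\<lambda>i. [i]) ` A)"
  unfolding code_def
proof (rule inj_onI)
  have eq: "M = map (\<lambda>i. [i]) (concat M)" if "M \<in> lists ((\<lambda>i. [i]) ` A)" for M
    using that by induction auto
  fix M N assume "M \<in> lists ((\<lambda>i. [i]) ` A)" "N \<in> lists ((\<lambda>i. [i]) ` A)" "concat M = concat N"
  then show "M = N" using eq[of M] eq[of N] by simp
qed

lemma lead_letter: "lead B (letter i) [i]"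
  by (auto simp: lead_def letter_def prec_def)

context free_pro_p
begin

lemma finite_nontrivial: "openin T C \<Longrightarrow> normal C S \<Longrightarrow> finite (Y - C)"
  using Y_cofinite subgroup.one_closed[OF normal_imp_subgroup] by blast

text \<open>The filtration of the second component has slope \<open>v 0\<close>, so that it reaches
  the ideal of \<open>v\<close> as soon as \<open>F\<close> reaches \<open>C\<close>.\<close>

lemma elimination_product:
  assumes C: "openin T C" "normal C S"
    and F: "\<And>i. F i \<subseteq> carrier S" "\<And>i. n \<le> i \<Longrightarrow> F i \<subseteq> C"
    and F_comm: "\<And>i j x y. 1 \<le> i \<Longrightarrow> 1 \<le> j \<Longrightarrow> x \<in> F i \<Longrightarrow> y \<in> F j \<Longrightarrow> comm S x y \<in> F (i + j)"
    and v: "antimono v" "\<And>d. n \<le> d \<Longrightarrow> v d = 0"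
    and pow_C: "\<And>w x a. 1 \<le> w \<Longrightarrow> x \<in> F w \<Longrightarrow> (\<And>j. 1 \<le> j \<Longrightarrow> p ^ v (j * w) dvd a choose j) \<Longrightarrow> x [^] a \<in> C"
    and B: "2 \<le> B"
  shows "\<exists>q. elimination (S \<times>\<times> magnus) snd
    (\<lambda>i. {(x, f). x \<in> F i \<and> cf f [] = 1 \<and> f - 1 \<in> adic p (lists {..<B}) (\<lambda>d. v 0 * (i - d))})
    {(x, f). x \<in> C \<and> cf f [] = 1}
    {(x, f). x \<in> C \<and> cf f [] = 1 \<and> f - 1 \<in> adic p (lists {..<B}) v} n B p q v"
proof -
  let ?P = "S \<times>\<times> magnus" and ?L = "lists {..<B}"
  let ?F = "\<lambda>i. {(x, f). x \<in> F i \<and> cf f [] = 1 \<and> f - 1 \<in> adic p ?L (\<lambda>d. v 0 * (i - d))}"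
  let ?C = "{(x, f). x \<in> C \<and> cf f [] = 1}"
  let ?D = "{(x, f). x \<in> C \<and> cf f [] = 1 \<and> f - 1 \<in> adic p ?L v}"
  interpret P: group ?P by (rule DirProd_group[OF is_group group_magnus])
  note simps = DirProd_magnus_simps[OF is_group]
  have L: "factorial_closed ?L"
    using lists_take[of _ "{..<B}"] lists_drop[of _ "{..<B}"] by (simp add: factorial_closed_def)
  have p0: "0 < p" using prime by (simp add: prime_gt_0_nat)
  obtain e where e: "card (rcosets C) = p ^ e" using card_index[OF C] .
  \<comment> \<open>The summand \<open>e\<close> brings the power of the first component into
    \<open>C\<close>; the summand \<open>n + v 0\<close> makes \<open>Suc k - d\<close> at least
    \<open>v d\<close> for all \<open>d < n\<close>.\<close>
  define k where "k = e + (n + v 0)"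
  have "elimination ?P snd ?F ?C ?D n B p (p ^ k) v"
  proof (rule elimination.intro[OF P.is_group elimination_axioms.intro])
    show "snd \<in> hom ?P magnus" by (auto simp: hom_def simps(1,2))
    show "?F i \<subseteq> carrier ?P" for i using F(1)[of i] by (auto simp: simps(1))
    show "?F i \<subseteq> ?D" if i: "n \<le> i" for i
    proof -
      have "v d \<le> v 0 * (i - d)" for d
      proof (cases "d < n")
        case True
        then have "v 0 * 1 \<le> v 0 * (i - d)" using i by (intro mult_le_mono2) simp
        moreover have "v d \<le> v 0" using v(1) by (simp add: antimono_def)
        ultimately show ?thesis by linarith
      qed (simp add: v(2))
      then have "f - 1 \<in> adic p ?L v" if "f - 1 \<in> adic p ?L (\<lambda>d. v 0 * (i - d))" for f
        using adic_mono[OF that] by blast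
      then show ?thesis using F(2)[OF i] by auto
    qed
    show "normal ?D ?P" by (rule normal_magnus_product[OF is_group C(2) L v(1)])
    have "normal {(x, f). x \<in> C \<and> cf f [] = 1 \<and> f - 1 \<in> adic p ?L (\<lambda>_. 0)} ?P"
      by (rule normal_magnus_product[OF is_group C(2) L]) (simp add: antimono_def)
    then show "subgroup ?C ?P" by (intro normal_imp_subgroup) simp
    show "?D \<subseteq> ?C" by auto
    show "snd d - 1 \<in> adic p ?L v" if "d \<in> ?D" for d using that by auto
    show "1 \<le> p ^ k" using p0 by simp
    show "antimono v" "2 \<le> B" by fact+
  next
    fix i j z z' assume ij: "1 \<le> i" "1 \<le> j" and "z \<in> ?F i" "z' \<in> ?F j"
    then obtain x f y g where z: "z = (x, f)" "z' = (y, g)" "x \<in> F i" "y \<in> F j" "cf f [] = 1" "cf g [] = 1"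
        "f - 1 \<in> adic p ?L (\<lambda>d. v 0 * (i - d))" "g - 1 \<in> adic p ?L (\<lambda>d. v 0 * (j - d))" by auto
    have c: "x \<in> carrier S" "y \<in> carrier S" using z(3,4) F(1) by auto
    have "comm ?P z z' = (comm S x y, comm magnus f g)"
      by (simp add: z(1,2) comm_def simps(2) simps(4)[OF c(1) z(5)] simps(4)[OF c(2) z(6)])
    moreover have "cf (comm magnus f g) [] = 1"
      using magnus_inv(1) z(5,6) by (simp add: comm_def)
    ultimately show "comm ?P z z' \<in> ?F (i + j)"
      using F_comm[OF ij z(3,4)] magnus_comm_adic[OF L z(5,7,6,8)] by simp
  next
    fix z assume "z \<in> carrier ?P"
    then obtain x f where z: "z = (x, f)" "x \<in> carrier S" "cf f [] = 1" by (auto simp: simps(1))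
    have "x [^] (p ^ e) \<in> C" using pow_index_mem[OF C(2) e _ z(2)] p0 by simp
    then have "(x [^] (p ^ e)) [^] (p ^ (n + v 0)) \<in> C"
      by (rule subgroup_pow[OF normal_imp_subgroup[OF C(2)]])
    then have "x [^] (p ^ k) \<in> C" using z(2) by (simp add: nat_pow_pow k_def power_add)
    moreover have "v d \<le> Suc k - d" for d
    proof (cases "d < n")
      case True
      moreover have "v d \<le> v 0" using v(1) by (simp add: antimono_def)
      ultimately show ?thesis by (simp add: k_def)
    qed (simp add: v(2))
    then have "f ^ (p ^ k) - 1 \<in> adic p ?L v"
      by (rule adic_mono[OF magnus_power_adic[OF L prime z(3)]])
    moreover have "cf (f ^ (p ^ k)) [] = 1"
      using monoid.nat_pow_closed[OF group.is_monoid[OF group_magnus], of f "p ^ k"] z(3) by simp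
    ultimately show "z [^]\<^bsub>?P\<^esub> (p ^ k) \<in> ?D" by (simp add: z(1) simps(5)[OF z(2,3)])
  next
    fix w z and a :: nat assume w: "1 \<le> w" and "z \<in> ?F w"
      and div: "\<And>j. 1 \<le> j \<Longrightarrow> p ^ v (j * w) dvd a choose j"
    then obtain x f where z: "z = (x, f)" "x \<in> F w" "cf f [] = 1" by auto
    have c: "x \<in> carrier S" using z(2) F(1) by auto
    have "cf (f ^ a) [] = 1"
      using monoid.nat_pow_closed[OF group.is_monoid[OF group_magnus], of f a] z(3) by simp
    then show "z [^]\<^bsub>?P\<^esub> a \<in> ?C"
      using pow_C[OF w z(2) div] by (simp add: z(1) simps(5)[OF c z(3)])
  qed
  then show ?thesis by blast
qed

text \<open>By \<open>rep\<close>, for each short word \<open>u\<close> the word matrices of the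
  generators extend to a representation of \<open>S\<close> that is trivial on \<open>s\<close>; its
  entry in row 0 and column \<open>length u\<close> is a Magnus coefficient. Up to an open normal
  subgroup \<open>Q\<close> on which these representations are trivial, \<open>s\<close> comes from
  the abstract group \<open>\<Gamma>\<close>. The series of that element is then trivial modulo the
  ideal of \<open>v\<close>, and elimination puts the element into \<open>C\<close>.\<close>

theorem detection:
  assumes C: "openin T C" "normal C S"
    and F: "\<And>i. F i \<subseteq> carrier S" "F 1 = carrier S" "\<And>i. n \<le> i \<Longrightarrow> F i \<subseteq> C"
    and F_comm: "\<And>i j x y. 1 \<le> i \<Longrightarrow> 1 \<le> j \<Longrightarrow> x \<in> F i \<Longrightarrow> y \<in> F j \<Longrightarrow> comm S x y \<in> F (i + j)"
    and v: "antimono v" "\<And>d. n \<le> d \<Longrightarrow> v d = 0"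
    and pow_C: "\<And>w x a. 1 \<le> w \<Longrightarrow> x \<in> F w \<Longrightarrow> (\<And>j. 1 \<le> j \<Longrightarrow> p ^ v (j * w) dvd a choose j) \<Longrightarrow> x [^] a \<in> C"
    and s: "s \<in> carrier S"
    and rep: "\<And>u f. 1 \<le> length u \<Longrightarrow> length u < n \<Longrightarrow> 0 < v (length u) \<Longrightarrow> (\<And>y. cf (f y) [] = 1) \<Longrightarrow>
      finite {y\<in>Y. f y \<noteq> 1} \<Longrightarrow>
      \<exists>m \<rho>. length u < m \<and> \<rho> \<in> hom S (UT (int p ^ v (length u)) m) \<and>
        dcont T (UT (int p ^ v (length u)) m) \<rho> \<and>
        (\<forall>y\<in>Y. \<rho> y = word_matrix m u (int p ^ v (length u)) (f y)) \<and>
        \<rho> s = \<one>\<^bsub>UT (int p ^ v (length u)) m\<^esub>"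
  shows "s \<in> C"
proof (cases "2 \<le> n")
  case False
  then have "carrier S \<subseteq> C" using F(2) F(3)[of 1] by simp
  then show ?thesis using s by blast
next
  case True
  define Y0 where "Y0 = Y - C"
  have fin: "finite Y0" unfolding Y0_def by (rule finite_nontrivial[OF C])
  obtain \<iota> where \<iota>: "bij_betw \<iota> Y0 {0..<card Y0}" using ex_bij_betw_finite_nat[OF fin] by blast
  \<comment> \<open>At least one letter for each generator outside \<open>C\<close>, and at least
    two, as the choice of the minimal word needs a base \<open>B \<ge> 2\<close>.\<close>
  define B where "B = max 2 (card Y0)"
  define f where "f y = (if y \<in> Y0 then 1 + letter (\<iota> y) else 1)" for y
  have fNil: "cf (f y) [] = 1" for y by (simp add: f_def letter_def cf_one)
  let ?P = "S \<times>\<times> magnus" and ?L = "lists {..<B}"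
  let ?F = "\<lambda>i. {(x, f). x \<in> F i \<and> cf f [] = 1 \<and> f - 1 \<in> adic p ?L (\<lambda>d. v 0 * (i - d))}"
  let ?C = "{(x, f). x \<in> C \<and> cf f [] = 1}"
  let ?D = "{(x, f). x \<in> C \<and> cf f [] = 1 \<and> f - 1 \<in> adic p ?L v}"
  have B2: "2 \<le> B" by (simp add: B_def)
  have "\<exists>q. elimination ?P snd ?F ?C ?D n B p q v"
    by (rule elimination_product[where F = F and n = n and v = v and C = C and B = B]) fact+
  then obtain q where "elimination ?P snd ?F ?C ?D n B p q v" by (rule exE)
  then interpret E: elimination ?P snd ?F ?C ?D n B p q v .
  note simps = DirProd_magnus_simps[OF is_group]
  have "finite {y\<in>Y. f y \<noteq> 1}" by (rule finite_subset[OF _ fin]) (auto simp: f_def)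
  note rep' = rep[OF _ _ _ fNil this]
  let ?U = "\<lambda>u. UT (int p ^ v (length u))"
  \<comment> \<open>The words at which some divisibility is demanded. Their finiteness makes
    \<open>Q\<close> below open.\<close>
  define \<Omega> where "\<Omega> = {u \<in> ?L. 1 \<le> length u \<and> length u < n \<and> 0 < v (length u)}"
  have "\<Omega> \<subseteq> {u. set u \<subseteq> {..<B} \<and> length u \<le> n}" by (auto simp: \<Omega>_def)
  then have fin\<Omega>: "finite \<Omega>" by (rule finite_subset) (simp add: finite_lists_length_le)
  have "\<forall>u\<in>\<Omega>. \<exists>m \<rho>. length u < m \<and> \<rho> \<in> hom S (?U u m) \<and>
        dcont T (?U u m) \<rho> \<and>
        (\<forall>y\<in>Y. \<rho> y = word_matrix m u (int p ^ v (length u)) (f y)) \<and> \<rho> s = \<one>\<^bsub>?U u m\<^esub>"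
    using rep' by (simp add: \<Omega>_def)
  then obtain M \<rho> where rho: "\<And>u. u \<in> \<Omega> \<Longrightarrow> length u < M u \<and> \<rho> u \<in> hom S (?U u (M u)) \<and>
        dcont T (?U u (M u)) (\<rho> u) \<and>
        (\<forall>y\<in>Y. \<rho> u y = word_matrix (M u) u (int p ^ v (length u)) (f y)) \<and> \<rho> u s = \<one>\<^bsub>?U u (M u)\<^esub>"
    by metis
  have q1: "1 < int p ^ v (length u)" if "u \<in> \<Omega>" for u
    using prime_gt_1_nat[OF prime] that by (simp add: \<Omega>_def one_less_power)
  have gU: "group (?U u (M u))" if "u \<in> \<Omega>" for u by (rule group_unitri_residue[OF q1[OF that]])
  define Q where "Q = {x \<in> C. \<forall>u\<in>\<Omega>. \<rho> u x = \<one>\<^bsub>?U u (M u)\<^esub>}"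
  have Cs: "subgroup C S" by (rule normal_imp_subgroup[OF C(2)])
  have Cc: "x \<in> carrier S" if "x \<in> C" for x by (rule subgroup.mem_carrier[OF Cs that])
  have Q_open: "openin T Q"
  proof -
    have "openin T {x \<in> carrier S. \<rho> u x = \<one>\<^bsub>?U u (M u)\<^esub>}" if "u \<in> \<Omega>" for u
      using continuous_discreteD(2)[of "carrier (?U u (M u))" "\<rho> u" "\<lambda>A. A = \<one>\<^bsub>?U u (M u)\<^esub>"] rho[OF that]
      by blast
    then have "openin T (C \<inter> \<Inter>((\<lambda>u. {x \<in> carrier S. \<rho> u x = \<one>\<^bsub>?U u (M u)\<^esub>}) ` \<Omega>))"
      using C(1) fin\<Omega>
      by (cases "\<Omega> = {}") (auto intro!: openin_Int openin_Inter)
    moreover have "Q = C \<inter> \<Inter>((\<lambda>u. {x \<in> carrier S. \<rho> u x = \<one>\<^bsub>?U u (M u)\<^esub>}) ` \<Omega>)"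
      using Cc by (auto simp: Q_def)
    ultimately show ?thesis by simp
  qed
  have Q_normal: "normal Q S"
  proof (rule normal_invI)
    have gh: "group_hom S (?U u (M u)) (\<rho> u)" if "u \<in> \<Omega>" for u
      using gU[OF that] rho[OF that] by (simp add: group_hom_def group_hom_axioms_def is_group)
    have ker: "normal (kernel S (?U u (M u)) (\<rho> u)) S" if "u \<in> \<Omega>" for u
      by (rule group_hom.normal_kernel[OF gh[OF that]])
    have Q_iff: "x \<in> Q \<longleftrightarrow> x \<in> C \<and> (\<forall>u\<in>\<Omega>. x \<in> kernel S (?U u (M u)) (\<rho> u))" for x
      using Cc by (auto simp: Q_def kernel_def)
    show "subgroup Q S"
    proof
      show "Q \<subseteq> carrier S" using Cc by (auto simp: Q_def)
      show "\<one> \<in> Q"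
        using subgroup.one_closed[OF Cs] subgroup.one_closed[OF normal_imp_subgroup[OF ker]] by (simp add: Q_iff)
      show "x \<otimes> y \<in> Q" if "x \<in> Q" "y \<in> Q" for x y
        using that subgroup.m_closed[OF Cs] subgroup.m_closed[OF normal_imp_subgroup[OF ker]] by (simp add: Q_iff)
      show "inv x \<in> Q" if "x \<in> Q" for x
        using that subgroup.m_inv_closed[OF Cs] subgroup.m_inv_closed[OF normal_imp_subgroup[OF ker]] by (simp add: Q_iff)
    qed
    fix g x assume "g \<in> carrier S" "x \<in> Q"
    then show "g \<otimes> x \<otimes> inv g \<in> Q"
      using normal.inv_op_closed2[OF C(2)] normal.inv_op_closed2[OF ker] by (simp add: Q_iff)
  qed
  have Y0_carrier: "y \<in> carrier S" if "y \<in> Y0" for y using that Y_carrier by (auto simp: Y0_def)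
  define \<gamma> where "\<gamma> w = (inv_into Y0 \<iota> (hd w), 1 + letter (hd w))" for w
  define W where "W = (\<lambda>i. [i]) ` {0..<card Y0}"
  have \<iota>_inv: "inv_into Y0 \<iota> i \<in> Y0" "\<iota> (inv_into Y0 \<iota> i) = i" if "i \<in> {0..<card Y0}" for i
    using \<iota> that by (auto simp: bij_betw_def intro: inv_into_into f_inv_into_f)
  have good: "E.good W \<gamma>"
    unfolding E.good_def
  proof (intro conjI ballI)
    show "code W" unfolding W_def by (rule code_singletons)
    show "W \<subseteq> ?L" by (auto simp: W_def B_def)
    fix w assume "w \<in> W"
    then obtain i where i: "w = [i]" "i \<in> {0..<card Y0}" by (auto simp: W_def)
    show "length w < n" using True i by simp
    have "int p ^ (v 0 * (1 - length u)) dvd cf (letter i) u" for u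
      by (cases u) (simp_all add: letter_def)
    then have "letter i \<in> adic p ?L (\<lambda>d. v 0 * (1 - d))" by (simp add: adic_def)
    then show "\<gamma> w \<in> ?F (length w)"
      using F(2) Y0_carrier[OF \<iota>_inv(1)[OF i(2)]] by (simp add: \<gamma>_def i(1) cf_one letter_def)
    show "lead B (snd (\<gamma> w) - 1) w" by (simp add: \<gamma>_def i(1) lead_letter)
  qed
  define \<Gamma> where "\<Gamma> = generate ?P (\<gamma> ` W)"
  have gamma_carrier: "\<gamma> ` W \<subseteq> carrier ?P"
  proof
    fix z assume "z \<in> \<gamma> ` W"
    then obtain w where w: "w \<in> W" "z = \<gamma> w" by blast
    have "\<forall>w\<in>W. length w < n \<and> \<gamma> w \<in> ?F (length w) \<and> lead B (snd (\<gamma> w) - 1) w"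
      using good unfolding E.good_def by (elim conjE)
    from this[THEN bspec, OF w(1)] have "\<gamma> w \<in> ?F (length w)" by (elim conjE)
    then show "z \<in> carrier ?P" unfolding w(2) by (rule E.F_carr)
  qed
  have Gsub: "subgroup \<Gamma> ?P" unfolding \<Gamma>_def by (rule E.generate_is_subgroup[OF gamma_carrier])
  have fst_hom: "group_hom ?P S fst"
    using E.is_group is_group by (auto simp: group_hom_def group_hom_axioms_def hom_def simps(1,2))
  have fst_sub: "subgroup (fst ` \<Gamma>) S"
    by (rule group_hom.subgroup_img_is_subgroup[OF fst_hom Gsub])
  \<comment> \<open>Both sides are homomorphisms on \<open>S \<times>\<times> magnus\<close>, so
    they are compared on the generators of \<open>\<Gamma>\<close>.\<close>
  have word: "\<rho> u (fst g) = word_matrix (M u) u (int p ^ v (length u)) (snd g)"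
    if u: "u \<in> \<Omega>" and g: "g \<in> \<Gamma>" for u g
  proof -
    let ?w = "word_matrix (M u) u (int p ^ v (length u))"
    have h1: "group_hom ?P (?U u (M u)) (\<lambda>g. \<rho> u (fst g))"
      using E.is_group gU[OF u] rho[OF u] hom_mult[of "\<rho> u" S "?U u (M u)"] hom_in_carrier[of "\<rho> u" S "?U u (M u)"]
      by (auto simp: group_hom_def group_hom_axioms_def simps(1,2) intro!: homI)
    have h2: "group_hom ?P (?U u (M u)) (\<lambda>g. ?w (snd g))"
      using E.is_group gU[OF u] word_matrix_mult[OF q1[OF u]] word_matrix_carrier[OF q1[OF u]]
      by (auto simp: group_hom_def group_hom_axioms_def simps(1,2) intro!: homI)
    have base: "\<rho> u (fst g) = ?w (snd g)" if gW: "g \<in> \<gamma> ` W" for g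
    proof -
      obtain i where i: "g = \<gamma> [i]" "i \<in> {0..<card Y0}" using gW by (auto simp: W_def)
      have "f (fst g) = snd g" using \<iota>_inv[OF i(2)] by (simp add: f_def \<gamma>_def i(1))
      moreover have "fst g \<in> Y" using \<iota>_inv(1)[OF i(2)] by (simp add: \<gamma>_def i(1) Y0_def)
      ultimately show ?thesis using rho[OF u] by simp
    qed
    show ?thesis
      using g unfolding \<Gamma>_def
    proof induction
      case one
      then show ?case using group_hom.hom_one[OF h1] group_hom.hom_one[OF h2] by simp
    next
      case (incl g)
      then show ?case by (rule base)
    next
      case (inv g)
      then have "g \<in> carrier ?P" using gamma_carrier by blast
      then show ?case
        using group_hom.hom_inv[OF h1, of g] group_hom.hom_inv[OF h2, of g] base[OF inv] by simp
    next
      case (eng g g')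
      then have "g \<in> carrier ?P" "g' \<in> carrier ?P"
        using E.generate_in_carrier[OF gamma_carrier] by auto
      then show ?case
        using group_hom.hom_mult[OF h1, of g g'] group_hom.hom_mult[OF h2, of g g'] eng by simp
    qed
  qed
  \<comment> \<open>The form in which topological generation is used: \<open>\<Gamma>\<close> meets
    every coset of \<open>Q\<close>.\<close>
  have "Q <#> fst ` \<Gamma> = carrier S"
  proof (rule generation[OF Q_open Q_normal])
    show "subgroup (Q <#> fst ` \<Gamma>) S" by (rule mult_norm_subgroup[OF Q_normal fst_sub])
    have one: "\<one> \<in> fst ` \<Gamma>" "\<one> \<in> Q"
      using subgroup.one_closed[OF fst_sub] subgroup.one_closed[OF normal_imp_subgroup[OF Q_normal]] by auto
    have Qc: "x \<in> carrier S" if "x \<in> Q" for x using that Cc by (simp add: Q_def)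
    have Q_incl: "x \<in> Q <#> fst ` \<Gamma>" if "x \<in> Q" for x
      using that one(1) Qc[OF that] unfolding set_mult_def by force
    then show "Q \<subseteq> Q <#> fst ` \<Gamma>" by blast
    show "Y \<subseteq> Q <#> fst ` \<Gamma>"
    proof
      fix y assume y: "y \<in> Y"
      show "y \<in> Q <#> fst ` \<Gamma>"
      proof (cases "y \<in> Y0")
        case True
        then have "\<iota> y \<in> {0..<card Y0}" using \<iota> by (auto simp: bij_betw_def)
        then have "[\<iota> y] \<in> W" by (simp add: W_def)
        then have "\<gamma> [\<iota> y] \<in> \<Gamma>" unfolding \<Gamma>_def by (intro generate.incl imageI)
        moreover have "fst (\<gamma> [\<iota> y]) = y"
          using \<iota> True by (simp add: \<gamma>_def bij_betw_def inv_into_f_f)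
        ultimately have "y \<in> fst ` \<Gamma>" by force
        then show ?thesis using one(2) Y0_carrier[OF True] unfolding set_mult_def by force
      next
        \<comment> \<open>Generators inside \<open>C\<close> have the series 1, so every
          \<open>\<rho> u\<close> is trivial on them.\<close>
        case False
        then have yC: "y \<in> C" using y by (simp add: Y0_def)
        have "\<rho> u y = \<one>\<^bsub>?U u (M u)\<^esub>" if "u \<in> \<Omega>" for u
          using rho[OF that] y False word_matrix_one[OF q1[OF that]] by (simp add: f_def)
        then show ?thesis using yC by (intro Q_incl) (simp add: Q_def)
      qed
    qed
  qed
  then obtain k g where k: "k \<in> Q" "g \<in> \<Gamma>" "s = k \<otimes> fst g"
    using s unfolding set_mult_def by blast
  have gP: "g \<in> carrier ?P" using subgroup.mem_carrier[OF Gsub k(2)] .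
  have kC: "k \<in> C" using k(1) by (simp add: Q_def)
  have gc: "fst g \<in> carrier S" "cf (snd g) [] = 1" using gP by (auto simp: simps(1))
  have "snd g - 1 \<in> adic p ?L v"
    unfolding adic_def
  proof (intro CollectI ballI)
    fix u assume uL: "u \<in> ?L"
    show "int p ^ v (length u) dvd cf (snd g - 1) u"
    proof (cases "u \<in> \<Omega>")
      case True
      note r = rho[OF True]
      have "\<rho> u s = \<rho> u k \<otimes>\<^bsub>?U u (M u)\<^esub> \<rho> u (fst g)"
        using hom_mult[of "\<rho> u" S "?U u (M u)" k "fst g"] r Cc[OF kC] gc(1) k(3) by simp
      moreover have "\<rho> u k = \<one>\<^bsub>?U u (M u)\<^esub>" using k(1) True by (simp add: Q_def)
      moreover have "\<rho> u (fst g) \<in> carrier (?U u (M u))"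
        using hom_in_carrier[of "\<rho> u" S "?U u (M u)"] r gc(1) by blast
      ultimately have "\<rho> u (fst g) = \<one>\<^bsub>?U u (M u)\<^esub>"
        using r monoid.l_one[OF group.is_monoid[OF gU[OF True]]] by simp
      \<comment> \<open>The entry in row 0 and column \<open>length u\<close> is the coefficient at
        the whole word \<open>u\<close>.\<close>
      then have "word_matrix (M u) u (int p ^ v (length u)) (snd g) 0 (length u) = \<one>\<^bsub>?U u (M u)\<^esub> 0 (length u)"
        using word[OF True k(2)] by simp
      moreover have "0 < length u" "length u < M u" using True r by (auto simp: \<Omega>_def)
      ultimately have "cf (snd g) u mod int p ^ v (length u) = 0"
        by (simp add: word_matrix_def unitri_residue_simps)
      moreover have "u \<noteq> []" using \<open>0 < length u\<close> by auto
      ultimately show ?thesis by (simp add: cf_one dvd_eq_mod_eq_0)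
    next
      case False
      then consider "u = []" | "v (length u) = 0"
        using uL v(2)[of "length u"] by (cases u) (auto simp: \<Omega>_def not_less)
      then show ?thesis using gc(2) by cases (simp_all add: cf_one)
    qed
  qed
  moreover have "g \<in> generate ?P (\<gamma> ` W \<union> ?D)"
    using k(2) E.mono_generate[of "\<gamma> ` W" "\<gamma> ` W \<union> ?D"] unfolding \<Gamma>_def by blast
  ultimately have "g \<in> ?C" using E.generate_imp_C[OF good] by blast
  then have "fst g \<in> C" by auto
  then show ?thesis unfolding k(3) by (rule subgroup.m_closed[OF Cs kC])
qed

end

section \<open>Unitriangular groups over the p-adic integers\<close>

lemma padic_simps:
  "a \<in> carrier (padic_int p) \<longleftrightarrow> (\<forall>k. 0 \<le> a k \<and> a k < int p ^ k \<and> a (Suc k) mod (int p ^ k) = a k)"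
  "(a \<otimes>\<^bsub>padic_int p\<^esub> b) k = (a k * b k) mod int p ^ k"
  "(a \<oplus>\<^bsub>padic_int p\<^esub> b) k = (a k + b k) mod int p ^ k"
  "\<one>\<^bsub>padic_int p\<^esub> k = 1 mod int p ^ k" "\<zero>\<^bsub>padic_int p\<^esub> k = 0"
  by (simp_all add: padic_int_def)

lemma mod_power_Suc_mod: "x mod int p ^ Suc k mod int p ^ k = x mod int p ^ k"
  by (rule mod_mod_cancel) (simp add: le_imp_power_dvd)

lemma padic_add_closed:
  assumes p: "0 < p" and a: "a \<in> carrier (padic_int p)" and b: "b \<in> carrier (padic_int p)"
  shows "a \<oplus>\<^bsub>padic_int p\<^esub> b \<in> carrier (padic_int p)"
  unfolding padic_simps(1,3)
proof (intro allI conjI)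
  fix k
  have pk: "0 < int p ^ k" using p by simp
  show "0 \<le> (a k + b k) mod int p ^ k" "(a k + b k) mod int p ^ k < int p ^ k" using pk by simp_all
  have "a (Suc k) mod int p ^ k = a k" "b (Suc k) mod int p ^ k = b k" using a b by (simp_all add: padic_simps(1))
  then show "(a (Suc k) + b (Suc k)) mod int p ^ Suc k mod int p ^ k = (a k + b k) mod int p ^ k"
    unfolding mod_power_Suc_mod by (metis mod_add_eq)
qed

lemma padic_mult_closed:
  assumes p: "0 < p" and a: "a \<in> carrier (padic_int p)" and b: "b \<in> carrier (padic_int p)"
  shows "a \<otimes>\<^bsub>padic_int p\<^esub> b \<in> carrier (padic_int p)"
  unfolding padic_simps(1,2)
proof (intro allI conjI)
  fix k
  have pk: "0 < int p ^ k" using p by simp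
  show "0 \<le> (a k * b k) mod int p ^ k" "(a k * b k) mod int p ^ k < int p ^ k" using pk by simp_all
  have "a (Suc k) mod int p ^ k = a k" "b (Suc k) mod int p ^ k = b k" using a b by (simp_all add: padic_simps(1))
  then show "(a (Suc k) * b (Suc k)) mod int p ^ Suc k mod int p ^ k = (a k * b k) mod int p ^ k"
    unfolding mod_power_Suc_mod by (metis mod_mult_eq)
qed

lemma abelian_monoid_padic:
  assumes p: "0 < p"
  shows "abelian_monoid (padic_int p)"
proof (rule abelian_monoidI)
  show "\<zero>\<^bsub>padic_int p\<^esub> \<in> carrier (padic_int p)" using p by (simp add: padic_simps)
  fix a assume a: "a \<in> carrier (padic_int p)"
  show "\<zero>\<^bsub>padic_int p\<^esub> \<oplus>\<^bsub>padic_int p\<^esub> a = a"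
    using a by (intro ext) (simp add: padic_simps)
  fix b assume "b \<in> carrier (padic_int p)"
  show "a \<oplus>\<^bsub>padic_int p\<^esub> b \<in> carrier (padic_int p)" by (rule padic_add_closed) fact+
  show "a \<oplus>\<^bsub>padic_int p\<^esub> b = b \<oplus>\<^bsub>padic_int p\<^esub> a"
    by (intro ext) (simp add: padic_simps add.commute)
  fix c
  show "a \<oplus>\<^bsub>padic_int p\<^esub> b \<oplus>\<^bsub>padic_int p\<^esub> c = a \<oplus>\<^bsub>padic_int p\<^esub> (b \<oplus>\<^bsub>padic_int p\<^esub> c)"
    by (intro ext) (simp add: padic_simps mod_add_left_eq mod_add_right_eq add.assoc)
qed

lemma finsum_padic:
  assumes p: "0 < p" and "finite I" "\<And>i. i \<in> I \<Longrightarrow> f i \<in> carrier (padic_int p)"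
  shows "finsum (padic_int p) f I k = (\<Sum>i\<in>I. f i k) mod int p ^ k"
  using assms(2,3)
proof (induction rule: finite_induct)
  case empty
  show ?case by (simp add: abelian_monoid.finsum_empty[OF abelian_monoid_padic[OF p]] padic_simps)
next
  case (insert x I)
  have "finsum (padic_int p) f (insert x I) = f x \<oplus>\<^bsub>padic_int p\<^esub> finsum (padic_int p) f I"
    using insert by (intro abelian_monoid.finsum_insert[OF abelian_monoid_padic[OF p]]) auto
  then show ?case
    using insert by (simp add: padic_simps mod_add_right_eq)
qed

lemma unitri_padic_mult:
  assumes p: "0 < p" and A: "A \<in> carrier (unitri (padic_int p) m)" and B: "B \<in> carrier (unitri (padic_int p) m)"
    and ij: "i < m" "j < m"
  shows "(A \<otimes>\<^bsub>unitri (padic_int p) m\<^esub> B) i j k = (\<Sum>l<m. A i l k * B l j k) mod int p ^ k"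
proof -
  have c: "A i l \<otimes>\<^bsub>padic_int p\<^esub> B l j \<in> carrier (padic_int p)" if "l \<in> {..<m}" for l
    using A B ij that by (intro padic_mult_closed[OF p]) (simp_all add: unitri_def)
  have "finsum (padic_int p) (\<lambda>l. A i l \<otimes>\<^bsub>padic_int p\<^esub> B l j) {..<m} k =
      (\<Sum>l<m. (A i l k * B l j k) mod int p ^ k) mod int p ^ k"
    using finsum_padic[where I = "{..<m}" and f = "\<lambda>l. A i l \<otimes>\<^bsub>padic_int p\<^esub> B l j", OF p _ c, of k]
    by (simp add: padic_simps)
  then show ?thesis
    using ij by (simp add: unitri_def mod_sum_eq)
qed

lemma hom_compose_fun: "f \<in> hom G H \<Longrightarrow> g \<in> hom H K \<Longrightarrow> (\<lambda>x. g (f x)) \<in> hom G K"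
  by (auto simp: hom_def Pi_iff)

definition reduce :: "nat \<Rightarrow> (nat \<Rightarrow> nat \<Rightarrow> nat \<Rightarrow> int) \<Rightarrow> nat \<Rightarrow> nat \<Rightarrow> int" where
  "reduce k A = (\<lambda>i j. A i j k)"

lemma one_mod_prime_power: "Factorial_Ring.prime p \<Longrightarrow> 1 \<le> k \<Longrightarrow> 1 < int p ^ k"
  using prime_gt_1_nat[of p] by (simp add: one_less_power)

lemma reduce_carrier:
  assumes p: "Factorial_Ring.prime p" and k: "1 \<le> k" and A: "A \<in> carrier (unitri (padic_int p) m)"
  shows "reduce k A \<in> carrier (UT (int p ^ k) m)"
  unfolding unitri_residue_simps reduce_def
proof (intro CollectI allI conjI impI)
  fix i j
  show "0 \<le> A i j k" "A i j k < int p ^ k" if "i < m \<and> j < m"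
    using A that by (simp_all add: unitri_def padic_simps(1))
  show "A i j k = 0" if "i < m \<and> j < i" using A that by (simp add: unitri_def padic_simps)
  show "A i i k = 1" if "i < m"
    using A that one_mod_prime_power[OF p k] by (simp add: unitri_def padic_simps)
  show "A i j k = 0" if "\<not> (i < m \<and> j < m)"
  proof -
    have "A i j = \<zero>\<^bsub>padic_int p\<^esub>" using A that unfolding unitri_def by simp
    then show ?thesis by (simp add: padic_simps)
  qed
qed

lemma reduce_hom:
  assumes p: "Factorial_Ring.prime p" and k: "1 \<le> k"
  shows "reduce k \<in> hom (unitri (padic_int p) m) (UT (int p ^ k) m)"
proof (rule homI)
  fix A B assume A: "A \<in> carrier (unitri (padic_int p) m)" and B: "B \<in> carrier (unitri (padic_int p) m)"
  show "reduce k (A \<otimes>\<^bsub>unitri (padic_int p) m\<^esub> B) =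
      reduce k A \<otimes>\<^bsub>UT (int p ^ k) m\<^esub> reduce k B"
  proof (intro ext)
    fix i j
    show "reduce k (A \<otimes>\<^bsub>unitri (padic_int p) m\<^esub> B) i j =
      (reduce k A \<otimes>\<^bsub>UT (int p ^ k) m\<^esub> reduce k B) i j"
    proof (cases "i < m \<and> j < m")
      case True
      then show ?thesis
        using unitri_padic_mult[OF prime_gt_0_nat[OF p] A B, of i j k]
          unitri_residue_mult_full[OF one_mod_prime_power[OF p k], of i m j]
        by (simp add: reduce_def)
    next
      case False
      have "(A \<otimes>\<^bsub>unitri (padic_int p) m\<^esub> B) i j = \<zero>\<^bsub>padic_int p\<^esub>"
        by (simp only: unitri_def monoid.simps False if_False)
      then show ?thesis
        by (simp add: reduce_def padic_simps unitri_residue_mult_outside[OF False])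
    qed
  qed
qed (rule reduce_carrier[OF p k])

lemma reduce_one:
  assumes "Factorial_Ring.prime p" "1 \<le> k"
  shows "reduce k \<one>\<^bsub>unitri (padic_int p) m\<^esub> = \<one>\<^bsub>UT (int p ^ k) m\<^esub>"
  unfolding reduce_def unitri_residue_simps
  using one_mod_prime_power[OF assms] by (auto simp: unitri_def padic_simps fun_eq_iff)

lemma (in topgroup) continuous_reduce:
  assumes p: "Factorial_Ring.prime p" and k: "1 \<le> k"
    and hom: "\<rho> \<in> hom S (unitri (padic_int p) m)" and cont: "continuous_map T (padic_unitri_topology p m) \<rho>"
  shows "dcont T (UT (int p ^ k) m) (\<lambda>x. reduce k (\<rho> x))"
proof (rule continuous_discreteI)
  have rc: "\<rho> x \<in> carrier (unitri (padic_int p) m)" if "x \<in> carrier S" for x using hom_in_carrier[OF hom that] .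
  then show "reduce k (\<rho> x) \<in> carrier (UT (int p ^ k) m)" if "x \<in> carrier S" for x
    using reduce_carrier[OF p k] that by blast
  fix A :: "nat \<Rightarrow> nat \<Rightarrow> int"
  show "openin T {x \<in> carrier S. reduce k (\<rho> x) = A}"
  proof (cases "\<exists>y\<in>carrier S. reduce k (\<rho> y) = A")
    case True
    then obtain y where y: "y \<in> carrier S" "reduce k (\<rho> y) = A" by blast
    let ?V = "{M \<in> carrier (unitri (padic_int p) m). \<forall>i<m. \<forall>j<m. M i j k = \<rho> y i j k}"
    have "openin (padic_unitri_topology p m) ?V"
      unfolding padic_unitri_topology_def using rc[OF y(1)] by (intro topology_generated_by_Basis) blast
    then have "openin T {x \<in> carrier S. \<rho> x \<in> ?V}" by (rule openin_preimage[OF cont])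
    moreover have "reduce k (\<rho> x) = A \<longleftrightarrow> \<rho> x \<in> ?V" if x: "x \<in> carrier S" for x
    proof
      assume "reduce k (\<rho> x) = A"
      then have "\<rho> x i j k = \<rho> y i j k" for i j using y(2) unfolding reduce_def by metis
      then show "\<rho> x \<in> ?V" using rc[OF x] by simp
    next
      assume V: "\<rho> x \<in> ?V"
      have "reduce k (\<rho> x) i j = reduce k (\<rho> y) i j" for i j
      proof (cases "i < m \<and> j < m")
        case False
        then show ?thesis
          using unitri_residueD(5)[OF reduce_carrier[OF p k rc[OF x]] False]
            unitri_residueD(5)[OF reduce_carrier[OF p k rc[OF y(1)]] False] by simp
      qed (use V in \<open>simp add: reduce_def\<close>)
      then show "reduce k (\<rho> x) = A" unfolding y(2)[symmetric] by blast
    qed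
    then have "{x \<in> carrier S. reduce k (\<rho> x) = A} = {x \<in> carrier S. \<rho> x \<in> ?V}" by blast
    ultimately show ?thesis by simp
  next
    case False
    then have "{x \<in> carrier S. reduce k (\<rho> x) = A} = {}" by blast
    then show ?thesis by (simp only: openin_empty)
  qed
qed

text \<open>Tested modulo each \<open>p ^ k\<close>, with \<open>e = c = k\<close>: then
  \<open>weight n d = k\<close> at all distances \<open>d < n\<close>, so the whole matrix is
  trivial modulo \<open>p ^ k\<close>.\<close>

lemma (in topgroup) lower_central_padic:
  assumes p: "Factorial_Ring.prime p" and n: "1 \<le> n" and x: "x \<in> lower_central S T n"
    and hom: "\<rho> \<in> hom S (unitri (padic_int p) n)" and cont: "continuous_map T (padic_unitri_topology p n) \<rho>"
  shows "\<rho> x = \<one>\<^bsub>unitri (padic_int p) n\<^esub>"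
proof (intro ext)
  fix i j k
  have xc: "x \<in> carrier S" using x cnormal_mem(4)[OF cnormal_lower_central] by blast
  have rc: "\<rho> x \<in> carrier (unitri (padic_int p) n)" by (rule hom_in_carrier[OF hom xc])
  show "\<rho> x i j k = \<one>\<^bsub>unitri (padic_int p) n\<^esub> i j k"
  proof (cases "k = 0")
    case True
    \<comment> \<open>Component 0 of a p-adic integer is a residue modulo
      \<open>p ^ 0 = 1\<close>.\<close>
    have "\<rho> x i j 0 = 0"
    proof (cases "i < n \<and> j < n")
      case True
      then have "\<rho> x i j \<in> carrier (padic_int p)" using rc by (simp add: unitri_def)
      then have "\<forall>k. 0 \<le> \<rho> x i j k \<and> \<rho> x i j k < int p ^ k \<and> \<rho> x i j (Suc k) mod int p ^ k = \<rho> x i j k"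
        unfolding padic_simps(1) .
      from this[rule_format, of 0] show ?thesis by simp
    next
      case False
      then have "\<rho> x i j = \<zero>\<^bsub>padic_int p\<^esub>" using rc unfolding unitri_def by simp
      then show ?thesis by (simp add: padic_simps)
    qed
    then show ?thesis using True by (simp add: unitri_def padic_simps)
  next
    case False
    then have k: "1 \<le> k" by simp
    have hk: "(\<lambda>x. reduce k (\<rho> x)) \<in> hom S (UT (int p ^ k) n)"
      by (rule hom_compose_fun[OF hom reduce_hom[OF p k]])
    interpret unitri_rep S T p k k n "\<lambda>x. reduce k (\<rho> x)"
      by unfold_locales (use p k hk continuous_reduce[OF p k hom cont] in auto)
    have "x \<in> fil n" using lower_central_fil[OF n] x by blast
    moreover have "k \<le> weight n d" if "1 \<le> d" "d < n" for d
    proof -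
      have "k * 1 \<le> k * (n - d)" using that by (intro mult_le_mono2) simp
      then show ?thesis unfolding weight_def by simp
    qed
    ultimately have "reduce k (\<rho> x) = \<one>\<^bsub>UT (int p ^ k) n\<^esub>" by (rule fil_kernel)
    then have "reduce k (\<rho> x) i j = reduce k \<one>\<^bsub>unitri (padic_int p) n\<^esub> i j"
      by (simp only: reduce_one[OF p k])
    then show ?thesis by (simp only: reduce_def)
  qed
qed

context free_pro_p
begin

section \<open>Representations with prescribed word matrices\<close>

lemma card_unitri:
  assumes "1 \<le> e"
  shows "\<exists>N. card (carrier (UT (int p ^ e) m)) = p ^ N"
proof -
  have "nat (int p ^ e) = p ^ e" by (simp add: nat_power_eq)
  then have "card (carrier (UT (int p ^ e) m)) = p ^ (e * card {(i, j). i < j \<and> j < m})"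
    using card_unitri_residue(2)[OF one_mod_prime_power[OF prime assms], of m] by (simp add: power_mult)
  then show ?thesis by blast
qed

lemma word_representation:
  assumes e: "1 \<le> e" and f: "\<And>y. cf (f y) [] = 1" "finite {y\<in>Y. f y \<noteq> 1}"
  obtains \<rho> where "\<rho> \<in> hom S (UT (int p ^ e) m)"
    "dcont T (UT (int p ^ e) m) \<rho>"
    "\<And>y. y \<in> Y \<Longrightarrow> \<rho> y = word_matrix m u (int p ^ e) (f y)"
proof -
  let ?U = "UT (int p ^ e) m"
  note q1 = one_mod_prime_power[OF prime e]
  obtain N where N: "card (carrier ?U) = p ^ N" using card_unitri[OF e] by blast
  have "finite {y\<in>Y. word_matrix m u (int p ^ e) (f y) \<noteq> \<one>\<^bsub>?U\<^esub>}"
    by (rule finite_subset[OF _ f(2)]) (auto simp: word_matrix_one[OF q1])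
  from universal_general[OF group_unitri_residue[OF q1] card_unitri_residue(1)[OF q1] N
      word_matrix_carrier[OF q1 f(1)] this]
  show thesis using that by (elim exE conjE) simp
qed

text \<open>The universal property speaks of finite targets, so it is applied modulo each
  \<open>p ^ k\<close>. Uniqueness makes the resulting homomorphisms compatible, and
  \<open>\<rho>\<close> is their inverse limit.\<close>

lemma padic_word_representation:
  assumes e: "1 \<le> e" and f: "\<And>y. cf (f y) [] = 1" "finite {y\<in>Y. f y \<noteq> 1}"
  obtains \<rho> where "\<rho> \<in> hom S (unitri (padic_int p) m)" "continuous_map T (padic_unitri_topology p m) \<rho>"
    "\<And>y. y \<in> Y \<Longrightarrow> reduce e (\<rho> y) = word_matrix m u (int p ^ e) (f y)"
proof -
  let ?U = "\<lambda>k. UT (int p ^ k) m"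
  have p0: "0 < p" by (rule prime_gt_0_nat[OF prime])
  have "\<forall>k\<in>{1..}. \<exists>\<phi>. \<phi> \<in> hom S (?U k) \<and> dcont T (?U k) \<phi> \<and>
      (\<forall>y\<in>Y. \<phi> y = word_matrix m u (int p ^ k) (f y))"
  proof
    fix k :: nat assume "k \<in> {1..}"
    then have "1 \<le> k" by simp
    from word_representation[where m = m and u = u, OF this f]
    show "\<exists>\<phi>. \<phi> \<in> hom S (?U k) \<and> dcont T (?U k) \<phi> \<and>
      (\<forall>y\<in>Y. \<phi> y = word_matrix m u (int p ^ k) (f y))" by metis
  qed
  from bchoice[OF this] obtain \<phi> where "\<forall>k\<in>{1..}. \<phi> k \<in> hom S (?U k) \<and>
      dcont T (?U k) (\<phi> k) \<and>
      (\<forall>y\<in>Y. \<phi> k y = word_matrix m u (int p ^ k) (f y))" by (rule exE)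
  then have hom: "\<phi> k \<in> hom S (?U k)" and cont: "dcont T (?U k) (\<phi> k)"
    and val: "\<And>y. y \<in> Y \<Longrightarrow> \<phi> k y = word_matrix m u (int p ^ k) (f y)" if "1 \<le> k" for k
    using that by auto
  note q1 = one_mod_prime_power[OF prime]
  have carr: "\<phi> k x \<in> carrier (?U k)" if "1 \<le> k" "x \<in> carrier S" for k x
    using hom_in_carrier[OF hom[OF that(1)] that(2)] .
  have compat: "\<phi> (Suc k) x i j mod int p ^ k = \<phi> k x i j" if k: "1 \<le> k" and x: "x \<in> carrier S" for k x i j
  proof -
    define r where "r A = (\<lambda>i j. A i j mod int p ^ k)" for A :: "nat \<Rightarrow> nat \<Rightarrow> int"
    have Sk: "1 \<le> Suc k" by simp
    have r: "r \<in> hom (?U (Suc k)) (?U k)"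
    proof (rule homI)
      fix A assume A: "A \<in> carrier (?U (Suc k))"
      show "r A \<in> carrier (?U k)"
        unfolding unitri_residue_simps r_def
      proof (intro CollectI allI conjI impI)
        fix i j
        show "0 \<le> A i j mod int p ^ k" "A i j mod int p ^ k < int p ^ k" using p0 by simp_all
        show "A i j mod int p ^ k = 0" if "i < m \<and> j < i" using unitri_residueD(3)[OF A, of i j] that by simp
        show "A i i mod int p ^ k = 1" if "i < m" using unitri_residueD(4)[OF A that] q1[OF k] by simp
        show "A i j mod int p ^ k = 0" if "\<not> (i < m \<and> j < m)" using unitri_residueD(5)[OF A that] by simp
      qed
      fix B
      show "r (A \<otimes>\<^bsub>?U (Suc k)\<^esub> B) = r A \<otimes>\<^bsub>?U k\<^esub> r B"
      proof (intro ext)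
        fix i j
        show "r (A \<otimes>\<^bsub>?U (Suc k)\<^esub> B) i j = (r A \<otimes>\<^bsub>?U k\<^esub> r B) i j"
        proof (cases "i < m \<and> j < m")
          case True
          then have ij: "i < m" "j < m" by auto
          have "r (A \<otimes>\<^bsub>?U (Suc k)\<^esub> B) i j = (\<Sum>l<m. A i l * B l j) mod int p ^ k"
            unfolding r_def unitri_residue_mult_full[OF q1[OF Sk] ij] by (rule mod_power_Suc_mod)
          also have "\<dots> = (\<Sum>l<m. r A i l * r B l j) mod int p ^ k"
            unfolding r_def by (subst (1 2) mod_sum_eq[symmetric]) (simp add: mod_mult_eq)
          also have "\<dots> = (r A \<otimes>\<^bsub>?U k\<^esub> r B) i j"
            by (rule unitri_residue_mult_full[OF q1[OF k] ij, symmetric])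
          finally show ?thesis .
        next
          case False
          then show ?thesis by (simp add: r_def unitri_residue_mult_outside[OF False])
        qed
      qed
    qed
    obtain N where N: "card (carrier (?U k)) = p ^ N" using card_unitri[OF k] by blast
    have "r (\<phi> (Suc k) x) = \<phi> k x"
    proof (rule hom_eqI[OF group_unitri_residue[OF q1[OF k]] card_unitri_residue(1)[OF q1[OF k]] N _ _ hom[OF k] cont[OF k] _ x])
      show rhom: "(\<lambda>x. r (\<phi> (Suc k) x)) \<in> hom S (?U k)"
        by (rule hom_compose_fun[OF hom[OF Sk] r])
      show "dcont T (?U k) (\<lambda>x. r (\<phi> (Suc k) x))"
      proof (rule continuous_discreteI)
        show "openin T {x \<in> carrier S. r (\<phi> (Suc k) x) = a}" for a
          by (rule continuous_discreteD(2)[OF cont[OF Sk]])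
      qed (rule hom_in_carrier[OF rhom])
      fix y assume y: "y \<in> Y"
      have "r (word_matrix m u (int p ^ Suc k) (f y)) = word_matrix m u (int p ^ k) (f y)"
      proof (intro ext)
        fix i j
        have "x mod (int p ^ k * int p) mod int p ^ k = x mod int p ^ k" for x :: int
          by (rule mod_mod_cancel) simp
        then show "r (word_matrix m u (int p ^ Suc k) (f y)) i j = word_matrix m u (int p ^ k) (f y) i j"
          unfolding r_def word_matrix_def using q1[OF k] by (simp add: mult.commute)
      qed
      then show "r (\<phi> (Suc k) y) = \<phi> k y" using val[OF Sk y] val[OF k y] by simp
    qed
    then show ?thesis unfolding r_def by metis
  qed
  \<comment> \<open>Component 0 has to be set by hand, because the \<open>\<phi> k\<close> are
    chosen for \<open>k \<ge> 1\<close>.\<close>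
  define \<rho> where "\<rho> x = (\<lambda>i j k. if k = 0 then 0 else \<phi> k x i j)" for x
  have red: "reduce k (\<rho> x) = \<phi> k x" if "1 \<le> k" for k x using that by (auto simp: reduce_def \<rho>_def)
  have rc: "\<rho> x \<in> carrier (unitri (padic_int p) m)" if x: "x \<in> carrier S" for x
  proof -
    have D: "k \<noteq> 0 \<Longrightarrow> i < m \<Longrightarrow> j < m \<Longrightarrow> 0 \<le> \<phi> k x i j \<and> \<phi> k x i j < int p ^ k"
        "k \<noteq> 0 \<Longrightarrow> i < m \<Longrightarrow> j < i \<Longrightarrow> \<phi> k x i j = 0" "k \<noteq> 0 \<Longrightarrow> i < m \<Longrightarrow> \<phi> k x i i = 1"
        "k \<noteq> 0 \<Longrightarrow> \<not> (i < m \<and> j < m) \<Longrightarrow> \<phi> k x i j = 0" for i j k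
      using unitri_residueD[OF carr[OF _ x], of k] by auto
    have "\<rho> x i j \<in> carrier (padic_int p)" if "i < m" "j < m" for i j
      unfolding padic_simps(1)
    proof (intro allI conjI)
      fix k
      show "0 \<le> \<rho> x i j k" "\<rho> x i j k < int p ^ k" using D(1)[of k i j] that by (auto simp: \<rho>_def)
      show "\<rho> x i j (Suc k) mod int p ^ k = \<rho> x i j k"
        using compat[OF _ x, of k i j] by (cases "k = 0") (simp_all add: \<rho>_def)
    qed
    moreover have "\<rho> x i j = \<zero>\<^bsub>padic_int p\<^esub>" if "i < m" "j < i" for i j
      using D(2)[OF _ that] by (intro ext) (simp add: \<rho>_def padic_simps)
    moreover have "\<rho> x i i = \<one>\<^bsub>padic_int p\<^esub>" if "i < m" for i
      using D(3)[OF _ that] q1 by (intro ext) (simp add: \<rho>_def padic_simps)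
    moreover have "\<rho> x i j = \<zero>\<^bsub>padic_int p\<^esub>" if "\<not> (i < m \<and> j < m)" for i j
      using D(4)[OF _ that] by (intro ext) (simp add: \<rho>_def padic_simps)
    ultimately show ?thesis unfolding unitri_def by simp
  qed
  have rhom: "\<rho> \<in> hom S (unitri (padic_int p) m)"
  proof (rule homI)
    fix x y assume xy: "x \<in> carrier S" "y \<in> carrier S"
    show "\<rho> (x \<otimes> y) = \<rho> x \<otimes>\<^bsub>unitri (padic_int p) m\<^esub> \<rho> y"
    proof (intro ext)
      fix i j k
      show "\<rho> (x \<otimes> y) i j k = (\<rho> x \<otimes>\<^bsub>unitri (padic_int p) m\<^esub> \<rho> y) i j k"
      proof (cases "k = 0")
        case True
        have "(\<rho> x \<otimes>\<^bsub>unitri (padic_int p) m\<^esub> \<rho> y) i j 0 = 0"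
        proof (cases "i < m \<and> j < m")
          case True
          then show ?thesis using unitri_padic_mult[OF p0 rc[OF xy(1)] rc[OF xy(2)], of i j 0] by simp
        next
          case False
          have "(\<rho> x \<otimes>\<^bsub>unitri (padic_int p) m\<^esub> \<rho> y) i j = \<zero>\<^bsub>padic_int p\<^esub>"
            by (simp only: unitri_def monoid.simps False if_False)
          then show ?thesis by (simp add: padic_simps)
        qed
        then show ?thesis using True by (simp add: \<rho>_def)
      next
        case False
        then have k: "1 \<le> k" by simp
        have "reduce k (\<rho> (x \<otimes> y)) = reduce k (\<rho> x) \<otimes>\<^bsub>?U k\<^esub> reduce k (\<rho> y)"
          using hom_mult[OF hom[OF k] xy] by (simp add: red[OF k])
        also have "\<dots> = reduce k (\<rho> x \<otimes>\<^bsub>unitri (padic_int p) m\<^esub> \<rho> y)"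
          using hom_mult[OF reduce_hom[OF prime k] rc[OF xy(1)] rc[OF xy(2)]] by simp
        finally show ?thesis unfolding reduce_def by metis
      qed
    qed
  qed (rule rc)
  moreover have "continuous_map T (padic_unitri_topology p m) \<rho>"
    unfolding padic_unitri_topology_def
  proof (rule continuous_on_generated_topo)
    fix V assume "V \<in> {{A \<in> carrier (unitri (padic_int p) m). \<forall>i<m. \<forall>j<m. A i j k = B i j k} | B k.
          B \<in> carrier (unitri (padic_int p) m)}"
    then obtain B k where V: "V = {A \<in> carrier (unitri (padic_int p) m). \<forall>i<m. \<forall>j<m. A i j k = B i j k}" by blast
    have "\<rho> -` V \<inter> topspace T = {x \<in> carrier S. \<forall>i<m. \<forall>j<m. \<rho> x i j k = B i j k}"
      unfolding V using rc by auto
    also have "openin T \<dots>"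
    proof (cases "k = 0")
      case True
      then have "{x \<in> carrier S. \<forall>i<m. \<forall>j<m. \<rho> x i j k = B i j k} =
          (if \<forall>i<m. \<forall>j<m. 0 = B i j k then carrier S else {})" by (auto simp: \<rho>_def)
      then show ?thesis using openin_topspace[of T] by simp
    next
      case False
      then have "{x \<in> carrier S. \<forall>i<m. \<forall>j<m. \<rho> x i j k = B i j k} =
          {x \<in> carrier S. \<forall>i<m. \<forall>j<m. \<phi> k x i j = B i j k}" by (simp add: \<rho>_def)
      then show ?thesis
        using continuous_discreteD(2)[OF cont, of k "\<lambda>A. \<forall>i<m. \<forall>j<m. A i j = B i j k"] False by simp
    qed
    finally show "openin T (\<rho> -` V \<inter> topspace T)" .
  next
    show "\<rho> ` topspace T \<subseteq> \<Union>{{A \<in> carrier (unitri (padic_int p) m). \<forall>i<m. \<forall>j<m. A i j k = B i j k} | B k.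
          B \<in> carrier (unitri (padic_int p) m)}"
    proof
      fix A assume "A \<in> \<rho> ` topspace T"
      then have A: "A \<in> carrier (unitri (padic_int p) m)" using rc by auto
      then have "A \<in> {A' \<in> carrier (unitri (padic_int p) m). \<forall>i<m. \<forall>j<m. A' i j 0 = A i j 0}" by simp
      then show "A \<in> \<Union>{{A \<in> carrier (unitri (padic_int p) m). \<forall>i<m. \<forall>j<m. A i j k = B i j k} | B k.
          B \<in> carrier (unitri (padic_int p) m)}" using A by blast
    qed
  qed
  moreover have "reduce e (\<rho> y) = word_matrix m u (int p ^ e) (f y)" if "y \<in> Y" for y
    using red[OF e] val[OF e that] by simp
  ultimately show thesis using that by blast
qed

end

section \<open>The three intersection theorems\<close>

context free_pro_p
begin

section \<open>Elements killed by all representations lie in the filtration\<close>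

lemma p2: "2 \<le> p"
  by (rule prime_ge_2_nat[OF prime])

text \<open>A closed normal subgroup of a profinite group is the intersection of the open normal
  subgroups that contain it.\<close>

lemma not_mem_filtration:
  assumes "cnormal F" "s \<in> carrier S" and "\<And>C. openin T C \<Longrightarrow> normal C S \<Longrightarrow> F \<subseteq> C \<Longrightarrow> s \<in> C"
  shows "s \<in> F"
  using exists_open_normal[OF profinite assms(1,2)] assms(3) by blast

text \<open>If \<open>p ^ t\<close> is the exact power of \<open>p\<close> in \<open>a\<close>, then
  \<open>a choose p ^ t\<close> is prime to \<open>p\<close>. The divisibility condition at
  \<open>j = p ^ t\<close> therefore forces \<open>p ^ t * w \<ge> n\<close>, and
  \<open>x [^] (p ^ t)\<close> already lies in the \<open>n\<close>-th term.\<close>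

lemma zassenhaus_detected:
  assumes s: "s \<in> carrier S"
    and ker: "\<And>\<rho>. \<rho> \<in> hom S (UT (int p) n) \<Longrightarrow>
      dcont T (UT (int p) n) \<rho> \<Longrightarrow>
      \<rho> s = \<one>\<^bsub>UT (int p) n\<^esub>"
  shows "s \<in> zassenhaus p S T n"
proof (rule not_mem_filtration[OF cnormal_zassenhaus[OF p2] s])
  fix C assume C: "openin T C" "normal C S" and sub: "zassenhaus p S T n \<subseteq> C"
  have Cs: "subgroup C S" by (rule normal_imp_subgroup[OF C(2)])
  note Zc = cnormal_mem(4)[OF cnormal_zassenhaus[OF p2]]
  show "s \<in> C"
  proof (rule detection[OF C, where F = "zassenhaus p S T" and n = n and v = "\<lambda>d. if d < n then 1 else 0"])
    show "zassenhaus p S T i \<subseteq> carrier S" for i by (rule cnormalD(2)[OF cnormal_zassenhaus[OF p2]])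
    show "zassenhaus p S T 1 = carrier S" by (rule zassenhaus_1) simp
    show "zassenhaus p S T i \<subseteq> C" if "n \<le> i" for i
      using zassenhaus_antimono[OF p2 that] sub by blast
    show "comm S x y \<in> zassenhaus p S T (i + j)"
      if "1 \<le> i" "1 \<le> j" "x \<in> zassenhaus p S T i" "y \<in> zassenhaus p S T j" for i j x y
      by (rule zassenhaus_comm[OF p2 that])
    show "antimono (\<lambda>d. if d < n then 1 else 0 :: nat)" by (auto simp: antimono_def)
    show "s \<in> carrier S" by (rule s)
  next
    fix w x and a :: nat assume w: "1 \<le> w" "x \<in> zassenhaus p S T w"
      and div: "\<And>j. 1 \<le> j \<Longrightarrow> p ^ (if j * w < n then 1 else 0) dvd a choose j"
    have xc: "x \<in> carrier S" using w(2) Zc by blast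
    show "x [^] a \<in> C"
    proof (cases "a = 0")
      case True
      then show ?thesis using subgroup.one_closed[OF Cs] by simp
    next
      case False
      have unit: "\<not> is_unit p" using p2 by simp
      define t where "t = multiplicity p a"
      obtain b where b: "a = p ^ t * b" "\<not> p dvd b"
        using multiplicity_decompose'[OF False unit] unfolding t_def by blast
      have b0: "0 < b" using False b(1) by (cases b) auto
      have "multiplicity p (p ^ t * b choose p ^ t) = 0"
        using const_p_fac[OF b0 prime] b(2) by (simp add: not_dvd_imp_multiplicity_0)
      moreover have "(p ^ t * b choose p ^ t) \<noteq> 0" using b0 by simp
      ultimately have "\<not> p dvd a choose p ^ t"
        unfolding b(1) using unit multiplicity_eq_zero_iff by blast
      moreover have "1 \<le> p ^ t" using p2 by simp
      ultimately have "\<not> p ^ t * w < n" using div[of "p ^ t"] by (auto split: if_splits)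
      then have "x [^] (p ^ t) \<in> C"
        using zassenhaus_pow_power[OF p2 w, of t] zassenhaus_antimono[OF p2, of n "w * p ^ t"] sub
        by (auto simp: mult.commute not_less)
      then have "(x [^] (p ^ t)) [^] b \<in> C" by (rule subgroup_pow[OF Cs])
      then show ?thesis using xc by (simp add: nat_pow_pow b(1))
    qed
  next
    fix u :: "nat list" and f :: "'a \<Rightarrow> ser"
    assume u: "length u < n" and f: "\<And>y. cf (f y) [] = 1" "finite {y\<in>Y. f y \<noteq> 1}"
    obtain \<rho> where rho: "\<rho> \<in> hom S (UT (int p ^ 1) n)"
      "dcont T (UT (int p ^ 1) n) \<rho>"
      "\<And>y. y \<in> Y \<Longrightarrow> \<rho> y = word_matrix n u (int p ^ 1) (f y)"
      using word_representation[where m = n and u = u and e = 1, OF _ f] by (metis order.refl)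
    have "\<rho> s = \<one>\<^bsub>UT (int p ^ 1) n\<^esub>"
      using ker[of \<rho>] rho(1,2) by simp
    then show "\<exists>m \<rho>. length u < m \<and> \<rho> \<in> hom S (UT (int p ^ (if length u < n then 1 else 0)) m) \<and>
        dcont T (UT (int p ^ (if length u < n then 1 else 0)) m) \<rho> \<and>
        (\<forall>y\<in>Y. \<rho> y = word_matrix m u (int p ^ (if length u < n then 1 else 0)) (f y)) \<and>
        \<rho> s = \<one>\<^bsub>UT (int p ^ (if length u < n then 1 else 0)) m\<^esub>"
      unfolding if_P[OF u] using u rho by (intro exI[of _ n] exI[of _ \<rho>]) simp
  qed simp
qed

text \<open>With \<open>p ^ e\<close> the index of \<open>C\<close>, coefficients modulo
  \<open>p ^ e\<close> suffice: below step \<open>n\<close> the condition at \<open>j = 1\<close>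
  makes \<open>p ^ e\<close> divide \<open>a\<close>, and \<open>p ^ e\<close>-th powers lie in
  \<open>C\<close>. The p-adic representations are reduced accordingly.\<close>

lemma lower_central_detected:
  assumes s: "s \<in> carrier S"
    and ker: "\<And>\<rho>. \<rho> \<in> hom S (unitri (padic_int p) n) \<Longrightarrow>
      continuous_map T (padic_unitri_topology p n) \<rho> \<Longrightarrow> \<rho> s = \<one>\<^bsub>unitri (padic_int p) n\<^esub>"
  shows "s \<in> lower_central S T n"
proof (rule not_mem_filtration[OF cnormal_lower_central s])
  fix C assume C: "openin T C" "normal C S" and sub: "lower_central S T n \<subseteq> C"
  have Cs: "subgroup C S" by (rule normal_imp_subgroup[OF C(2)])
  obtain e where e: "card (rcosets C) = p ^ e" using card_index[OF C] .
  show "s \<in> C"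
  proof (rule detection[OF C, where F = "lower_central S T" and n = n and v = "\<lambda>d. if d < n then e else 0"])
    show "lower_central S T i \<subseteq> carrier S" for i by (rule cnormalD(2)[OF cnormal_lower_central])
    show "lower_central S T 1 = carrier S" by simp
    show deep: "lower_central S T i \<subseteq> C" if "n \<le> i" for i
      using lower_central_antimono[OF that] sub by blast
    show "comm S x y \<in> lower_central S T (i + j)"
      if "1 \<le> i" "1 \<le> j" "x \<in> lower_central S T i" "y \<in> lower_central S T j" for i j x y
      by (rule lower_central_comm_general[OF that])
    show "antimono (\<lambda>d. if d < n then e else 0)" by (auto simp: antimono_def)
    show "s \<in> carrier S" by (rule s)
    fix w x and a :: nat assume w: "1 \<le> w" "x \<in> lower_central S T w"
      and div: "\<And>j. 1 \<le> j \<Longrightarrow> p ^ (if j * w < n then e else 0) dvd a choose j"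
    have xc: "x \<in> carrier S" using w(2) cnormal_mem(4)[OF cnormal_lower_central] by blast
    show "x [^] a \<in> C"
    proof (cases "w < n")
      case True
      then have "p ^ e dvd a" using div[of 1] by simp
      then obtain b where b: "a = p ^ e * b" by (elim dvdE)
      have "x [^] (p ^ e) \<in> C" using pow_index_mem[OF C(2) e _ xc] p2 by simp
      then have "(x [^] (p ^ e)) [^] b \<in> C" by (rule subgroup_pow[OF Cs])
      then show ?thesis using xc by (simp add: nat_pow_pow b)
    next
      case False
      then have "x \<in> C" using deep[of w] w(2) by auto
      then show ?thesis by (rule subgroup_pow[OF Cs])
    qed
  next
    fix u :: "nat list" and f :: "'a \<Rightarrow> ser"
    assume u: "length u < n" and "0 < (if length u < n then e else 0)"
      and f: "\<And>y. cf (f y) [] = 1" "finite {y\<in>Y. f y \<noteq> 1}"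
    \<comment> \<open>The premise \<open>0 < v (length u)\<close> of \<open>detection\<close> rules
      out \<open>e = 0\<close>, where the residue ring would be trivial.\<close>
    then have e1: "1 \<le> e" by simp
    obtain \<rho> where rho: "\<rho> \<in> hom S (unitri (padic_int p) n)" "continuous_map T (padic_unitri_topology p n) \<rho>"
      "\<And>y. y \<in> Y \<Longrightarrow> reduce e (\<rho> y) = word_matrix n u (int p ^ e) (f y)"
      using padic_word_representation[where m = n and u = u, OF e1 f] by metis
    have "reduce e (\<rho> s) = \<one>\<^bsub>UT (int p ^ e) n\<^esub>"
      using ker[OF rho(1,2)] reduce_one[OF prime e1] by simp
    then show "\<exists>m \<rho>. length u < m \<and> \<rho> \<in> hom S (UT (int p ^ (if length u < n then e else 0)) m) \<and>
        dcont T (UT (int p ^ (if length u < n then e else 0)) m) \<rho> \<and>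
        (\<forall>y\<in>Y. \<rho> y = word_matrix m u (int p ^ (if length u < n then e else 0)) (f y)) \<and>
        \<rho> s = \<one>\<^bsub>UT (int p ^ (if length u < n then e else 0)) m\<^esub>"
      unfolding if_P[OF u]
      using u rho(3) hom_compose_fun[OF rho(1) reduce_hom[OF prime e1]] continuous_reduce[OF prime e1 rho(1,2)]
      by (intro exI[of _ n] exI[of _ "\<lambda>x. reduce e (\<rho> x)"]) simp
  qed simp
qed

text \<open>The lower central series serves as \<open>F\<close>. It is contained in the p-central
  series, where a \<open>p ^ (n - w)\<close>-th power moves from step \<open>w\<close> to step
  \<open>n\<close>; the condition at \<open>j = 1\<close> provides exactly this exponent. A word of
  length \<open>k\<close> is seen by a matrix of size \<open>k + 1\<close> modulo
  \<open>p ^ (n - k)\<close>.\<close>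

lemma p_central_detected:
  assumes s: "s \<in> carrier S"
    and ker: "\<And>k \<rho>. 1 \<le> k \<Longrightarrow> k \<le> n - 1 \<Longrightarrow> \<rho> \<in> hom S (UT (int p ^ (n - k)) (k + 1)) \<Longrightarrow>
      dcont T (UT (int p ^ (n - k)) (k + 1)) \<rho> \<Longrightarrow>
      \<rho> s = \<one>\<^bsub>UT (int p ^ (n - k)) (k + 1)\<^esub>"
  shows "s \<in> p_central p S T n"
proof (rule not_mem_filtration[OF cnormal_p_central s])
  fix C assume C: "openin T C" "normal C S" and sub: "p_central p S T n \<subseteq> C"
  have Cs: "subgroup C S" by (rule normal_imp_subgroup[OF C(2)])
  show "s \<in> C"
  proof (rule detection[OF C, where F = "lower_central S T" and n = n and v = "\<lambda>d. n - d"])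
    show "lower_central S T i \<subseteq> carrier S" for i by (rule cnormalD(2)[OF cnormal_lower_central])
    show "lower_central S T 1 = carrier S" by simp
    show deep: "lower_central S T i \<subseteq> C" if "n \<le> i" for i
      using lower_central_p_central[of i p] p_central_antimono[OF that, of p] sub by blast
    show "comm S x y \<in> lower_central S T (i + j)"
      if "1 \<le> i" "1 \<le> j" "x \<in> lower_central S T i" "y \<in> lower_central S T j" for i j x y
      by (rule lower_central_comm_general[OF that])
    show "antimono (\<lambda>d. n - d)" by (auto simp: antimono_def)
    show "s \<in> carrier S" by (rule s)
    fix w x and a :: nat assume w: "1 \<le> w" "x \<in> lower_central S T w"
      and div: "\<And>j. 1 \<le> j \<Longrightarrow> p ^ (n - j * w) dvd a choose j"
    have xc: "x \<in> carrier S" using w(2) cnormal_mem(4)[OF cnormal_lower_central] by blast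
    show "x [^] a \<in> C"
    proof (cases "w < n")
      case True
      have "p ^ (n - w) dvd a" using div[of 1] by simp
      then obtain b where b: "a = p ^ (n - w) * b" by (elim dvdE)
      have "x \<in> p_central p S T w" using lower_central_p_central w(2) by blast
      then have "x [^] (p ^ (n - w)) \<in> C"
        using p_central_pow_power[OF w(1), of x p "n - w"] True sub by auto
      then have "(x [^] (p ^ (n - w))) [^] b \<in> C" by (rule subgroup_pow[OF Cs])
      then show ?thesis using xc by (simp add: nat_pow_pow b)
    next
      case False
      then have "x \<in> C" using deep[of w] w(2) by auto
      then show ?thesis by (rule subgroup_pow[OF Cs])
    qed
  next
    fix u :: "nat list" and f :: "'a \<Rightarrow> ser"
    assume u: "1 \<le> length u" "length u < n" and f: "\<And>y. cf (f y) [] = 1" "finite {y\<in>Y. f y \<noteq> 1}"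
    then have e1: "1 \<le> n - length u" by simp
    obtain \<rho> where rho: "\<rho> \<in> hom S (UT (int p ^ (n - length u)) (length u + 1))"
      "dcont T (UT (int p ^ (n - length u)) (length u + 1)) \<rho>"
      "\<And>y. y \<in> Y \<Longrightarrow> \<rho> y = word_matrix (length u + 1) u (int p ^ (n - length u)) (f y)"
      using word_representation[where m = "length u + 1" and u = u, OF e1 f] by metis
    have "\<rho> s = \<one>\<^bsub>UT (int p ^ (n - length u)) (length u + 1)\<^esub>"
      using u by (intro ker rho(1,2)) auto
    then show "\<exists>m \<rho>. length u < m \<and> \<rho> \<in> hom S (UT (int p ^ (n - length u)) m) \<and>
        dcont T (UT (int p ^ (n - length u)) m) \<rho> \<and>
        (\<forall>y\<in>Y. \<rho> y = word_matrix m u (int p ^ (n - length u)) (f y)) \<and>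
        \<rho> s = \<one>\<^bsub>UT (int p ^ (n - length u)) m\<^esub>"
      using rho by (intro exI[of _ "length u + 1"] exI[of _ \<rho>]) simp
  qed simp
qed

section \<open>The filtrations lie in the kernels\<close>

lemma zassenhaus_kernel:
  assumes n: "1 \<le> n" and x: "x \<in> zassenhaus p S T n"
    and rho: "\<rho> \<in> hom S (UT (int p) n)"
      "dcont T (UT (int p) n) \<rho>"
  shows "\<rho> x = \<one>\<^bsub>UT (int p) n\<^esub>"
proof -
  interpret unitri_rep S T p 1 1 n \<rho>
    by unfold_locales (use prime rho in auto)
  have "x \<in> fil n" using zassenhaus_fil[OF refl n] x by blast
  moreover have "1 \<le> weight n d" if "1 \<le> d" "d < n" for d
    unfolding weight_def using that by simp
  ultimately have "\<rho> x = \<one>\<^bsub>UT (int p ^ 1) n\<^esub>" by (rule fil_kernel)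
  then show ?thesis by simp
qed

lemma p_central_kernel:
  assumes k: "1 \<le> k" "k \<le> n - 1" and x: "x \<in> p_central p S T n"
    and rho: "\<rho> \<in> hom S (UT (int p ^ (n - k)) (k + 1))"
      "dcont T (UT (int p ^ (n - k)) (k + 1)) \<rho>"
  shows "\<rho> x = \<one>\<^bsub>UT (int p ^ (n - k)) (k + 1)\<^esub>"
proof -
  interpret unitri_rep S T p "n - k" 1 "k + 1" \<rho>
    by unfold_locales (use prime rho k in auto)
  have "1 \<le> n" using k by simp
  then have "x \<in> fil n" using p_central_fil[OF refl] x by blast
  moreover have "n - k \<le> weight n d" if "1 \<le> d" "d < k + 1" for d
    unfolding weight_def using that by simp
  ultimately show ?thesis by (rule fil_kernel)
qed

end

theorem theorem2p6:
  fixes p :: nat and S :: "'a monoid" and T :: "'a topology" and n :: nat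
  assumes "Factorial_Ring.prime p" and "free_pro_p_group p S T" and "n \<ge> 1"
  shows "(zassenhaus p S T n =
           carrier S \<inter> \<Inter> {kernel S (unitri (residue_ring (int p)) n) \<rho> | \<rho>.
              \<rho> \<in> hom S (unitri (residue_ring (int p)) n) \<and>
              continuous_map T (discrete_topology (carrier (unitri (residue_ring (int p)) n))) \<rho>}) \<and>
         (lower_central S T n =
           carrier S \<inter> \<Inter> {kernel S (unitri (padic_int p) n) \<rho> | \<rho>.
              \<rho> \<in> hom S (unitri (padic_int p) n) \<and>
              continuous_map T (padic_unitri_topology p n) \<rho>}) \<and>
         (p_central p S T n =
           carrier S \<inter> \<Inter> {kernel S (unitri (residue_ring (int p ^ (n - k))) (k + 1)) \<rho> | \<rho> k.
              1 \<le> k \<and> k \<le> n - 1 \<and>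
              \<rho> \<in> hom S (unitri (residue_ring (int p ^ (n - k))) (k + 1)) \<and>
              continuous_map T (discrete_topology (carrier (unitri (residue_ring (int p ^ (n - k))) (k + 1)))) \<rho>})"
proof -
  obtain Y where "free_pro_p S T p Y" using free_pro_p_groupE[OF assms(1,2)] .
  then interpret free_pro_p S T p Y .
  let ?A = "\<lambda>\<rho>. \<rho> \<in> hom S (UT (int p) n) \<and>
    dcont T (UT (int p) n) \<rho>"
  let ?B = "\<lambda>\<rho>. \<rho> \<in> hom S (unitri (padic_int p) n) \<and> continuous_map T (padic_unitri_topology p n) \<rho>"
  let ?C = "\<lambda>\<rho> k. 1 \<le> k \<and> k \<le> n - 1 \<and> \<rho> \<in> hom S (UT (int p ^ (n - k)) (k + 1)) \<and>
    dcont T (UT (int p ^ (n - k)) (k + 1)) \<rho>"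
  have "x \<in> zassenhaus p S T n \<longleftrightarrow>
      x \<in> carrier S \<inter> \<Inter>{kernel S (UT (int p) n) \<rho> | \<rho>. ?A \<rho>}" for x
  proof
    assume x: "x \<in> zassenhaus p S T n"
    have "x \<in> carrier S" using x cnormal_mem(4)[OF cnormal_zassenhaus[OF p2]] by blast
    then show "x \<in> carrier S \<inter> \<Inter>{kernel S (UT (int p) n) \<rho> | \<rho>. ?A \<rho>}"
      using zassenhaus_kernel[OF assms(3) x] by (auto simp: kernel_def)
  next
    assume x: "x \<in> carrier S \<inter> \<Inter>{kernel S (UT (int p) n) \<rho> | \<rho>. ?A \<rho>}"
    show "x \<in> zassenhaus p S T n"
    proof (rule zassenhaus_detected)
      fix \<rho> assume "\<rho> \<in> hom S (UT (int p) n)"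
        "dcont T (UT (int p) n) \<rho>"
      then have "x \<in> kernel S (UT (int p) n) \<rho>" using x by blast
      then show "\<rho> x = \<one>\<^bsub>UT (int p) n\<^esub>" by (simp add: kernel_def)
    qed (use x in blast)
  qed
  moreover have "x \<in> lower_central S T n \<longleftrightarrow>
      x \<in> carrier S \<inter> \<Inter>{kernel S (unitri (padic_int p) n) \<rho> | \<rho>. ?B \<rho>}" for x
  proof
    assume x: "x \<in> lower_central S T n"
    have "x \<in> carrier S" using x cnormal_mem(4)[OF cnormal_lower_central] by blast
    then show "x \<in> carrier S \<inter> \<Inter>{kernel S (unitri (padic_int p) n) \<rho> | \<rho>. ?B \<rho>}"
      using lower_central_padic[OF assms(1,3) x] by (auto simp: kernel_def)
  next
    assume x: "x \<in> carrier S \<inter> \<Inter>{kernel S (unitri (padic_int p) n) \<rho> | \<rho>. ?B \<rho>}"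
    show "x \<in> lower_central S T n"
    proof (rule lower_central_detected)
      fix \<rho> assume "\<rho> \<in> hom S (unitri (padic_int p) n)" "continuous_map T (padic_unitri_topology p n) \<rho>"
      then have "x \<in> kernel S (unitri (padic_int p) n) \<rho>" using x by blast
      then show "\<rho> x = \<one>\<^bsub>unitri (padic_int p) n\<^esub>" by (simp add: kernel_def)
    qed (use x in blast)
  qed
  \<comment> \<open>For \<open>n = 1\<close> there is no admissible \<open>k\<close>; both sides are
    then the whole group.\<close>
  moreover have "x \<in> p_central p S T n \<longleftrightarrow>
      x \<in> carrier S \<inter> \<Inter>{kernel S (UT (int p ^ (n - k)) (k + 1)) \<rho> | \<rho> k. ?C \<rho> k}" for x
  proof
    assume x: "x \<in> p_central p S T n"
    have "x \<in> carrier S" using x cnormal_mem(4)[OF cnormal_p_central] by blast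
    then show "x \<in> carrier S \<inter> \<Inter>{kernel S (UT (int p ^ (n - k)) (k + 1)) \<rho> | \<rho> k. ?C \<rho> k}"
      using p_central_kernel[OF _ _ x] by (auto simp: kernel_def)
  next
    assume x: "x \<in> carrier S \<inter> \<Inter>{kernel S (UT (int p ^ (n - k)) (k + 1)) \<rho> | \<rho> k. ?C \<rho> k}"
    show "x \<in> p_central p S T n"
    proof (rule p_central_detected)
      fix k \<rho> assume "1 \<le> k" "k \<le> n - 1" "\<rho> \<in> hom S (UT (int p ^ (n - k)) (k + 1))"
        "dcont T (UT (int p ^ (n - k)) (k + 1)) \<rho>"
      then have "x \<in> kernel S (UT (int p ^ (n - k)) (k + 1)) \<rho>" using x by blast
      then show "\<rho> x = \<one>\<^bsub>UT (int p ^ (n - k)) (k + 1)\<^esub>" by (simp add: kernel_def)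
    qed (use x in blast)
  qed
  ultimately show ?thesis by blast
qed

end
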